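(* Let $\xi=(\xi_t)_{t\ge0}$ be a real-valued Lévy process started at $0$ (law $\mathbb{P}$) such that $\mu:=\mathbb{E}[\xi_1]\in(0,\infty)$, $\xi$ has local times, and $\xi$ is not a compound Poisson process. Let $f:\mathbb{R}\to[0,\infty)$ be a measurable, locally integrable function. Then $\mathbb{P}\big(\int_0^\infty f(\xi_s)\,ds<\infty\big)\in\{0,1\}$, and more precisely $$\mathbb{P}\Big(\int_0^\infty f(\xi_s)\,ds<\infty\Big)=1 \iff \int_a^\infty f(x)\,dx<\infty \text{ for some } a\in\mathbb{R},$$ $$\mathbb{P}\Big(\int_0^\infty f(\xi_s)\,ds<\infty\Big)=0 \iff \int_a^\infty f(x)\,dx=\infty \text{ for some (equivalently all) } a\in\mathbb{R}.$$
   Context: A Lévy process $\xi$ is said to have local times if there is a family $(L_t(x))_{t\ge0,x\in\mathbb{R}}$ of random variables such that for every bounded measurable $g:\mathbb{R}\to[0,\infty)$ the occupation time formula $\int_0^t g(\xi_s)\,ds=\int_{\mathbb{R}} g(x)L_t(x)\,dx$ holds almost surely for all $t\ge0$; equivalently, with characteristic exponent $\Psi(\lambda)=-\log\mathbb{E}[e^{i\lambda\xi_1}]$, one has $\int_{-\infty}^\infty \mathrm{Re}\big(\frac{1}{1+\Psi(r)}\big)\,dr<\infty$. *)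

theory Defs
  imports "HOL-Probability.Probability"
begin

text \<open>Real-valued Levy process started at 0, indexed by real times t \<ge> 0.
  Paths are required to be cadlag on [0,\<infinity>) for every outcome (one may always
  pass to such a version).\<close>
definition levy_process :: "'a measure \<Rightarrow> (real \<Rightarrow> 'a \<Rightarrow> real) \<Rightarrow> bool" where
  "levy_process M X \<longleftrightarrow>
     prob_space M \<and>
     (\<forall>t\<ge>0. X t \<in> borel_measurable M) \<and>
     (AE \<omega> in M. X 0 \<omega> = 0) \<and>
     (\<forall>tt :: nat \<Rightarrow> real. incseq tt \<and> tt 0 \<ge> 0 \<longrightarrow>
        prob_space.indep_vars M (\<lambda>_. borel) (\<lambda>i \<omega>. X (tt (Suc i)) \<omega> - X (tt i) \<omega>) UNIV) \<and>
     (\<forall>s\<ge>0. \<forall>t\<ge>0. distr M borel (\<lambda>\<omega>. X (s + t) \<omega> - X s \<omega>) = distr M borel (X t)) \<and>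
     (\<forall>\<omega>\<in>space M.
        (\<forall>t\<ge>0. ((\<lambda>s. X s \<omega>) \<longlongrightarrow> X t \<omega>) (at_right t)) \<and>
        (\<forall>t>0. \<exists>l. ((\<lambda>s. X s \<omega>) \<longlongrightarrow> l) (at_left t)))"

definition has_local_times :: "'a measure \<Rightarrow> (real \<Rightarrow> 'a \<Rightarrow> real) \<Rightarrow> bool" where
  "has_local_times M X \<longleftrightarrow>
     (\<exists>L :: real \<Rightarrow> real \<Rightarrow> 'a \<Rightarrow> real.
        (\<forall>t x. L t x \<in> borel_measurable M) \<and>
        (\<forall>g :: real \<Rightarrow> real. g \<in> borel_measurable borel \<and> (\<forall>x. g x \<ge> 0) \<and> bounded (range g) \<longrightarrow>
           (AE \<omega> in M. \<forall>t\<ge>0.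
              (\<integral>\<^sup>+ s\<in>{0..t}. ennreal (g (X s \<omega>)) \<partial>lborel)
              = (\<integral>\<^sup>+ x. ennreal (g x) * ennreal (L t x \<omega>) \<partial>lborel))))"

text \<open>A probability law on the reals is compound Poisson if its characteristic
  function is exp(\<lambda>(\<phi>_\<nu>(u) - 1)) for a rate \<lambda> \<ge> 0 and a probability law \<nu>
  (the jump distribution).  A Levy process is compound Poisson iff the law of
  X 1 is compound Poisson.\<close>
definition compound_poisson_law :: "real measure \<Rightarrow> bool" where
  "compound_poisson_law \<mu> \<longleftrightarrow>
     (\<exists>rate :: real. \<exists>\<nu> :: real measure. rate \<ge> 0 \<and> prob_space \<nu> \<and> sets \<nu> = sets borel \<and>
        (\<forall>u. char \<mu> u = exp (complex_of_real rate * (char \<nu> u - 1))))"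

definition compound_poisson_process :: "'a measure \<Rightarrow> (real \<Rightarrow> 'a \<Rightarrow> real) \<Rightarrow> bool" where
  "compound_poisson_process M X \<longleftrightarrow> levy_process M X \<and> compound_poisson_law (distr M borel (X 1))"

end

theory Submission
  imports Defs "HOL-Real_Asymp.Real_Asymp"
begin

text \<open>Let \<open>U\<close> be the potential measure, \<open>U A = E \<integral>\<^sub>0\<^sup>\<infinity> 1\<^sub>A(\<xi>\<^sub>s) ds\<close>. It suffices to show that \<open>U\<close> has
  a bounded density, and a density bounded away from 0 far to the right.

  Upper bound. A maximum principle for the discrete skeletons gives \<open>U I \<le> 2 U [-2h, 2h]\<close> for every
  interval \<open>I\<close> of length \<open>h\<close>, hence second moments of occupation times of small intervals are
  comparable to squared first moments. By Paley-Zygmund, the occupation time of the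
  \<open>\<epsilon>\<close>-neighbourhood of the current position exceeds half of \<open>m(\<epsilon>) = U [-\<epsilon>, \<epsilon>]\<close> with probability
  bounded below. If \<open>m(\<epsilon>) / \<epsilon>\<close> were unbounded, the set of such positions would become Lebesgue-null
  while keeping a positive share of the occupation measure; this is impossible since, by the
  existence of local times, the occupation measure is absolutely continuous. So
  \<open>\<integral>\<^sub>a\<^sup>\<infinity> f < \<infinity>\<close> gives finite expectations, and the path is bounded below.

  Lower bound. Integrability of \<open>\<xi>\<^sub>1\<close> bounds overshoots, so the walk \<open>\<xi>\<^sub>n\<close> visits every long
  interval far to the right with probability at least 1/2; Steinhaus' theorem and repeated
  convolution spread this out to \<open>U A \<ge> c |A|\<close>.

  If \<open>\<integral>\<^sub>a\<^sup>\<infinity> f = \<infinity>\<close> but the perpetual integral were at most \<open>K\<close> on an event \<open>B\<close> of positive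
  probability, then \<open>B\<close> is a decreasing limit of the events that the integral up to time \<open>n\<close> is at
  most \<open>K\<close>. These are independent of the later increments, so the occupation measure restricted to
  \<open>B\<close> still dominates a multiple of Lebesgue measure far to the right, which makes
  \<open>E [1\<^sub>B \<integral> f(\<xi>\<^sub>s) ds]\<close> infinite.\<close>

section \<open>Paths and filtration\<close>

text \<open>The obstacle behind the upper bound is a change of kind: local times give a random
  density of the occupation measure, path by path and without any bound, while a deterministic
  bounded density is wanted. The bridge is a second-moment comparison whose constant, 32, depends
  neither on the radius nor on the horizon; being scale-free, it lets a bad sequence of radii be
  played off against absolute continuity. Stopping times never appear: the maximum principle is an
  induction on the number of steps of a skeleton, and first passages are decomposed over dyadic
  grids, so independence of the past at a fixed time from a later increment suffices. Finite
  horizons come before the infinite one because the potential is not known to be finite at the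
  outset. For the lower bound, visits of the walk control long intervals only; general sets are seen
  through an absolutely continuous component, which the upper bound supplies. No zero-one law is
  invoked for the perpetual integral: divergence is contradicted on any event of positive
  probability, so both alternatives come out almost surely.\<close>

text \<open>Rounding by floor plus one, instead of ceiling, moves even grid points strictly to the
  right. The approximating times therefore live in \<open>at_right u\<close>, which is what right
  continuity of paths can be composed with.\<close>

lemma dyadic_ceiling_tendsto:
  fixes u d :: real and c :: "nat \<Rightarrow> real"
  assumes c: "\<And>j. c j > 0" "filterlim c at_top sequentially"
  shows "filterlim (\<lambda>j. (of_int (\<lfloor>u * c j\<rfloor> + 1)) / c j) (at_right u) sequentially"
  unfolding filterlim_at
proof (intro conjI)
  have *: "u < of_int (\<lfloor>u * c j\<rfloor> + 1) / c j" "of_int (\<lfloor>u * c j\<rfloor> + 1) / c j \<le> u + 1 / c j" for j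
  proof -
    show "u < of_int (\<lfloor>u * c j\<rfloor> + 1) / c j"
      using c(1)[of j] floor_correct[of "u * c j"] by (simp add: pos_less_divide_eq)
    have "of_int (\<lfloor>u * c j\<rfloor> + 1) \<le> u * c j + 1" by linarith
    then show "of_int (\<lfloor>u * c j\<rfloor> + 1) / c j \<le> u + 1 / c j"
      using c(1)[of j] by (simp add: field_simps)
  qed
  then show "\<forall>\<^sub>F j in sequentially. of_int (\<lfloor>u * c j\<rfloor> + 1) / c j \<in> {u<..} \<and> of_int (\<lfloor>u * c j\<rfloor> + 1) / c j \<noteq> u"
    by (intro always_eventually) (auto simp: less_imp_neq[symmetric])
  show "(\<lambda>j. of_int (\<lfloor>u * c j\<rfloor> + 1) / c j) \<longlonglongrightarrow> u"
  proof (rule tendsto_sandwich[of "\<lambda>_. u" _ _ "\<lambda>j. u + 1 / c j"])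
    have "(\<lambda>j. 1 / c j) \<longlonglongrightarrow> 0"
      using tendsto_inverse_0_at_top[OF c(2)] by (simp add: inverse_eq_divide)
    from tendsto_add[OF tendsto_const this]
    show "(\<lambda>j. u + 1 / c j) \<longlonglongrightarrow> u" by simp
  qed (use * less_imp_le in \<open>auto intro!: always_eventually\<close>)
qed

text \<open>At a fixed mesh the rounded time takes countably many values, so the discretised map is
  measurable by countable composition; right continuity makes it converge pointwise.\<close>

lemma measurable_right_continuous_pair:
  fixes Z :: "real \<Rightarrow> 'a \<Rightarrow> real"
  assumes meas: "\<And>t. Z t \<in> borel_measurable N"
    and rc: "\<And>\<omega> t. \<omega> \<in> space N \<Longrightarrow> ((\<lambda>s. Z s \<omega>) \<longlongrightarrow> Z t \<omega>) (at_right t)"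
  shows "(\<lambda>(\<omega>, t). Z t \<omega>) \<in> borel_measurable (N \<Otimes>\<^sub>M borel)"
proof (rule borel_measurable_LIMSEQ_metric)
  fix k :: nat
  have "(\<lambda>x. Z (of_int (i + 1) / real (Suc k)) (fst x)) \<in> borel_measurable (N \<Otimes>\<^sub>M (borel :: real measure))" for i
    by (rule measurable_compose[OF measurable_fst meas])
  from measurable_compose_countable[OF this, where g = "\<lambda>x. \<lfloor>snd x * real (Suc k)\<rfloor>"]
  show "(\<lambda>(\<omega>, t). Z (of_int (\<lfloor>t * real (Suc k)\<rfloor> + 1) / real (Suc k)) \<omega>) \<in> borel_measurable (N \<Otimes>\<^sub>M borel)"
    by (simp add: case_prod_beta')
next
  fix x :: "'a \<times> real"
  assume "x \<in> space (N \<Otimes>\<^sub>M borel)"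
  then obtain \<omega> t where x: "x = (\<omega>, t)" "\<omega> \<in> space N" by (auto simp: space_pair_measure)
  have "filterlim (\<lambda>k. real (Suc k)) at_top sequentially"
    by (rule filterlim_compose[OF filterlim_real_sequentially filterlim_Suc])
  from filterlim_compose[OF rc[OF x(2)] dyadic_ceiling_tendsto[OF _ this]]
  show "(\<lambda>k. case x of (\<omega>, t) \<Rightarrow> Z (of_int (\<lfloor>t * real (Suc k)\<rfloor> + 1) / real (Suc k)) \<omega>)
     \<longlonglongrightarrow> (case x of (\<omega>, t) \<Rightarrow> Z t \<omega>)"
    by (simp add: x)
qed

text \<open>Paths are extended by 0 to negative times, so that times can range over the whole line.\<close>

locale levy_paths = prob_space M for M :: "'a measure" +
  fixes Y :: "real \<Rightarrow> 'a \<Rightarrow> real"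
  assumes rv [measurable]: "Y t \<in> borel_measurable M"
    and zero: "t \<le> 0 \<Longrightarrow> Y t \<omega> = 0"
    and rcont: "\<omega> \<in> space M \<Longrightarrow> ((\<lambda>s. Y s \<omega>) \<longlongrightarrow> Y t \<omega>) (at_right t)"
    and indep_incr: "incseq tt \<Longrightarrow> tt 0 \<ge> 0 \<Longrightarrow>
      indep_vars (\<lambda>_. borel) (\<lambda>i \<omega>. Y (tt (Suc i)) \<omega> - Y (tt i) \<omega>) (UNIV :: nat set)"
    and stat: "s \<ge> 0 \<Longrightarrow> t \<ge> 0 \<Longrightarrow> distr M borel (\<lambda>\<omega>. Y (s + t) \<omega> - Y s \<omega>) = distr M borel (Y t)"
begin

lemma joint_measurable [measurable]: "(\<lambda>(\<omega>, t). Y t \<omega>) \<in> borel_measurable (M \<Otimes>\<^sub>M borel)"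
  by (rule measurable_right_continuous_pair[OF rv rcont])

lemma joint_measurable_compose [measurable (raw)]:
  assumes [measurable]: "f \<in> N \<rightarrow>\<^sub>M M" "g \<in> N \<rightarrow>\<^sub>M borel"
  shows "(\<lambda>x. Y (g x) (f x)) \<in> borel_measurable N"
proof -
  have "(\<lambda>x. (\<lambda>(\<omega>, t). Y t \<omega>) (f x, g x)) \<in> borel_measurable N"
    by measurable
  then show ?thesis by simp
qed

section \<open>The past of the path and the Markov property at fixed times\<close>

text \<open>The raw natural filtration, without added null sets: an event belongs to
  \<open>F s\<close> only if it is expressed literally through path values up to
  \<open>s\<close>.\<close>

definition F :: "real \<Rightarrow> 'a measure" where
  "F s = sigma (space M) (\<Union>u\<in>{..s}. {Y u -` A \<inter> space M | A. A \<in> sets borel})"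

lemma space_F [simp]: "space (F s) = space M"
  unfolding F_def by (rule space_measure_of) auto

lemma sets_F: "sets (F s) = sigma_sets (space M) (\<Union>u\<in>{..s}. {Y u -` A \<inter> space M | A. A \<in> sets borel})"
  unfolding F_def by (rule sets_measure_of) auto

lemma sets_F_mono: "s \<le> t \<Longrightarrow> sets (F s) \<subseteq> sets (F t)"
  unfolding sets_F by (intro sigma_sets_subseteq UN_mono) auto

lemma sets_F_subset: "sets (F s) \<subseteq> sets M"
  unfolding sets_F by (rule sets.sigma_sets_subset) auto

lemma id_measurable_F [measurable]: "(\<lambda>x. x) \<in> M \<rightarrow>\<^sub>M F s"
  using sets_F_subset sets.sets_into_space by (intro measurableI) (auto simp: Int_absorb2 subset_eq)

lemma rv_F: "u \<le> s \<Longrightarrow> Y u \<in> borel_measurable (F s)"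
  by (rule measurableI) (auto simp: sets_F intro!: sigma_sets.Basic)

text \<open>Capping time at \<open>s\<close> keeps every value inside the past while the time
  parameter still ranges over the whole line, so integrals of path functionals up to time
  \<open>s\<close> become \<open>F s\<close>-measurable. The capped path is constant after
  \<open>s\<close>, hence still right continuous.\<close>

lemma joint_measurable_F: "(\<lambda>(\<omega>, t). Y (min t s) \<omega>) \<in> borel_measurable (F s \<Otimes>\<^sub>M borel)"
proof (rule measurable_right_continuous_pair)
  show "Y (min t s) \<in> borel_measurable (F s)" for t
    by (rule rv_F) simp
  fix \<omega> t assume "\<omega> \<in> space (F s)"
  then have \<omega>: "\<omega> \<in> space M" by simp
  show "((\<lambda>u. Y (min u s) \<omega>) \<longlongrightarrow> Y (min t s) \<omega>) (at_right t)"
  proof (cases "t < s")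
    case True
    then have "\<forall>\<^sub>F u in at_right t. Y u \<omega> = Y (min u s) \<omega>"
      unfolding eventually_at_right_field by (intro exI[of _ s]) auto
    with rcont[OF \<omega>, of t] True show ?thesis
      by (simp add: tendsto_cong)
  next
    case False
    then have "\<forall>\<^sub>F u in at_right t. Y (min t s) \<omega> = Y (min u s) \<omega>"
      unfolding eventually_at_right_field by (intro exI[of _ "t + 1"]) (auto simp: min_def)
    then show ?thesis
      by (rule Lim_transform_eventually[OF tendsto_const])
  qed
qed

text \<open>The past before \<open>s\<close> is generated by the increasing algebras of dyadic skeletons, each of which
  is independent of the next increment by assumption.\<close>

lemma indep_past:
  assumes s: "0 \<le> s" and t: "0 \<le> t"
  shows "indep_set (sets (F s)) (sigma_sets (space M) {(\<lambda>\<omega>. Y (s + t) \<omega> - Y s \<omega>) -` A \<inter> space M | A. A \<in> sets borel})"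
proof -
  define gen where "gen j = (\<Union>i\<in>{..2^j::nat}. {Y (s * real i / 2^j) -` A \<inter> space M | A. A \<in> sets borel})" for j :: nat
  define D where "D j = sigma_sets (space M) (gen j)" for j
  define B where "B = sigma_sets (space M) {(\<lambda>\<omega>. Y (s + t) \<omega> - Y s \<omega>) -` A \<inter> space M | A. A \<in> sets borel}"
  have indepD: "indep_set (D j) B" for j
  proof -
    \<comment> \<open>Indices up to \<open>2^j\<close> run through the grid on
      \<open>{0..s}\<close>; every later index is sent to \<open>s + t\<close>. Increment number
      \<open>2^j\<close> is then the one of interest and all further increments vanish.\<close>
    define tt where "tt i = (if i \<le> 2^j then s * real i / 2^j else s + t)" for i :: nat
    define incr where "incr i \<omega> = Y (tt (Suc i)) \<omega> - Y (tt i) \<omega>" for i \<omega>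
    have [measurable]: "incr i \<in> borel_measurable M" for i
      unfolding incr_def by measurable
    have mono: "incseq tt"
    proof (rule incseq_SucI)
      fix i show "tt i \<le> tt (Suc i)"
      proof (cases "Suc i \<le> 2^j")
        case True then show ?thesis using s by (auto simp: tt_def divide_right_mono mult_left_mono)
      next
        case False
        have "s * real i / 2^j \<le> s + t" if "i \<le> 2^j"
        proof -
          have "real i \<le> 2^j" using that by (metis of_nat_le_iff of_nat_numeral of_nat_power)
          then have "s * real i / 2^j \<le> s" using s by (simp add: divide_le_eq mult_left_mono)
          then show ?thesis using t by simp
        qed
        with False show ?thesis by (auto simp: tt_def)
      qed
    qed
    have iv: "indep_vars (\<lambda>_. borel) incr (UNIV :: nat set)"
      using indep_incr[OF mono] by (simp add: tt_def incr_def[abs_def])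
    let ?R = "\<lambda>\<omega>. \<lambda>i\<in>{..<2^j::nat}. incr i \<omega>"
    let ?S = "\<lambda>\<omega>. \<lambda>i\<in>{2^j::nat}. incr i \<omega>"
    have Smeas[measurable]: "?S \<in> M \<rightarrow>\<^sub>M PiM {2^j} (\<lambda>_. borel)"
      by measurable
    have iv2: "indep_var (PiM {..<2^j} (\<lambda>_. borel)) ?R (PiM {2^j} (\<lambda>_. borel)) ?S"
      by (rule indep_var_restrict[OF iv]) auto
    have incr: "(\<lambda>\<omega>. Y (s + t) \<omega> - Y s \<omega>) = incr (2^j)"
      by (auto simp: incr_def tt_def fun_eq_iff)
    have "B \<subseteq> sigma_sets (space M) {?S -` A \<inter> space M | A. A \<in> sets (PiM {2^j} (\<lambda>_. borel))}"
      unfolding B_def incr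
    proof (rule sigma_sets_mono, safe)
      fix A :: "real set" assume A: "A \<in> sets borel"
      have m: "(\<lambda>x. x (2^j)) -` A \<inter> space (PiM {2^j} (\<lambda>_. borel)) \<in> sets (PiM {2^j::nat} (\<lambda>_. borel :: real measure))"
        by (rule measurable_sets[OF _ A]) (rule measurable_component_singleton, simp)
      have "incr (2^j) -` A \<inter> space M = ?S -` ((\<lambda>x. x (2^j)) -` A \<inter> space (PiM {2^j} (\<lambda>_. borel))) \<inter> space M"
        using measurable_space[OF Smeas] by auto
      with m show "incr (2^j) -` A \<inter> space M \<in> sigma_sets (space M) {?S -` A \<inter> space M | A. A \<in> sets (PiM {2^j} (\<lambda>_. borel))}"
        by (intro sigma_sets.Basic) blast
    qed
    with iv2 have past: "indep_set (sigma_sets (space M) {?R -` A \<inter> space M | A. A \<in> sets (PiM {..<2^j} (\<lambda>_. borel))}) B"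
      unfolding indep_var_eq indep_sets2_eq by blast
    have Rmeas[measurable]: "?R \<in> M \<rightarrow>\<^sub>M PiM {..<2^j} (\<lambda>_. borel)"
      by measurable
    have "D j \<subseteq> sigma_sets (space M) {?R -` A \<inter> space M | A. A \<in> sets (PiM {..<2^j} (\<lambda>_. borel))}"
      unfolding D_def
    proof (rule sigma_sets_mono)
      show "gen j \<subseteq> sigma_sets (space M) {?R -` A \<inter> space M | A. A \<in> sets (PiM {..<2^j} (\<lambda>_. borel))}"
      proof
        fix E assume "E \<in> gen j"
        then obtain i A where i: "i \<le> 2^j" and A: "A \<in> sets borel" and E: "E = Y (s * real i / 2^j) -` A \<inter> space M"
          by (auto simp: gen_def)
        have "(\<lambda>x. \<Sum>k<i. x k) \<in> borel_measurable (PiM {..<2^j} (\<lambda>_. borel :: real measure))"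
          using i by (intro borel_measurable_sum measurable_component_singleton) auto
        then have ms: "(\<lambda>x. \<Sum>k<i. x k) -` A \<inter> space (PiM {..<2^j} (\<lambda>_. borel)) \<in> sets (PiM {..<2^j} (\<lambda>_. borel :: real measure))"
          using A by (rule measurable_sets)
        \<comment> \<open>Paths start exactly at 0, so a grid value is the sum of the increments
          before it and is a function of those with index below \<open>2^j\<close> only.\<close>
        have tele: "(\<Sum>k<i. incr k \<omega>) = Y (s * real i / 2^j) \<omega>" for \<omega>
          unfolding incr_def sum_lessThan_telescope[of "\<lambda>i. Y (tt i) \<omega>"]
          using i by (simp add: tt_def zero)
        have "E = ?R -` ((\<lambda>x. \<Sum>k<i. x k) -` A \<inter> space (PiM {..<2^j} (\<lambda>_. borel))) \<inter> space M"
          using i measurable_space[OF Rmeas] by (auto simp: E tele[symmetric])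
        with ms show "E \<in> sigma_sets (space M) {?R -` A \<inter> space M | A. A \<in> sets (PiM {..<2^j} (\<lambda>_. borel))}"
          by (intro sigma_sets.Basic) blast
      qed
    qed
    with past show ?thesis unfolding indep_sets2_eq by blast
  qed
  have Dmono: "D j \<subseteq> D k" if "j \<le> k" for j k
  proof -
    have "gen j \<subseteq> gen (Suc j)" for j
    proof
      fix E assume "E \<in> gen j"
      then obtain i A where i: "i \<le> 2^j" and A: "A \<in> sets borel" and E: "E = Y (s * real i / 2^j) -` A \<inter> space M"
        by (auto simp: gen_def)
      have "s * real i / 2^j = s * real (2 * i) / 2^Suc j" by simp
      with i A show "E \<in> gen (Suc j)"
        unfolding gen_def E by (intro UN_I[of "2 * i"]) auto
    qed
    then have "gen j \<subseteq> gen k" using lift_Suc_mono_le[of gen j k] that by blast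
    then show ?thesis unfolding D_def by (rule sigma_sets_subseteq)
  qed
  have DM: "D j \<subseteq> sets M" for j
    unfolding D_def gen_def by (rule sets.sigma_sets_subset) auto
  have "indep_set (sigma_sets (space M) (\<Union>j. D j)) (sigma_sets (space M) B)"
  proof (rule indep_set_sigma_sets)
    show "indep_set (\<Union>j. D j) B"
      using indepD unfolding indep_sets2_eq by blast
    show "Int_stable (\<Union>j. D j)"
    proof (rule Int_stableI)
      fix a b assume "a \<in> (\<Union>j. D j)" "b \<in> (\<Union>j. D j)"
      then obtain j k where "a \<in> D j" "b \<in> D k" by auto
      with Dmono[of j "max j k"] Dmono[of k "max j k"]
      have "a \<in> D (max j k)" "b \<in> D (max j k)" by auto
      moreover have "sigma_algebra (space M) (D (max j k))"
        unfolding D_def by (rule sigma_algebra_sigma_sets) (auto simp: gen_def)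
      ultimately have "a \<inter> b \<in> D (max j k)"
        using sigma_algebra.axioms(1) algebra.Int_stable Int_stableD
        by (metis algebra_iff_Int sigma_algebra_def sigma_sets_Un algebra.axioms(1) ring_of_sets.axioms(1) semiring_of_sets.Int)
      then show "a \<inter> b \<in> (\<Union>j. D j)" by blast
    qed
    have "sigma_algebra (space M) B"
      unfolding B_def by (rule sigma_algebra_sigma_sets) auto
    then show "Int_stable B"
      by (metis algebra.Int_stable sigma_algebra.axioms(1))
  qed
  moreover have "sigma_sets (space M) B = B"
    unfolding B_def by (rule sigma_sets_sigma_sets_eq) auto
  ultimately have ind: "indep_set (sigma_sets (space M) (\<Union>j. D j)) B" by simp
  define N where "N = sigma (space M) (\<Union>j. D j)"
  have Dpow: "(\<Union>j. D j) \<subseteq> Pow (space M)" using DM sets.sets_into_space by blast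
  have spN: "space N = space M" unfolding N_def using Dpow by (rule space_measure_of)
  have seN: "sets N = sigma_sets (space M) (\<Union>j. D j)" unfolding N_def using Dpow by (rule sets_measure_of)
  have grid: "Y (s * real i / 2^j) \<in> borel_measurable N" if "i \<le> 2^j" for i j :: nat
    using that by (intro measurableI) (auto simp: spN seN D_def gen_def intro!: sigma_sets.Basic)
  have YN: "Y u \<in> borel_measurable N" if "u \<le> s" for u
  proof -
    consider "u \<le> 0" | "u = s" | "0 < u" "u < s" using \<open>u \<le> s\<close> by linarith
    then show ?thesis
    proof cases
      case 1
      then have "Y u = (\<lambda>_. 0)" by (auto simp: zero)
      then show ?thesis by simp
    next
      case 2
      then show ?thesis using grid[of 1 0] by simp
    next
      case 3
      let ?c = "\<lambda>j. 2^j / s :: real"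
      have c: "?c j > 0" for j using 3 by simp
      have "filterlim ?c at_top sequentially"
        using 3 by real_asymp
      note lim = dyadic_ceiling_tendsto[OF c this, of u]
      show ?thesis
      proof (rule borel_measurable_LIMSEQ_metric)
        fix j :: nat
        let ?i = "nat (\<lfloor>u * ?c j\<rfloor> + 1)"
        \<comment> \<open>For \<open>u < s\<close> the rounded-up index is still at most
          \<open>2^j\<close>, so the approximating times never leave the grid on
          \<open>{0..s}\<close>. At \<open>u = s\<close> this would fail, whence the separate
          case.\<close>
        have "u * ?c j < 2^j" using 3 by (simp add: field_simps)
        then have "\<lfloor>u * ?c j\<rfloor> < 2^j" by (simp add: floor_less_iff)
        then have le: "?i \<le> 2^j" by (simp add: nat_le_iff)
        have nn: "0 \<le> \<lfloor>u * ?c j\<rfloor>" using 3 by simp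
        then have "real ?i = of_int (\<lfloor>u * ?c j\<rfloor> + 1)" by linarith
        then have "s * real ?i / 2^j = of_int (\<lfloor>u * ?c j\<rfloor> + 1) / ?c j" by (simp only:) simp
        with grid[OF le] 3 show "Y (of_int (\<lfloor>u * ?c j\<rfloor> + 1) / ?c j) \<in> borel_measurable N" by (simp add: mult.commute)
      next
        fix \<omega> assume "\<omega> \<in> space N"
        then show "(\<lambda>j. Y (of_int (\<lfloor>u * ?c j\<rfloor> + 1) / ?c j) \<omega>) \<longlonglongrightarrow> Y u \<omega>"
          using filterlim_compose[OF rcont lim, of \<omega>] spN by simp
      qed
    qed
  qed
  have "sets (F s) \<subseteq> sets N"
    unfolding sets_F spN[symmetric] using measurable_sets[OF YN]
    by (intro sets.sigma_sets_subset) (auto simp: spN)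
  with ind have "indep_set (sets (F s)) B"
    unfolding indep_sets2_eq seN by blast
  then show ?thesis unfolding B_def .
qed

text \<open>Independence of past and increment makes their joint law a product; stationarity then
  replaces the increment by an independent copy of \<open>Y t\<close>. The past enters as the
  identity map into \<open>F s\<close>, so \<open>g\<close> may depend on it arbitrarily.\<close>

lemma markov:
  assumes s: "0 \<le> s" and t: "0 \<le> t" and g [measurable]: "g \<in> borel_measurable (F s \<Otimes>\<^sub>M borel)"
  shows "(\<integral>\<^sup>+\<omega>. g (\<omega>, Y (s + t) \<omega> - Y s \<omega>) \<partial>M) = (\<integral>\<^sup>+\<omega>. (\<integral>\<^sup>+\<omega>'. g (\<omega>, Y t \<omega>') \<partial>M) \<partial>M)"
proof -
  let ?Z = "\<lambda>\<omega>. Y (s + t) \<omega> - Y s \<omega>"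
  interpret P: prob_space "distr M borel (Y t)" by (rule prob_space_distr) measurable
  interpret Q: prob_space "distr M (F s) (\<lambda>\<omega>. \<omega>)" by (rule prob_space_distr) measurable
  have eq: "distr M (F s) (\<lambda>\<omega>. \<omega>) \<Otimes>\<^sub>M distr M borel (Y t) = distr M (F s \<Otimes>\<^sub>M borel) (\<lambda>\<omega>. (\<omega>, ?Z \<omega>))"
  proof (rule pair_measure_eqI)
    fix A B assume A: "A \<in> sets (distr M (F s) (\<lambda>\<omega>. \<omega>))" and "B \<in> sets (distr M borel (Y t))"
    then have AF: "A \<in> sets (F s)" and B [measurable]: "B \<in> sets borel" by auto
    then have [measurable]: "A \<in> sets M" using sets_F_subset by blast
    have "emeasure (distr M borel (Y t)) B = emeasure M (?Z -` B \<inter> space M)"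
      unfolding stat[OF s t, symmetric] by (rule emeasure_distr) measurable
    moreover have "emeasure (distr M (F s) (\<lambda>\<omega>. \<omega>)) A = emeasure M A"
      using AF sets.sets_into_space[of A M] by (subst emeasure_distr) (auto simp: Int_absorb2)
    moreover have "emeasure (distr M (F s \<Otimes>\<^sub>M borel) (\<lambda>\<omega>. (\<omega>, ?Z \<omega>))) (A \<times> B) = emeasure M (A \<inter> (?Z -` B \<inter> space M))"
      using AF by (subst emeasure_distr) (auto intro!: arg_cong[where f="emeasure M"] dest: sets.sets_into_space)
    moreover have "prob (A \<inter> (?Z -` B \<inter> space M)) = prob A * prob (?Z -` B \<inter> space M)"
      using indep_past[OF s t] AF B unfolding indep_sets2_eq by (blast intro: sigma_sets.Basic)
    ultimately show "emeasure (distr M (F s) (\<lambda>\<omega>. \<omega>)) A * emeasure (distr M borel (Y t)) B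
        = emeasure (distr M (F s \<Otimes>\<^sub>M borel) (\<lambda>\<omega>. (\<omega>, ?Z \<omega>))) (A \<times> B)"
      by (simp add: emeasure_eq_measure ennreal_mult)
  qed (simp_all add: P.sigma_finite_measure_axioms Q.sigma_finite_measure_axioms cong: sets_pair_measure_cong)
  have "(\<integral>\<^sup>+\<omega>. g (\<omega>, ?Z \<omega>) \<partial>M) = (\<integral>\<^sup>+x. g x \<partial>distr M (F s \<Otimes>\<^sub>M borel) (\<lambda>\<omega>. (\<omega>, ?Z \<omega>)))"
    by (subst nn_integral_distr) measurable
  also have "\<dots> = (\<integral>\<^sup>+\<omega>. (\<integral>\<^sup>+z. g (\<omega>, z) \<partial>distr M borel (Y t)) \<partial>distr M (F s) (\<lambda>\<omega>. \<omega>))"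
    unfolding eq[symmetric] by (subst P.nn_integral_fst[symmetric]) simp_all
  also have "\<dots> = (\<integral>\<^sup>+\<omega>. (\<integral>\<^sup>+z. g (\<omega>, z) \<partial>distr M borel (Y t)) \<partial>M)"
    by (rule nn_integral_distr) (simp_all add: P.borel_measurable_nn_integral)
  also have "\<dots> = (\<integral>\<^sup>+\<omega>. (\<integral>\<^sup>+\<omega>'. g (\<omega>, Y t \<omega>') \<partial>M) \<partial>M)"
    by (intro nn_integral_cong nn_integral_distr) (simp_all add: measurable_Pair2'[THEN measurable_compose])
  finally show ?thesis .
qed

end

section \<open>Transition probabilities and the potential measure\<close>

lemma ennreal_half: "(1/2 :: ennreal) = ennreal (1/2)"
  by (metis divide_ennreal ennreal_1 ennreal_numeral zero_le_one zero_less_numeral zero_le_numeral)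

lemma ennreal_quarter: "(1/4 :: ennreal) = ennreal (1/4)"
  by (metis divide_ennreal ennreal_1 ennreal_numeral zero_le_one zero_less_numeral zero_le_numeral)

lemma nn_integral_shift:
  fixes \<phi> :: "real \<Rightarrow> ennreal"
  assumes [measurable]: "\<phi> \<in> borel_measurable borel"
  shows "(\<integral>\<^sup>+t. \<phi> (c + t) \<partial>lborel) = (\<integral>\<^sup>+t. \<phi> t \<partial>lborel)"
  using nn_integral_real_affine[of \<phi> 1 c] by simp

lemma emeasure_lborel_translate:
  assumes "A \<in> sets borel"
  shows "(\<lambda>z. z + y) -` A \<in> sets borel" "emeasure lborel ((\<lambda>z. z + y :: real) -` A) = emeasure lborel A"
proof -
  show B: "(\<lambda>z. z + y) -` A \<in> sets borel"
    using measurable_sets[of "\<lambda>z. z + y" borel borel A] assms by simp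
  have "emeasure lborel ((\<lambda>z. z + y) -` A) = (\<integral>\<^sup>+z. indicator ((\<lambda>z. z + y) -` A) z \<partial>lborel)"
    using B by simp
  also have "\<dots> = (\<integral>\<^sup>+z. indicator A (y + z) \<partial>lborel)"
    by (intro nn_integral_cong) (simp add: indicator_def add.commute)
  also have "\<dots> = (\<integral>\<^sup>+z. indicator A z \<partial>lborel)"
    using assms by (intro nn_integral_shift) simp
  finally show "emeasure lborel ((\<lambda>z. z + y) -` A) = emeasure lborel A"
    using assms by simp
qed

lemma nn_integral_segments:
  fixes \<phi> :: "real \<Rightarrow> ennreal"
  assumes [measurable]: "\<phi> \<in> borel_measurable borel" and d: "0 \<le> d"
  shows "(\<integral>\<^sup>+t\<in>{0..<real N * d}. \<phi> t \<partial>lborel) = (\<Sum>k<N. \<integral>\<^sup>+s\<in>{0..<d}. \<phi> (real k * d + s) \<partial>lborel)"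
proof (induction N)
  case (Suc N)
  have "indicator {0..<D + d} t = (indicator {0..<D} t + indicator {0..<d} (t - D) :: ennreal)"
    if "0 \<le> D" for D t :: real
    using d that by (auto simp: indicator_def)
  from this[of "real N * d"] d
  have ind: "indicator {0..<real (Suc N) * d} t =
      (indicator {0..<real N * d} t + indicator {0..<d} (t - real N * d) :: ennreal)" for t
    by (simp add: algebra_simps)
  have "(\<integral>\<^sup>+t\<in>{0..<real (Suc N) * d}. \<phi> t \<partial>lborel) =
     (\<integral>\<^sup>+t\<in>{0..<real N * d}. \<phi> t \<partial>lborel) + (\<integral>\<^sup>+t. \<phi> t * indicator {0..<d} (t - real N * d) \<partial>lborel)"
    unfolding ind by (simp add: distrib_left nn_integral_add)
  also have "(\<integral>\<^sup>+t. \<phi> t * indicator {0..<d} (t - real N * d) \<partial>lborel)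
     = (\<integral>\<^sup>+s\<in>{0..<d}. \<phi> (real N * d + s) \<partial>lborel)"
    by (subst nn_integral_shift[symmetric, where c = "real N * d"]) simp_all
  finally show ?case by (simp add: Suc.IH)
qed simp

lemma nn_integral_horizon:
  fixes \<phi> :: "real \<Rightarrow> ennreal"
  assumes [measurable]: "\<phi> \<in> borel_measurable borel"
  shows "(\<integral>\<^sup>+t\<in>{0..}. \<phi> t \<partial>lborel) = (SUP n. \<integral>\<^sup>+t\<in>{0..<real n}. \<phi> t \<partial>lborel)"
proof -
  have "(SUP n. \<phi> t * indicator {0..<real n} t) = \<phi> t * indicator {0..} t" for t
  proof (cases "0 \<le> t")
    case True
    obtain m where m: "t < real m" using reals_Archimedean2 by blast
    show ?thesis
    proof (rule antisym)
      show "(SUP n. \<phi> t * indicator {0..<real n} t) \<le> \<phi> t * indicator {0..} t"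
        by (rule SUP_least) (auto simp: indicator_def)
      show "\<phi> t * indicator {0..} t \<le> (SUP n. \<phi> t * indicator {0..<real n} t)"
        by (rule SUP_upper2[of m]) (use m True in auto)
    qed
  qed simp
  then have "(\<integral>\<^sup>+t\<in>{0..}. \<phi> t \<partial>lborel) = (\<integral>\<^sup>+t. (SUP n. \<phi> t * indicator {0..<real n} t) \<partial>lborel)"
    by simp
  also have "\<dots> = (SUP n. \<integral>\<^sup>+t\<in>{0..<real n}. \<phi> t \<partial>lborel)"
    by (rule nn_integral_monotone_convergence_SUP)
       (auto simp: incseq_def le_fun_def indicator_def)
  finally show ?thesis .
qed

context levy_paths
begin

definition p :: "real \<Rightarrow> real set \<Rightarrow> real \<Rightarrow> ennreal" where
  "p t A y = emeasure M {\<omega> \<in> space M. y + Y t \<omega> \<in> A}"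

text \<open>The potential kernel restricted to a time set \<open>J\<close>. Keeping \<open>J\<close>
  as a parameter allows the arguments to run first on bounded horizons, where all masses are
  finite.\<close>

definition pot :: "real set \<Rightarrow> real set \<Rightarrow> real \<Rightarrow> ennreal" where
  "pot J A y = (\<integral>\<^sup>+t\<in>J. p t A y \<partial>lborel)"

definition occ :: "real set \<Rightarrow> real set \<Rightarrow> 'a \<Rightarrow> ennreal" where
  "occ J A \<omega> = (\<integral>\<^sup>+t\<in>J. indicator A (Y t \<omega>) \<partial>lborel)"

lemma p_nn_integral:
  assumes [measurable]: "A \<in> sets borel"
  shows "p t A y = (\<integral>\<^sup>+\<omega>. indicator A (y + Y t \<omega>) \<partial>M)"
proof -
  have "(\<integral>\<^sup>+\<omega>. indicator A (y + Y t \<omega>) \<partial>M) = (\<integral>\<^sup>+\<omega>. indicator {\<omega> \<in> space M. y + Y t \<omega> \<in> A} \<omega> \<partial>M)"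
    by (rule nn_integral_cong) (simp add: indicator_def)
  also have "\<dots> = p t A y" unfolding p_def by (rule nn_integral_indicator) measurable
  finally show ?thesis by simp
qed

lemma p_measurable [measurable (raw)]:
  assumes [measurable]: "f \<in> borel_measurable N" "g \<in> borel_measurable N" "A \<in> sets borel"
  shows "(\<lambda>x. p (f x) A (g x)) \<in> borel_measurable N"
  unfolding p_nn_integral[OF assms(3)] by measurable

lemma pot_measurable [measurable (raw)]:
  assumes [measurable]: "g \<in> borel_measurable N" "A \<in> sets borel" "J \<in> sets borel"
  shows "(\<lambda>x. pot J A (g x)) \<in> borel_measurable N"
  unfolding pot_def by measurable

lemma p_le_1: "p t A y \<le> 1"
  unfolding p_def using emeasure_space_1 emeasure_space by metis

lemma p_mono: "A \<subseteq> B \<Longrightarrow> B \<in> sets borel \<Longrightarrow> p t A y \<le> p t B y"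
  unfolding p_def by (rule emeasure_mono) auto

lemma p_0: "p 0 A y = indicator A y"
  unfolding p_def using zero emeasure_space_1 by (auto simp: indicator_def)

lemma p_shift: "p t A y = p t {z. z + y \<in> A} 0"
  unfolding p_def by (simp add: add.commute)

lemma pot_shift: "pot J A y = pot J ((\<lambda>z. z + y) -` A) 0"
  unfolding pot_def vimage_def by (subst p_shift) simp

lemma pot_mono: "A \<subseteq> B \<Longrightarrow> B \<in> sets borel \<Longrightarrow> pot J A y \<le> pot J B y"
  unfolding pot_def by (intro nn_integral_mono mult_right_mono p_mono) auto

lemma pot_mono_time: "J \<subseteq> K \<Longrightarrow> pot J A y \<le> pot K A y"
  unfolding pot_def by (intro nn_integral_mono mult_left_mono) (auto simp: indicator_def)

lemma pot_subadditive:
  assumes [measurable]: "A \<in> sets borel" "B \<in> sets borel" "J \<in> sets borel"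
  shows "pot J (A \<union> B) y \<le> pot J A y + pot J B y"
proof -
  have "p t (A \<union> B) y \<le> p t A y + p t B y" for t
  proof -
    have "p t (A \<union> B) y = (\<integral>\<^sup>+\<omega>. indicator (A \<union> B) (y + Y t \<omega>) \<partial>M)"
      by (rule p_nn_integral) measurable
    also have "\<dots> \<le> (\<integral>\<^sup>+\<omega>. indicator A (y + Y t \<omega>) + indicator B (y + Y t \<omega>) \<partial>M)"
      by (intro nn_integral_mono) (simp add: indicator_def)
    also have "\<dots> = p t A y + p t B y"
      by (subst nn_integral_add) (auto simp: p_nn_integral)
    finally show ?thesis .
  qed
  then have "pot J (A \<union> B) y \<le> (\<integral>\<^sup>+t. p t A y * indicator J t + p t B y * indicator J t \<partial>lborel)"
    unfolding pot_def distrib_right[symmetric] by (intro nn_integral_mono mult_right_mono) auto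
  also have "\<dots> = pot J A y + pot J B y"
    unfolding pot_def by (rule nn_integral_add) measurable
  finally show ?thesis .
qed

lemma pot_horizon:
  assumes [measurable]: "A \<in> sets borel"
  shows "pot {0..} A y = (SUP n. pot {0..<real n} A y)"
  unfolding pot_def by (rule nn_integral_horizon) measurable

lemma markov_p:
  assumes s: "0 \<le> s" and t: "0 \<le> t" and [measurable]: "h \<in> borel_measurable (F s)" "Z \<in> borel_measurable (F s)" "A \<in> sets borel"
  shows "(\<integral>\<^sup>+\<omega>. h \<omega> * indicator A (Z \<omega> + (Y (s + t) \<omega> - Y s \<omega>)) \<partial>M) = (\<integral>\<^sup>+\<omega>. h \<omega> * p t A (Z \<omega>) \<partial>M)"
proof -
  have "(\<integral>\<^sup>+\<omega>. h \<omega> * indicator A (Z \<omega> + (Y (s + t) \<omega> - Y s \<omega>)) \<partial>M)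
    = (\<integral>\<^sup>+\<omega>. (\<integral>\<^sup>+\<omega>'. h \<omega> * indicator A (Z \<omega> + Y t \<omega>') \<partial>M) \<partial>M)"
    using markov[OF s t, of "\<lambda>(\<omega>, z). h \<omega> * indicator A (Z \<omega> + z)"] by simp
  also have "\<dots> = (\<integral>\<^sup>+\<omega>. h \<omega> * p t A (Z \<omega>) \<partial>M)"
    by (intro nn_integral_cong, subst p_nn_integral) (simp_all add: nn_integral_cmult)
  finally show ?thesis .
qed

lemma chapman_kolmogorov:
  assumes s: "0 \<le> s" and t: "0 \<le> t" and [measurable]: "A \<in> sets borel"
  shows "p (s + t) A y = (\<integral>\<^sup>+\<omega>. p t A (y + Y s \<omega>) \<partial>M)"
proof -
  have [measurable]: "Y s \<in> borel_measurable (F s)" by (rule rv_F) simp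
  show ?thesis
    using markov_p[OF s t, of "\<lambda>_. 1" "\<lambda>\<omega>. y + Y s \<omega>" A] by (simp add: p_nn_integral add_ac)
qed

section \<open>Maximum principle and bounds uniform in the starting point\<close>

text \<open>Induction on the number of steps replaces stopping at the first visit. From outside the
  interval the zeroth term vanishes and one step leaves a sum of fewer terms started elsewhere; from
  inside, the interval shifted by the starting point fits into the symmetric window.\<close>

lemma skeleton_maximum_principle:
  assumes d: "0 \<le> d"
  shows "(\<Sum>k<N. p (real k * d) {a..b} y) \<le> (\<Sum>k<N. p (real k * d) {-(b-a)..b-a} 0)"
proof (induction N arbitrary: y)
  case (Suc N)
  show ?case
  proof (cases "y \<in> {a..b}")
    case True
    then show ?thesis
      by (intro sum_mono, subst p_shift, intro p_mono) auto
  next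
    case False
    have "(\<Sum>k<Suc N. p (real k * d) {a..b} y) = (\<Sum>k<N. p (real (Suc k) * d) {a..b} y)"
      using False by (simp add: sum.lessThan_Suc_shift p_0 del: sum.lessThan_Suc of_nat_Suc)
    also have "\<dots> = (\<Sum>k<N. \<integral>\<^sup>+\<omega>. p (real k * d) {a..b} (y + Y d \<omega>) \<partial>M)"
      using d by (intro sum.cong refl, subst chapman_kolmogorov[symmetric]) (auto simp: algebra_simps)
    also have "\<dots> = (\<integral>\<^sup>+\<omega>. (\<Sum>k<N. p (real k * d) {a..b} (y + Y d \<omega>)) \<partial>M)"
      by (rule nn_integral_sum[symmetric]) measurable
    also have "\<dots> \<le> (\<integral>\<^sup>+\<omega>. (\<Sum>k<N. p (real k * d) {-(b-a)..b-a} 0) \<partial>M)"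
      by (intro nn_integral_mono Suc.IH)
    also have "\<dots> \<le> (\<Sum>k<Suc N. p (real k * d) {-(b-a)..b-a} 0)"
      by (simp add: emeasure_space_1)
    finally show ?thesis .
  qed
qed simp

text \<open>For each offset in \<open>{0..<d}\<close> the path at times congruent to the offset is a
  skeleton with a random starting point, and the maximum principle does not see the starting point.
  Integrating over offsets gives the factor \<open>d\<close>.\<close>

lemma pot_le_skeleton:
  assumes d: "0 \<le> d"
  shows "pot {0..<real N * d} {a..b} y \<le> ennreal d * (\<Sum>k<N. p (real k * d) {-(b-a)..b-a} 0)"
proof -
  let ?S = "\<Sum>k<N. p (real k * d) {-(b-a)..b-a} 0"
  have "pot {0..<real N * d} {a..b} y = (\<Sum>k<N. \<integral>\<^sup>+s\<in>{0..<d}. p (real k * d + s) {a..b} y \<partial>lborel)"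
    unfolding pot_def by (rule nn_integral_segments[OF _ d]) measurable
  also have "\<dots> = (\<integral>\<^sup>+s. (\<Sum>k<N. p (real k * d + s) {a..b} y * indicator {0..<d} s) \<partial>lborel)"
    by (rule nn_integral_sum[symmetric]) measurable
  also have "\<dots> \<le> (\<integral>\<^sup>+s\<in>{0..<d}. ?S \<partial>lborel)"
  proof (intro nn_integral_mono)
    fix s
    show "(\<Sum>k<N. p (real k * d + s) {a..b} y * indicator {0..<d} s) \<le> ?S * indicator {0..<d} s"
    proof (cases "s \<in> {0..<d}")
      case True
      have "(\<Sum>k<N. p (real k * d + s) {a..b} y) = (\<Sum>k<N. \<integral>\<^sup>+\<omega>. p (real k * d) {a..b} (y + Y s \<omega>) \<partial>M)"
        using True by (intro sum.cong refl, subst chapman_kolmogorov[symmetric]) (auto simp: algebra_simps)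
      also have "\<dots> = (\<integral>\<^sup>+\<omega>. (\<Sum>k<N. p (real k * d) {a..b} (y + Y s \<omega>)) \<partial>M)"
        by (rule nn_integral_sum[symmetric]) measurable
      also have "\<dots> \<le> (\<integral>\<^sup>+\<omega>. ?S \<partial>M)"
        by (intro nn_integral_mono skeleton_maximum_principle d)
      finally show ?thesis using True by (simp add: emeasure_space_1)
    qed simp
  qed
  also have "\<dots> = ennreal d * ?S"
    by (subst nn_integral_cmult_indicator) (use d in \<open>auto simp: mult.commute\<close>)
  finally show ?thesis .
qed

text \<open>A visit at a grid time is followed, at each later offset below \<open>d\<close>, by a
  position within \<open>c\<close> of the visited point with probability at least \<open>q\<close>;
  hence the enlargement of the interval by \<open>c\<close> on both sides.\<close>

lemma skeleton_le_pot:
  assumes d: "0 \<le> d" and q: "\<And>s. s \<in> {0..d} \<Longrightarrow> q \<le> p s {-c..c} 0"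
  shows "q * (ennreal d * (\<Sum>k<N. p (real k * d) {a..b} y)) \<le> pot {0..<real N * d} {a-c..b+c} y"
proof -
  have "pot {0..<real N * d} {a-c..b+c} y = (\<Sum>k<N. \<integral>\<^sup>+s\<in>{0..<d}. p (real k * d + s) {a-c..b+c} y \<partial>lborel)"
    unfolding pot_def by (rule nn_integral_segments[OF _ d]) measurable
  also have "\<dots> \<ge> (\<Sum>k<N. \<integral>\<^sup>+s\<in>{0..<d}. q * p (real k * d) {a..b} y \<partial>lborel)"
  proof (intro sum_mono nn_integral_mono)
    fix k s
    show "q * p (real k * d) {a..b} y * indicator {0..<d} s \<le> p (real k * d + s) {a-c..b+c} y * indicator {0..<d} s"
    proof (cases "s \<in> {0..<d}")
      case True
      have "q * p (real k * d) {a..b} y = (\<integral>\<^sup>+\<omega>. q * indicator {a..b} (y + Y (real k * d) \<omega>) \<partial>M)"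
        by (simp add: p_nn_integral nn_integral_cmult)
      also have "\<dots> \<le> (\<integral>\<^sup>+\<omega>. p s {a-c..b+c} (y + Y (real k * d) \<omega>) \<partial>M)"
      proof (intro nn_integral_mono)
        fix \<omega>
        show "q * indicator {a..b} (y + Y (real k * d) \<omega>) \<le> p s {a-c..b+c} (y + Y (real k * d) \<omega>)"
        proof (cases "y + Y (real k * d) \<omega> \<in> {a..b}")
          case in': True
          have "q \<le> p s {-c..c} 0" using True by (intro q) auto
          also have "\<dots> \<le> p s {a-c..b+c} (y + Y (real k * d) \<omega>)"
            using in' by (subst (2) p_shift, intro p_mono) auto
          finally show ?thesis using in' by simp
        qed simp
      qed
      also have "\<dots> = p (real k * d + s) {a-c..b+c} y"
        using True d by (subst chapman_kolmogorov) auto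
      finally show ?thesis using True by simp
    qed simp
  qed
  also have "(\<Sum>k<N. \<integral>\<^sup>+s\<in>{0..<d}. q * p (real k * d) {a..b} y \<partial>lborel)
      = (\<Sum>k<N. q * p (real k * d) {a..b} y * ennreal d)"
    by (intro sum.cong refl, subst nn_integral_cmult_indicator) (use d in auto)
  also have "\<dots> = q * (ennreal d * (\<Sum>k<N. p (real k * d) {a..b} y))"
    by (simp add: sum_distrib_left mult_ac)
  finally show ?thesis .
qed

section \<open>Displacements over short and bounded times\<close>

text \<open>Along positive times shrinking to 0 the path tends to 0 by right continuity, so bad
  times cannot accumulate at 0, by dominated convergence.\<close>

lemma small_times:
  assumes a: "0 < a"
  obtains d where "d > 0" "\<And>s. s \<in> {0..d} \<Longrightarrow> 1/2 \<le> p s {-a..a} 0"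
proof -
  have "\<exists>d>0. \<forall>s\<in>{0..d}. 1/2 \<le> p s {-a..a} 0"
  proof (rule ccontr)
    assume "\<not> ?thesis"
    then have "\<forall>d>0. \<exists>s\<in>{0..d}. p s {-a..a} 0 < 1/2" by (auto simp: not_le)
    then have "\<forall>n. \<exists>s\<in>{0..1/real (Suc n)}. p s {-a..a} 0 < 1/2" by simp
    then obtain s where s: "\<And>n. s n \<in> {0..1/real (Suc n)}" "\<And>n. p (s n) {-a..a} 0 < 1/2"
      by metis
    have pos: "s n > 0" for n
    proof -
      have "s n \<noteq> 0"
      proof
        assume "s n = 0"
        with s(2)[of n] a have "ennreal 1 < ennreal (1/2)" by (simp add: p_0 ennreal_half)
        then show False by (subst (asm) ennreal_less_iff) auto
      qed
      with s(1)[of n] show ?thesis by auto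
    qed
    have lim0: "s \<longlonglongrightarrow> 0"
      by (rule tendsto_sandwich[OF _ _ tendsto_const LIMSEQ_inverse_real_of_nat])
         (use s(1) in \<open>auto simp: inverse_eq_divide\<close>)
    have lim: "filterlim s (at_right 0) sequentially"
      unfolding filterlim_at using lim0 pos by (auto simp: less_imp_neq[symmetric] intro!: always_eventually)
    have "(\<lambda>n. \<integral>\<omega>. indicat_real {-a..a} (Y (s n) \<omega>) \<partial>M) \<longlonglongrightarrow> (\<integral>\<omega>. 1 \<partial>M)"
    proof (rule integral_dominated_convergence[where w = "\<lambda>_. 1"])
      show "AE \<omega> in M. (\<lambda>n. indicat_real {-a..a} (Y (s n) \<omega>)) \<longlonglongrightarrow> 1"
      proof (rule AE_I2)
        fix \<omega> assume "\<omega> \<in> space M"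
        from filterlim_compose[OF rcont[OF this] lim] have "(\<lambda>n. Y (s n) \<omega>) \<longlonglongrightarrow> 0"
          by (simp add: zero)
        then have "\<forall>\<^sub>F n in sequentially. dist (Y (s n) \<omega>) 0 < a"
          by (rule tendstoD) fact
        then have "\<forall>\<^sub>F n in sequentially. 1 = indicat_real {-a..a} (Y (s n) \<omega>)"
          by eventually_elim (auto simp: indicator_def dist_real_def)
        then show "(\<lambda>n. indicat_real {-a..a} (Y (s n) \<omega>)) \<longlonglongrightarrow> 1"
          by (rule Lim_transform_eventually[OF tendsto_const])
      qed
    qed (auto simp: indicator_def)
    then have "(\<lambda>n. \<integral>\<omega>. indicat_real {-a..a} (Y (s n) \<omega>) \<partial>M) \<longlonglongrightarrow> 1" by (simp add: prob_space)
    from order_tendstoD(1)[OF this, of "1/2"]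
    obtain n where n: "1/2 < (\<integral>\<omega>. indicat_real {-a..a} (Y (s n) \<omega>) \<partial>M)"
      by (auto simp: eventually_sequentially)
    have "(\<integral>\<omega>. indicat_real {-a..a} (Y (s n) \<omega>) \<partial>M) = prob {\<omega> \<in> space M. Y (s n) \<omega> \<in> {-a..a}}"
    proof -
      have "(\<integral>\<omega>. indicat_real {-a..a} (Y (s n) \<omega>) \<partial>M) = (\<integral>\<omega>. indicat_real {\<omega> \<in> space M. Y (s n) \<omega> \<in> {-a..a}} \<omega> \<partial>M)"
        by (rule Bochner_Integration.integral_cong) (auto simp: indicator_def)
      then show ?thesis by simp
    qed
    with n have "ennreal (1/2) \<le> p (s n) {-a..a} 0"
      unfolding p_def emeasure_eq_measure by (intro ennreal_leI) simp
    with s(2)[of n] show False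
      unfolding ennreal_half using leD by blast
  qed
  with that show ?thesis by blast
qed

lemma tight_single: "\<exists>c. 1/2 \<le> p t {-c..c} 0"
proof -
  have "(\<Union>n. {\<omega> \<in> space M. Y t \<omega> \<in> {-real n..real n}}) = space M"
  proof safe
    fix \<omega> assume "\<omega> \<in> space M"
    moreover obtain n where "\<bar>Y t \<omega>\<bar> \<le> real n" using real_arch_simple by blast
    ultimately show "\<omega> \<in> (\<Union>n. {\<omega> \<in> space M. Y t \<omega> \<in> {-real n..real n}})" by (auto intro!: exI[of _ n])
  qed
  moreover have "(\<lambda>n. prob {\<omega> \<in> space M. Y t \<omega> \<in> {-real n..real n}}) \<longlonglongrightarrow> prob (\<Union>n. {\<omega> \<in> space M. Y t \<omega> \<in> {-real n..real n}})"
    by (rule finite_Lim_measure_incseq) (auto simp: incseq_def)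
  ultimately have "(\<lambda>n. prob {\<omega> \<in> space M. Y t \<omega> \<in> {-real n..real n}}) \<longlonglongrightarrow> 1" by (simp add: prob_space)
  from order_tendstoD(1)[OF this, of "1/2"]
  obtain n where "1/2 < prob {\<omega> \<in> space M. Y t \<omega> \<in> {-real n..real n}}"
    by (auto simp: eventually_sequentially)
  then show ?thesis
    unfolding p_def emeasure_eq_measure ennreal_half
    by (intro exI[of _ "real n"] ennreal_leI) simp
qed

text \<open>A time in \<open>{0..1}\<close> is a multiple of \<open>d\<close> plus a remainder below
  \<open>d\<close>. Finitely many multiples share the bound \<open>C\<close>, the remainder moves
  the path by at most 1, and independence multiplies the two probabilities 1/2; this explains both
  1/4 and \<open>C + 1\<close>.\<close>

lemma tight_unit_interval:
  obtains c where "c > 0" "\<And>s. s \<in> {0..1} \<Longrightarrow> 1/4 \<le> p s {-c..c} 0"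
proof -
  obtain d where d: "d > 0" "\<And>s. s \<in> {0..d} \<Longrightarrow> 1/2 \<le> p s {-1..1} 0"
    using small_times[of 1] by auto
  obtain N :: nat where N: "1 / d < real N" using reals_Archimedean2 by blast
  have "\<forall>k. \<exists>c. 1/2 \<le> p (real k * d) {-c..c} 0"
    using tight_single by blast
  from choice[OF this] obtain c where c: "\<And>k. 1/2 \<le> p (real k * d) {-c k..c k} 0"
    by blast
  define C where "C = Max (insert 0 (c ` {..N}))"
  have C: "c k \<le> C" "0 \<le> C" if "k \<le> N" for k
    unfolding C_def using that by (intro Max_ge; auto)+
  show thesis
  proof (rule that[of "C + 1"])
    show "C + 1 > 0" using C by force
    fix s :: real assume s: "s \<in> {0..1}"
    define k where "k = nat \<lfloor>s / d\<rfloor>"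
    have k: "real k = of_int \<lfloor>s / d\<rfloor>" unfolding k_def using s d by simp
    have "real k * d \<le> s" using d k by (simp add: pos_le_divide_eq[symmetric])
    moreover have "s < (real k + 1) * d" using d k by (simp add: pos_divide_less_eq[symmetric])
    moreover have "k \<le> N"
    proof -
      have "real k \<le> s / d" using k by simp
      also have "\<dots> \<le> 1 / d" using s d by (simp add: divide_right_mono)
      finally show ?thesis using N by simp
    qed
    ultimately have r: "s - real k * d \<in> {0..d}" and kN: "k \<le> N" by (auto simp: algebra_simps)
    have "1/4 = (1/2 * (1/2) :: ennreal)"
      unfolding ennreal_half ennreal_quarter by (subst ennreal_mult[symmetric]) auto
    also have "\<dots> \<le> 1/2 * p (real k * d) {-c k..c k} 0"
      by (intro mult_left_mono c) simp
    also have "\<dots> = (\<integral>\<^sup>+\<omega>. 1/2 * indicator {-c k..c k} (0 + Y (real k * d) \<omega>) \<partial>M)"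
      by (subst nn_integral_cmult) (auto simp: p_nn_integral)
    also have "\<dots> \<le> (\<integral>\<^sup>+\<omega>. p (s - real k * d) {-(C+1)..C+1} (0 + Y (real k * d) \<omega>) \<partial>M)"
    proof (intro nn_integral_mono)
      fix \<omega>
      show "1/2 * indicator {-c k..c k} (0 + Y (real k * d) \<omega>) \<le> p (s - real k * d) {-(C+1)..C+1} (0 + Y (real k * d) \<omega>)"
      proof (cases "Y (real k * d) \<omega> \<in> {-c k..c k}")
        case True
        have "1/2 \<le> p (s - real k * d) {-1..1} 0" by (intro d r)
        also have "\<dots> \<le> p (s - real k * d) {-(C+1)..C+1} (0 + Y (real k * d) \<omega>)"
          using True C[OF kN] by (subst (2) p_shift, intro p_mono) auto
        finally show ?thesis using True by simp
      qed simp
    qed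
    also have "\<dots> = p (real k * d + (s - real k * d)) {-(C+1)..C+1} 0"
      using r d by (subst chapman_kolmogorov) auto
    finally show "1/4 \<le> p s {-(C+1)..C+1} 0" by simp
  qed
qed

text \<open>The potential is compared with a skeleton and back. The step divides the horizon exactly
  and is so short that a displacement of at most \<open>l\<close> has probability at least 1/2; its
  inverse is the factor 2, and the second comparison widens the window from \<open>l\<close> to
  \<open>2 * l\<close>.\<close>

lemma pot_interval_le:
  assumes T: "0 < T" and l: "0 < l"
  shows "pot {0..<T} {a..a+l} y \<le> 2 * pot {0..<T} {-2*l..2*l} 0"
proof -
  obtain d0 where d0: "d0 > 0" "\<And>s. s \<in> {0..d0} \<Longrightarrow> 1/2 \<le> p s {-l..l} 0"
    using small_times[OF l] by auto
  obtain N :: nat where N: "T / d0 < real N" using reals_Archimedean2 by blast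
  then have N0: "real N > 0" using T d0 by (smt (verit) divide_pos_pos)
  define d where "d = T / real N"
  have d: "0 \<le> d" "d \<le> d0" "real N * d = T"
    using N N0 T d0 by (auto simp: d_def field_simps)
  let ?S = "ennreal d * (\<Sum>k<N. p (real k * d) {-l..l} 0)"
  have "pot {0..<T} {a..a+l} y \<le> ?S"
    using pot_le_skeleton[OF d(1), of N a "a+l" y] d(3) by simp
  also have "?S = 2 * (1/2 * ?S)"
    unfolding ennreal_half mult.assoc[symmetric]
    by (subst ennreal_numeral[symmetric], subst ennreal_mult[symmetric]) auto
  also have "1/2 * ?S \<le> pot {0..<real N * d} {-l-l..l+l} 0"
    by (rule skeleton_le_pot[OF d(1)]) (use d d0 in auto)
  finally show ?thesis
    by (simp add: d(3) mult_left_mono)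
qed

end

section \<open>Second moments of occupation times\<close>

text \<open>The square is a double integral, symmetric in the two times, so the ordered pairs
  account for at least half of it. The inner variable becomes the lag \<open>v\<close>, the form in
  which the Markov property applies.\<close>

lemma nn_integral_square_le:
  fixes h :: "real \<Rightarrow> ennreal"
  assumes [measurable]: "h \<in> borel_measurable borel"
  shows "(\<integral>\<^sup>+t. h t \<partial>lborel)\<^sup>2 \<le> 2 * (\<integral>\<^sup>+t. (\<integral>\<^sup>+v\<in>{0..}. h t * h (t + v) \<partial>lborel) \<partial>lborel)"
proof -
  let ?I = "\<lambda>t u. h t * h u * indicator {0..} (u - t)"
  have "(\<integral>\<^sup>+t. h t \<partial>lborel)\<^sup>2 = (\<integral>\<^sup>+t. (\<integral>\<^sup>+u. h t * h u \<partial>lborel) \<partial>lborel)"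
    by (simp add: nn_integral_cmult nn_integral_multc power2_eq_square)
  also have "\<dots> \<le> (\<integral>\<^sup>+t. (\<integral>\<^sup>+u. ?I t u + ?I u t \<partial>lborel) \<partial>lborel)"
    by (intro nn_integral_mono) (auto simp: indicator_def mult.commute)
  also have "\<dots> = (\<integral>\<^sup>+t. (\<integral>\<^sup>+u. ?I t u \<partial>lborel) \<partial>lborel) + (\<integral>\<^sup>+t. (\<integral>\<^sup>+u. ?I u t \<partial>lborel) \<partial>lborel)"
    by (simp add: nn_integral_add)
  also have "(\<integral>\<^sup>+t. (\<integral>\<^sup>+u. ?I u t \<partial>lborel) \<partial>lborel) = (\<integral>\<^sup>+t. (\<integral>\<^sup>+u. ?I t u \<partial>lborel) \<partial>lborel)"
    by (rule lborel_pair.Fubini') measurable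
  finally have le: "(\<integral>\<^sup>+t. h t \<partial>lborel)\<^sup>2 \<le> (\<integral>\<^sup>+t. (\<integral>\<^sup>+u. ?I t u \<partial>lborel) \<partial>lborel) + (\<integral>\<^sup>+t. (\<integral>\<^sup>+u. ?I t u \<partial>lborel) \<partial>lborel)" .
  have "(\<integral>\<^sup>+u. ?I t u \<partial>lborel) = (\<integral>\<^sup>+v\<in>{0..}. h t * h (t + v) \<partial>lborel)" for t
    by (subst nn_integral_shift[symmetric, where c = t]) simp_all
  then have "(\<integral>\<^sup>+t. (\<integral>\<^sup>+u. ?I t u \<partial>lborel) \<partial>lborel) = (\<integral>\<^sup>+t. (\<integral>\<^sup>+v\<in>{0..}. h t * h (t + v) \<partial>lborel) \<partial>lborel)"
    by simp
  with le show ?thesis by (simp add: mult_2)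
qed

text \<open>Arithmetic-geometric mean inequality, from \<open>(2 * l * r - 1)\<^sup>2\<close> being
  nonnegative. With its free weight it replaces the Cauchy-Schwarz inequality and stays valid for
  infinite \<open>z\<close>.\<close>

lemma ennreal_le_square:
  fixes z :: ennreal
  assumes l: "0 < l"
  shows "z \<le> ennreal l * z\<^sup>2 + ennreal (1 / (4 * l))"
proof (cases z)
  case (real r)
  have "0 \<le> (2 * l * r - 1)\<^sup>2" by simp
  then have "r * (4 * l) \<le> 4 * l\<^sup>2 * r\<^sup>2 + 1" by (simp add: power2_eq_square algebra_simps)
  then have "r \<le> (4 * l\<^sup>2 * r\<^sup>2 + 1) / (4 * l)" using l by (simp add: pos_le_divide_eq)
  also have "\<dots> = l * r\<^sup>2 + 1 / (4 * l)" using l by (simp add: field_simps power2_eq_square)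
  finally have "ennreal r \<le> ennreal (l * r\<^sup>2 + 1 / (4 * l))" by (rule ennreal_leI)
  then show ?thesis
    using l real by (simp add: ennreal_plus ennreal_mult ennreal_power del: times_divide_eq_left)
next
  case top
  have "ennreal l \<noteq> 0" using l by simp
  then have "ennreal l * z\<^sup>2 = \<top>"
    unfolding top power2_eq_square by (simp only: ennreal_mult_top ennreal_top_mult if_False ennreal_top_neq_zero)
  then show ?thesis by simp
qed

text \<open>Where \<open>Z\<close> is at most \<open>m / 2\<close> it is bounded by that; elsewhere
  it is split by \<open>ennreal_le_square\<close> with weight \<open>1 / (4 * \<kappa> * m)\<close>.
  Of the mean \<open>m\<close>, these terms absorb \<open>m / 2\<close> and \<open>m / 4\<close>,
  and the remaining quarter has to come from the set itself, whence the factor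
  \<open>4 * \<kappa>\<close>. A general finite measure is allowed because one application is to a
  weighted product of probability and time.\<close>

lemma paley_zygmund:
  fixes Z :: "'b \<Rightarrow> ennreal" and m \<kappa> :: real
  assumes [measurable]: "Z \<in> borel_measurable N" and fin: "emeasure N (space N) < \<infinity>" and pos: "0 < m" "0 < \<kappa>"
    and mean: "ennreal m * emeasure N (space N) \<le> (\<integral>\<^sup>+x. Z x \<partial>N)"
    and sq: "(\<integral>\<^sup>+x. (Z x)\<^sup>2 \<partial>N) \<le> ennreal (\<kappa> * m\<^sup>2) * emeasure N (space N)"
  shows "emeasure N (space N) \<le> ennreal (4 * \<kappa>) * emeasure N {x \<in> space N. ennreal (m / 2) < Z x}"
proof -
  let ?S = "{x \<in> space N. ennreal (m / 2) < Z x}"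
  have "emeasure N ?S \<le> emeasure N (space N)" by (rule emeasure_space)
  then have finS: "emeasure N ?S < \<infinity>" using fin by (rule le_less_trans)
  obtain a r where a: "emeasure N (space N) = ennreal a" "0 \<le> a" and r: "emeasure N ?S = ennreal r" "0 \<le> r"
    using fin finS by (cases "emeasure N (space N)"; cases "emeasure N ?S") auto
  have pt: "Z x \<le> ennreal (m / 2) + (ennreal (1 / (4 * \<kappa> * m)) * (Z x)\<^sup>2 + ennreal (\<kappa> * m) * indicator ?S x)"
    if "x \<in> space N" for x
  proof (cases "ennreal (m / 2) < Z x")
    case True
    have "Z x \<le> ennreal (1 / (4 * \<kappa> * m)) * (Z x)\<^sup>2 + ennreal (1 / (4 * (1 / (4 * \<kappa> * m))))"
      using pos by (intro ennreal_le_square) simp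
    also have "1 / (4 * (1 / (4 * \<kappa> * m))) = \<kappa> * m" using pos by simp
    finally show ?thesis using True that by - (rule add_increasing, simp_all)
  next
    case False
    then show ?thesis by (intro add_increasing2) auto
  qed
  have "ennreal m * ennreal a \<le> (\<integral>\<^sup>+x. Z x \<partial>N)" using mean a by simp
  also have "\<dots> \<le> (\<integral>\<^sup>+x. ennreal (m / 2) + (ennreal (1 / (4 * \<kappa> * m)) * (Z x)\<^sup>2 + ennreal (\<kappa> * m) * indicator ?S x) \<partial>N)"
    by (rule nn_integral_mono) (rule pt)
  also have "\<dots> = ennreal (m / 2) * ennreal a + (ennreal (1 / (4 * \<kappa> * m)) * (\<integral>\<^sup>+x. (Z x)\<^sup>2 \<partial>N) + ennreal (\<kappa> * m) * ennreal r)"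
    by (simp add: nn_integral_add nn_integral_cmult nn_integral_cmult_indicator a r)
  also have "\<dots> \<le> ennreal (m / 2) * ennreal a + (ennreal (1 / (4 * \<kappa> * m)) * (ennreal (\<kappa> * m\<^sup>2) * ennreal a) + ennreal (\<kappa> * m) * ennreal r)"
    using sq a by (intro add_mono mult_left_mono order_refl) auto
  also have "\<dots> = ennreal (m / 2 * a + (1 / (4 * \<kappa> * m) * (\<kappa> * m\<^sup>2 * a) + \<kappa> * m * r))"
    using pos a(2) r(2) by (simp add: ennreal_mult ennreal_plus del: times_divide_eq_left times_divide_eq_right)
  finally have "m * a \<le> m / 2 * a + (1 / (4 * \<kappa> * m) * (\<kappa> * m\<^sup>2 * a) + \<kappa> * m * r)"
    unfolding ennreal_mult[of m a, OF less_imp_le[OF pos(1)] a(2), symmetric]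
    by (subst (asm) ennreal_le_iff) (use pos a(2) r(2) in auto)
  also have "1 / (4 * \<kappa> * m) * (\<kappa> * m\<^sup>2 * a) = m / 4 * a"
    using pos by (simp add: field_simps power2_eq_square)
  finally have "m * a \<le> m * (4 * \<kappa> * r)" by (simp add: algebra_simps)
  then have "a \<le> 4 * \<kappa> * r" using pos by simp
  then show ?thesis
    using pos r(2) unfolding a r by (simp add: ennreal_mult[symmetric] ennreal_leI)
qed

context levy_paths
begin

definition occ_from :: "real \<Rightarrow> real set \<Rightarrow> real set \<Rightarrow> 'a \<Rightarrow> ennreal" where
  "occ_from s J A \<omega> = (\<integral>\<^sup>+t\<in>J. indicator A (Y (s + t) \<omega> - Y s \<omega>) \<partial>lborel)"

lemma occ_from_0: "occ_from 0 J A = occ J A"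
  by (simp add: occ_from_def occ_def zero fun_eq_iff)

lemma occ_measurable [measurable (raw)]:
  assumes [measurable]: "A \<in> sets borel" "J \<in> sets borel" "f \<in> N \<rightarrow>\<^sub>M M"
  shows "(\<lambda>x. occ J A (f x)) \<in> borel_measurable N"
  unfolding occ_def by measurable

lemma occ_from_measurable [measurable (raw)]:
  assumes [measurable]: "A \<in> sets borel" "J \<in> sets borel" "f \<in> N \<rightarrow>\<^sub>M M" "s \<in> borel_measurable N"
  shows "(\<lambda>x. occ_from (s x) J A (f x)) \<in> borel_measurable N"
  unfolding occ_from_def by measurable

lemma Fubini_time:
  fixes f :: "'a \<Rightarrow> real \<Rightarrow> ennreal"
  assumes [measurable]: "case_prod f \<in> borel_measurable (M \<Otimes>\<^sub>M borel)"
  shows "(\<integral>\<^sup>+\<omega>. (\<integral>\<^sup>+t. f \<omega> t \<partial>lborel) \<partial>M) = (\<integral>\<^sup>+t. (\<integral>\<^sup>+\<omega>. f \<omega> t \<partial>M) \<partial>lborel)"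
proof -
  interpret pair_sigma_finite M "lborel :: real measure" ..
  have "case_prod f \<in> borel_measurable (M \<Otimes>\<^sub>M lborel)" by measurable
  from Fubini'[OF this] show ?thesis by simp
qed

lemma nn_integral_indicator_F:
  assumes "B \<in> sets (F s)"
  shows "(\<integral>\<^sup>+\<omega>. indicator B \<omega> * c \<partial>M) = emeasure M B * c"
proof -
  have [measurable]: "B \<in> sets M" using assms sets_F_subset by blast
  show ?thesis by (subst nn_integral_multc) simp_all
qed

lemma occ_from_mean:
  assumes s: "0 \<le> s" and B: "B \<in> sets (F s)" and [measurable]: "A \<in> sets borel" "J \<in> sets borel" and J: "J \<subseteq> {0..}"
  shows "(\<integral>\<^sup>+\<omega>. indicator B \<omega> * occ_from s J A \<omega> \<partial>M) = emeasure M B * pot J A 0"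
proof -
  have [measurable]: "B \<in> sets M" using B sets_F_subset by blast
  have "(\<integral>\<^sup>+\<omega>. indicator B \<omega> * occ_from s J A \<omega> \<partial>M)
      = (\<integral>\<^sup>+\<omega>. (\<integral>\<^sup>+t. indicator B \<omega> * (indicator A (Y (s + t) \<omega> - Y s \<omega>) * indicator J t) \<partial>lborel) \<partial>M)"
    unfolding occ_from_def by (intro nn_integral_cong nn_integral_cmult[symmetric]) measurable
  also have "\<dots> = (\<integral>\<^sup>+t. (\<integral>\<^sup>+\<omega>. indicator B \<omega> * (indicator A (Y (s + t) \<omega> - Y s \<omega>) * indicator J t) \<partial>M) \<partial>lborel)"
    by (rule Fubini_time) measurable
  also have "\<dots> = (\<integral>\<^sup>+t. emeasure M B * (p t A 0 * indicator J t) \<partial>lborel)"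
  proof (rule nn_integral_cong)
    fix t
    show "(\<integral>\<^sup>+\<omega>. indicator B \<omega> * (indicator A (Y (s + t) \<omega> - Y s \<omega>) * indicator J t) \<partial>M) = emeasure M B * (p t A 0 * indicator J t)"
    proof (cases "t \<in> J")
      case True
      with J have "0 \<le> t" by auto
      from markov_p[OF s this, of "indicator B" "\<lambda>_. 0" A] B True show ?thesis
        by (simp add: nn_integral_indicator_F)
    qed simp
  qed
  also have "\<dots> = emeasure M B * pot J A 0"
    unfolding pot_def by (rule nn_integral_cmult) measurable
  finally show ?thesis .
qed

lemma occ_mean:
  assumes [measurable]: "A \<in> sets borel" "J \<in> sets borel" and J: "J \<subseteq> {0..}"
  shows "(\<integral>\<^sup>+\<omega>. occ J A \<omega> \<partial>M) = pot J A 0"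
proof -
  have "space M \<in> sets (F 0)" using sets.top[of "F 0"] by simp
  from occ_from_mean[OF _ this assms(1,2) J] show ?thesis
    by (simp add: occ_from_0 emeasure_space_1 cong: nn_integral_cong)
qed

text \<open>Over ordered pairs of visits, the Markov property at the earlier one leaves a potential
  started inside \<open>A\<close>, which \<open>\<kappa>\<close> bounds; the earlier visit then
  integrates to the first moment. The condition on differences keeps the lag in
  \<open>J\<close>.\<close>

lemma occ_from_second_moment:
  assumes s: "0 \<le> s" and B: "B \<in> sets (F s)" and [measurable]: "A \<in> sets borel" "J \<in> sets borel" and J: "J \<subseteq> {0..}"
    and J': "\<And>t v. t \<in> J \<Longrightarrow> 0 \<le> v \<Longrightarrow> t + v \<in> J \<Longrightarrow> v \<in> J"
    and \<kappa>: "\<And>z. z \<in> A \<Longrightarrow> pot J A z \<le> \<kappa>"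
  shows "(\<integral>\<^sup>+\<omega>. indicator B \<omega> * (occ_from s J A \<omega>)\<^sup>2 \<partial>M) \<le> 2 * (emeasure M B * pot J A 0 * \<kappa>)"
proof -
  have [measurable]: "B \<in> sets M" using B sets_F_subset by blast
  let ?D = "\<lambda>t \<omega>. Y (s + t) \<omega> - Y s \<omega>"
  let ?G = "\<lambda>\<omega> t. \<integral>\<^sup>+v. indicator B \<omega> * (indicator A (?D t \<omega>) * indicator J t) * indicator A (?D (t + v) \<omega>) * indicator J v \<partial>lborel"
  have "(\<integral>\<^sup>+\<omega>. indicator B \<omega> * (occ_from s J A \<omega>)\<^sup>2 \<partial>M) \<le> (\<integral>\<^sup>+\<omega>. 2 * (\<integral>\<^sup>+t. ?G \<omega> t \<partial>lborel) \<partial>M)"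
  proof (rule nn_integral_mono)
    fix \<omega> assume \<omega>: "\<omega> \<in> space M"
    let ?h = "\<lambda>t. indicator A (?D t \<omega>) * indicator J t :: ennreal"
    have "(occ_from s J A \<omega>)\<^sup>2 \<le> 2 * (\<integral>\<^sup>+t. (\<integral>\<^sup>+v\<in>{0..}. ?h t * ?h (t + v) \<partial>lborel) \<partial>lborel)"
      unfolding occ_from_def by (rule nn_integral_square_le) (use \<omega> in measurable)
    also have "\<dots> \<le> 2 * (\<integral>\<^sup>+t. (\<integral>\<^sup>+v. ?h t * indicator A (?D (t + v) \<omega>) * indicator J v \<partial>lborel) \<partial>lborel)"
    proof (intro mult_left_mono nn_integral_mono)
      fix t v
      show "?h t * ?h (t + v) * indicator {0..} v \<le> ?h t * indicator A (?D (t + v) \<omega>) * indicator J v"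
      proof (cases "t \<in> J \<and> 0 \<le> v \<and> t + v \<in> J")
        case True
        then show ?thesis using J'[of t v] by simp
      next
        case False
        then have "?h t * ?h (t + v) * indicator {0..} v = 0" by auto
        then show ?thesis by (simp only: zero_le)
      qed
    qed simp
    finally have "indicator B \<omega> * (occ_from s J A \<omega>)\<^sup>2 \<le> indicator B \<omega> * (2 * (\<integral>\<^sup>+t. (\<integral>\<^sup>+v. ?h t * indicator A (?D (t + v) \<omega>) * indicator J v \<partial>lborel) \<partial>lborel))"
      by (rule mult_left_mono) simp
    also have "\<dots> = 2 * (\<integral>\<^sup>+t. ?G \<omega> t \<partial>lborel)"
      by (cases "\<omega> \<in> B") auto
    finally show "indicator B \<omega> * (occ_from s J A \<omega>)\<^sup>2 \<le> 2 * (\<integral>\<^sup>+t. ?G \<omega> t \<partial>lborel)" .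
  qed
  also have "\<dots> = 2 * (\<integral>\<^sup>+\<omega>. (\<integral>\<^sup>+t. ?G \<omega> t \<partial>lborel) \<partial>M)"
    by (rule nn_integral_cmult) measurable
  finally have le: "(\<integral>\<^sup>+\<omega>. indicator B \<omega> * (occ_from s J A \<omega>)\<^sup>2 \<partial>M) \<le> 2 * (\<integral>\<^sup>+\<omega>. (\<integral>\<^sup>+t. ?G \<omega> t \<partial>lborel) \<partial>M)" .
  have "(\<integral>\<^sup>+\<omega>. (\<integral>\<^sup>+t. ?G \<omega> t \<partial>lborel) \<partial>M) = (\<integral>\<^sup>+t. (\<integral>\<^sup>+\<omega>. ?G \<omega> t \<partial>M) \<partial>lborel)"
    by (rule Fubini_time) measurable
  also have "\<dots> \<le> (\<integral>\<^sup>+t. emeasure M B * \<kappa> * (p t A 0 * indicator J t) \<partial>lborel)"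
  proof (rule nn_integral_mono)
    fix t
    show "(\<integral>\<^sup>+\<omega>. ?G \<omega> t \<partial>M) \<le> emeasure M B * \<kappa> * (p t A 0 * indicator J t)"
    proof (cases "t \<in> J")
      case True
      with J have t: "0 \<le> t" by auto
      have Bt: "B \<in> sets (F (s + t))" using B sets_F_mono[of s "s + t"] t by auto
      have [measurable]: "Y (s + t) \<in> borel_measurable (F (s + t))" "Y s \<in> borel_measurable (F (s + t))"
        using t by (auto intro: rv_F)
      note Bt[measurable]
      have "(\<integral>\<^sup>+\<omega>. ?G \<omega> t \<partial>M) = (\<integral>\<^sup>+v. (\<integral>\<^sup>+\<omega>. indicator B \<omega> * indicator A (?D t \<omega>) * indicator A (?D (t + v) \<omega>) * indicator J v \<partial>M) \<partial>lborel)"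
        using True by (subst Fubini_time[symmetric]) simp_all
      also have "\<dots> = (\<integral>\<^sup>+v. (\<integral>\<^sup>+\<omega>. indicator B \<omega> * indicator A (?D t \<omega>) * p v A (?D t \<omega>) * indicator J v \<partial>M) \<partial>lborel)"
      proof (rule nn_integral_cong)
        fix v
        show "(\<integral>\<^sup>+\<omega>. indicator B \<omega> * indicator A (?D t \<omega>) * indicator A (?D (t + v) \<omega>) * indicator J v \<partial>M)
          = (\<integral>\<^sup>+\<omega>. indicator B \<omega> * indicator A (?D t \<omega>) * p v A (?D t \<omega>) * indicator J v \<partial>M)"
        proof (cases "v \<in> J")
          case True
          with J have v: "0 \<le> v" by auto
          have "(\<integral>\<^sup>+\<omega>. indicator B \<omega> * indicator A (?D t \<omega>) * indicator A (?D (t + v) \<omega>) \<partial>M)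
            = (\<integral>\<^sup>+\<omega>. indicator B \<omega> * indicator A (?D t \<omega>) * indicator A (?D t \<omega> + (Y (s + t + v) \<omega> - Y (s + t) \<omega>)) \<partial>M)"
            by (simp add: add.assoc)
          also have "\<dots> = (\<integral>\<^sup>+\<omega>. indicator B \<omega> * indicator A (?D t \<omega>) * p v A (?D t \<omega>) \<partial>M)"
            using s t v by (intro markov_p) measurable
          finally show ?thesis using True by simp
        qed simp
      qed
      also have "\<dots> = (\<integral>\<^sup>+\<omega>. (\<integral>\<^sup>+v. indicator B \<omega> * indicator A (?D t \<omega>) * p v A (?D t \<omega>) * indicator J v \<partial>lborel) \<partial>M)"
        by (rule Fubini_time[symmetric]) measurable
      also have "\<dots> = (\<integral>\<^sup>+\<omega>. indicator B \<omega> * indicator A (?D t \<omega>) * pot J A (?D t \<omega>) \<partial>M)"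
        unfolding pot_def by (simp add: nn_integral_cmult mult.assoc)
      also have "\<dots> \<le> (\<integral>\<^sup>+\<omega>. indicator B \<omega> * indicator A (?D t \<omega>) * \<kappa> \<partial>M)"
        using \<kappa> by (intro nn_integral_mono) (auto simp: indicator_def)
      also have "\<dots> = (\<integral>\<^sup>+\<omega>. indicator B \<omega> * indicator A (0 + ?D t \<omega>) \<partial>M) * \<kappa>"
        by (simp add: nn_integral_multc)
      also have "(\<integral>\<^sup>+\<omega>. indicator B \<omega> * indicator A (0 + ?D t \<omega>) \<partial>M) = emeasure M B * p t A 0"
        using B markov_p[OF s t, of "indicator B" "\<lambda>_. 0" A] by (simp add: nn_integral_indicator_F)
      finally show ?thesis using True by (simp add: mult_ac)
    qed simp
  qed
  also have "\<dots> = emeasure M B * \<kappa> * pot J A 0"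
    unfolding pot_def by (rule nn_integral_cmult) measurable
  finally have "(\<integral>\<^sup>+\<omega>. (\<integral>\<^sup>+t. ?G \<omega> t \<partial>lborel) \<partial>M) \<le> emeasure M B * pot J A 0 * \<kappa>"
    by (simp only: mult_ac)
  with le show ?thesis
    by (meson mult_left_mono order_trans zero_le)
qed

end

section \<open>Transience\<close>

text \<open>The minimum of 0 and the first \<open>n\<close> partial sums. The recursion peels off
  the front term because the argument compares a sequence with its shift.\<close>

primrec running_min :: "nat \<Rightarrow> (nat \<Rightarrow> real) \<Rightarrow> real" where
  "running_min 0 z = 0"
| "running_min (Suc n) z = min 0 (z 0 + running_min n (\<lambda>i. z (Suc i)))"

lemma running_min_nonpos: "running_min n z \<le> 0"
  by (cases n) auto

lemma running_min_antimono: "running_min (Suc n) z \<le> running_min n z"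
proof (induction n arbitrary: z)
  case (Suc n)
  have "running_min (Suc n) (\<lambda>i. z (Suc i)) \<le> running_min n (\<lambda>i. z (Suc i))" by (rule Suc.IH)
  then show ?case by (simp only: running_min.simps(2)[of "Suc n"] running_min.simps(2)[of n z])
qed simp

lemma running_min_le_sum: "k \<le> n \<Longrightarrow> running_min n z \<le> (\<Sum>i<k. z i)"
proof (induction n arbitrary: z k)
  case (Suc n)
  show ?case
  proof (cases k)
    case (Suc j)
    with Suc.IH[of j "\<lambda>i. z (Suc i)"] Suc.prems have "running_min n (\<lambda>i. z (Suc i)) \<le> (\<Sum>i<j. z (Suc i))" by simp
    then have "running_min (Suc n) z \<le> z 0 + (\<Sum>i<j. z (Suc i))" by (simp add: min_le_iff_disj)
    also have "\<dots> = (\<Sum>i<k. z i)" unfolding Suc by (rule sum.lessThan_Suc_shift[symmetric])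
    finally show ?thesis .
  next
    case 0
    then show ?thesis using running_min_nonpos[of "Suc n" z] by simp
  qed
qed simp

text \<open>A negative minimum is attained after at least one step, so it equals the first term plus
  a shorter minimum of the shifted sequence; lengthening the latter only lowers it. In expectation
  the right-hand side will vanish by stationarity.\<close>

lemma running_min_step:
  "z 0 * indicator {z. running_min n z < 0} z \<le> running_min n z - running_min n (\<lambda>i. z (Suc i))"
proof (cases "running_min n z < 0")
  case True
  then obtain m where m: "n = Suc m" by (cases n) auto
  with True have "running_min n z = z 0 + running_min m (\<lambda>i. z (Suc i))" by (auto simp: min_def split: if_splits)
  moreover have "running_min n (\<lambda>i. z (Suc i)) \<le> running_min m (\<lambda>i. z (Suc i))"
    unfolding m by (rule running_min_antimono)
  ultimately show ?thesis using True by simp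
next
  case False
  then show ?thesis using running_min_nonpos[of n z] running_min_nonpos[of n "\<lambda>i. z (Suc i)"] by simp
qed

lemma measurable_shift_PiM: "(\<lambda>z i. z (Suc i)) \<in> PiM UNIV (\<lambda>_. borel :: real measure) \<rightarrow>\<^sub>M PiM UNIV (\<lambda>_. borel)"
  by (rule measurable_PiM_single') (auto intro: measurable_component_singleton)

lemma running_min_measurable [measurable]:
  "running_min n \<in> borel_measurable (PiM UNIV (\<lambda>_. borel))"
proof (induction n)
  case (Suc n)
  note [measurable] = measurable_compose[OF measurable_shift_PiM Suc.IH]
  have [measurable]: "(\<lambda>z. z 0) \<in> borel_measurable (PiM UNIV (\<lambda>_::nat. borel :: real measure))"
    by (rule measurable_component_singleton) simp
  show ?case unfolding running_min.simps by measurable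
next
  case 0
  have "running_min 0 = (\<lambda>_. 0)" by (simp add: fun_eq_iff)
  then show ?case by simp
qed

text \<open>Garsia's proof of the maximal ergodic lemma.\<close>

lemma (in prob_space) stationary_sums_nonneg:
  fixes \<xi> :: "nat \<Rightarrow> 'a \<Rightarrow> real"
  assumes [measurable]: "\<And>i. \<xi> i \<in> borel_measurable M"
    and stat: "distr M (PiM UNIV (\<lambda>_. borel)) (\<lambda>\<omega> i. \<xi> (Suc i) \<omega>) = distr M (PiM UNIV (\<lambda>_. borel)) (\<lambda>\<omega> i. \<xi> i \<omega>)"
    and int: "\<And>i. integrable M (\<xi> i)" and pos: "expectation (\<xi> 0) > 0"
  shows "prob {\<omega> \<in> space M. \<forall>k. 0 \<le> (\<Sum>i<k. \<xi> i \<omega>)} > 0"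
proof -
  let ?\<Xi> = "\<lambda>\<omega> i. \<xi> i \<omega>" and ?\<Xi>' = "\<lambda>\<omega> i. \<xi> (Suc i) \<omega>"
  have X [measurable]: "(\<lambda>\<omega> i. \<xi> (i + k) \<omega>) \<in> M \<rightarrow>\<^sub>M PiM UNIV (\<lambda>_. borel)" for k
    by (rule measurable_PiM_single') auto
  have m [measurable]: "(\<lambda>\<omega>. running_min n (\<lambda>i. \<xi> (i + k) \<omega>)) \<in> borel_measurable M" for n k
    by (rule measurable_compose[OF X running_min_measurable])
  have m0 [measurable]: "(\<lambda>\<omega>. running_min n (\<lambda>i. \<xi> i \<omega>)) \<in> borel_measurable M" for n
    using m[of n 0] by simp
  have intm: "integrable M (\<lambda>\<omega>. running_min n (\<lambda>i. \<xi> (i + k) \<omega>))" for n k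
  proof (induction n arbitrary: k)
    case (Suc n)
    show ?case
    proof (rule Bochner_Integration.integrable_bound)
      show "integrable M (\<lambda>\<omega>. norm (\<xi> k \<omega>) + norm (running_min n (\<lambda>i. \<xi> (i + Suc k) \<omega>)))"
        by (intro Bochner_Integration.integrable_add integrable_norm int Suc.IH)
    qed (use m[of "Suc n" k] in auto)
  qed simp
  have le0: "(\<integral>\<omega>. \<xi> 0 \<omega> * indicator {\<omega>. running_min n (?\<Xi> \<omega>) < 0} \<omega> \<partial>M) \<le> 0" for n
  proof -
    have "(\<integral>\<omega>. \<xi> 0 \<omega> * indicator {\<omega>. running_min n (?\<Xi> \<omega>) < 0} \<omega> \<partial>M)
      \<le> (\<integral>\<omega>. running_min n (?\<Xi> \<omega>) - running_min n (?\<Xi>' \<omega>) \<partial>M)"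
    proof (rule integral_mono)
      show "integrable M (\<lambda>\<omega>. \<xi> 0 \<omega> * indicator {\<omega>. running_min n (?\<Xi> \<omega>) < 0} \<omega>)"
        by (rule Bochner_Integration.integrable_bound[OF int[of 0]]) (auto simp: indicator_def)
      show "integrable M (\<lambda>\<omega>. running_min n (?\<Xi> \<omega>) - running_min n (?\<Xi>' \<omega>))"
        using intm[of n 0] intm[of n 1] by simp
      show "\<xi> 0 \<omega> * indicator {\<omega>. running_min n (?\<Xi> \<omega>) < 0} \<omega> \<le> running_min n (?\<Xi> \<omega>) - running_min n (?\<Xi>' \<omega>)" for \<omega>
        using running_min_step[of "?\<Xi> \<omega>" n] by (simp add: indicator_def)
    qed
    also have "\<dots> = (\<integral>\<omega>. running_min n (?\<Xi> \<omega>) \<partial>M) - (\<integral>\<omega>. running_min n (?\<Xi>' \<omega>) \<partial>M)"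
      using intm[of n 0] intm[of n 1] by simp
    \<comment> \<open>Both minima are the same functional of sequences with the same law, so their
      expectations cancel.\<close>
    also have "(\<integral>\<omega>. running_min n (?\<Xi>' \<omega>) \<partial>M) = (\<integral>z. running_min n z \<partial>distr M (PiM UNIV (\<lambda>_. borel)) ?\<Xi>')"
      using X[of 1] by (intro integral_distr[symmetric]) simp_all
    also have "\<dots> = (\<integral>\<omega>. running_min n (?\<Xi> \<omega>) \<partial>M)"
      unfolding stat using X[of 0] by (intro integral_distr) simp_all
    finally show ?thesis by simp
  qed
  have "(\<lambda>n. \<integral>\<omega>. \<xi> 0 \<omega> * indicator {\<omega>. running_min n (?\<Xi> \<omega>) < 0} \<omega> \<partial>M)
    \<longlonglongrightarrow> (\<integral>\<omega>. \<xi> 0 \<omega> * indicator {\<omega>. \<exists>n. running_min n (?\<Xi> \<omega>) < 0} \<omega> \<partial>M)"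
  proof (rule integral_dominated_convergence[where w = "\<lambda>\<omega>. norm (\<xi> 0 \<omega>)"])
    show "integrable M (\<lambda>\<omega>. norm (\<xi> 0 \<omega>))" by (intro integrable_norm int)
    show "AE \<omega> in M. (\<lambda>n. \<xi> 0 \<omega> * indicator {\<omega>. running_min n (?\<Xi> \<omega>) < 0} \<omega>)
        \<longlonglongrightarrow> \<xi> 0 \<omega> * indicator {\<omega>. \<exists>n. running_min n (?\<Xi> \<omega>) < 0} \<omega>"
    proof (rule AE_I2)
      fix \<omega>
      show "(\<lambda>n. \<xi> 0 \<omega> * indicator {\<omega>. running_min n (?\<Xi> \<omega>) < 0} \<omega>)
        \<longlonglongrightarrow> \<xi> 0 \<omega> * indicator {\<omega>. \<exists>n. running_min n (?\<Xi> \<omega>) < 0} \<omega>"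
      proof (cases "\<exists>n. running_min n (?\<Xi> \<omega>) < 0")
        case True
        then obtain k where k: "running_min k (?\<Xi> \<omega>) < 0" by blast
        have "running_min n (?\<Xi> \<omega>) < 0" if "k \<le> n" for n
          using lift_Suc_antimono_le[of "\<lambda>n. running_min n (?\<Xi> \<omega>)", OF running_min_antimono that] k by simp
        then have "\<forall>\<^sub>F n in sequentially. \<xi> 0 \<omega> * indicator {\<omega>. \<exists>n. running_min n (?\<Xi> \<omega>) < 0} \<omega> = \<xi> 0 \<omega> * indicator {\<omega>. running_min n (?\<Xi> \<omega>) < 0} \<omega>"
          using True unfolding eventually_sequentially by (intro exI[of _ k]) auto
        then show ?thesis by (rule Lim_transform_eventually[OF tendsto_const])
      qed simp
    qed
  qed (auto simp: indicator_def)
  then have le: "(\<integral>\<omega>. \<xi> 0 \<omega> * indicator {\<omega>. \<exists>n. running_min n (?\<Xi> \<omega>) < 0} \<omega> \<partial>M) \<le> 0"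
    by (rule LIMSEQ_le_const2) (use le0 in blast)
  show ?thesis
  proof (rule ccontr)
    let ?E = "{\<omega> \<in> space M. \<forall>k. 0 \<le> (\<Sum>i<k. \<xi> i \<omega>)}"
    assume "\<not> 0 < prob ?E"
    then have "prob ?E = 0" using measure_nonneg[of M ?E] by linarith
    moreover have "?E \<in> sets M" by measurable
    ultimately have "AE \<omega> in M. \<omega> \<notin> ?E"
      by (subst AE_iff_null_sets[symmetric]) (auto simp: emeasure_eq_measure)
    with AE_space have "AE \<omega> in M. \<xi> 0 \<omega> * indicator {\<omega>. \<exists>n. running_min n (?\<Xi> \<omega>) < 0} \<omega> = \<xi> 0 \<omega>"
    proof eventually_elim
      fix \<omega> assume "\<omega> \<in> space M" "\<omega> \<notin> ?E"
      then obtain k where "(\<Sum>i<k. \<xi> i \<omega>) < 0" by (auto simp: not_le)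
      with running_min_le_sum[of k k "?\<Xi> \<omega>"] have "running_min k (?\<Xi> \<omega>) < 0" by simp
      then show "\<xi> 0 \<omega> * indicator {\<omega>. \<exists>n. running_min n (?\<Xi> \<omega>) < 0} \<omega> = \<xi> 0 \<omega>"
        by (auto simp: indicator_def)
    qed
    then have "(\<integral>\<omega>. \<xi> 0 \<omega> * indicator {\<omega>. \<exists>n. running_min n (?\<Xi> \<omega>) < 0} \<omega> \<partial>M) = expectation (\<xi> 0)"
      by (rule integral_cong_AE[rotated 2]) measurable
    with le pos show False by simp
  qed
qed

context levy_paths
begin

section \<open>Divergence of the walk and of the path\<close>

text \<open>Steps reduced by half the mean still have positive mean, so with positive probability
  the walk stays above a line of positive slope. Divergence is a tail event of the steps, and
  Kolmogorov's law raises the probability to one; this takes the place of the strong law of large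
  numbers.\<close>

lemma walk_tendsto_at_top:
  assumes int: "integrable M (Y 1)" and pos: "expectation (Y 1) > 0"
  shows "AE \<omega> in M. filterlim (\<lambda>n. Y (real n) \<omega>) at_top sequentially"
proof -
  define c where "c = expectation (Y 1) / 2"
  define \<xi> where "\<xi> i \<omega> = Y (real (Suc i)) \<omega> - Y (real i) \<omega>" for i \<omega>
  have [measurable]: "\<xi> i \<in> borel_measurable M" for i unfolding \<xi>_def by measurable
  have law: "distr M borel (\<xi> i) = distr M borel (Y 1)" for i
    using stat[of "real i" 1] by (simp add: \<xi>_def[abs_def] add.commute)
  have ind: "indep_vars (\<lambda>_. borel) (\<lambda>i. \<xi> (i + k)) (UNIV :: nat set)" for k
    using indep_incr[of "\<lambda>i. real (i + k)"] by (simp add: \<xi>_def[abs_def] incseq_def)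
  have seq: "distr M (PiM UNIV (\<lambda>_. borel)) (\<lambda>\<omega> i. \<xi> (i + k) \<omega>) = PiM UNIV (\<lambda>_. distr M borel (Y 1))" for k
    using ind[of k] indep_vars_iff_distr_eq_PiM'[of UNIV "\<lambda>i. \<xi> (i + k)" "\<lambda>_. borel"]
    by (simp add: law restrict_UNIV)
  have intx: "integrable M (\<xi> i)" and Ex: "expectation (\<xi> i) = expectation (Y 1)" for i
  proof -
    have "integrable (distr M borel (Y 1)) (\<lambda>x. x)" using int by (subst integrable_distr_eq) auto
    then show "integrable M (\<xi> i)" unfolding law[of i, symmetric] by (subst (asm) integrable_distr_eq) auto
    have "expectation (\<xi> i) = (\<integral>x. x \<partial>distr M borel (\<xi> i))" by (rule integral_distr[symmetric]) auto
    also have "\<dots> = expectation (Y 1)" unfolding law by (rule integral_distr) auto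
    finally show "expectation (\<xi> i) = expectation (Y 1)" .
  qed
  have shift_meas [measurable]: "(\<lambda>\<omega> i. \<xi> (i + k) \<omega>) \<in> M \<rightarrow>\<^sub>M PiM UNIV (\<lambda>_. borel)" for k
    by (rule measurable_PiM_single') auto
  have cmeas: "(\<lambda>z i. z i - c) \<in> PiM UNIV (\<lambda>_. borel) \<rightarrow>\<^sub>M PiM (UNIV :: nat set) (\<lambda>_. borel :: real measure)"
    by (rule measurable_PiM_single') (auto intro!: borel_measurable_diff measurable_component_singleton)
  have seqc: "distr M (PiM UNIV (\<lambda>_. borel)) (\<lambda>\<omega> i. \<xi> (i + k) \<omega> - c) =
     distr (PiM UNIV (\<lambda>_. distr M borel (Y 1))) (PiM UNIV (\<lambda>_. borel)) (\<lambda>z i. z i - c)" for k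
    unfolding seq[of k, symmetric] by (subst distr_distr[OF cmeas shift_meas]) (simp add: comp_def)
  have "prob {\<omega> \<in> space M. \<forall>k. 0 \<le> (\<Sum>i<k. \<xi> i \<omega> - c)} > 0"
  proof (rule stationary_sums_nonneg)
    show "expectation (\<lambda>\<omega>. \<xi> 0 \<omega> - c) > 0"
      using pos intx[of 0] by (simp add: Ex prob_space c_def)
    show "distr M (PiM UNIV (\<lambda>_. borel)) (\<lambda>\<omega> i. \<xi> (Suc i) \<omega> - c) = distr M (PiM UNIV (\<lambda>_. borel)) (\<lambda>\<omega> i. \<xi> i \<omega> - c)"
      using seqc[of 1] seqc[of 0] by simp
  qed (use intx in auto)
  moreover have "(\<Sum>i<k. \<xi> i \<omega> - c) = Y (real k) \<omega> - real k * c" for k \<omega>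
  proof -
    have "(\<Sum>i<k. \<xi> i \<omega>) = Y (real k) \<omega>"
      unfolding \<xi>_def sum_lessThan_telescope[of "\<lambda>i. Y (real i) \<omega>"] by (simp add: zero)
    then show ?thesis by (simp add: sum_subtractf)
  qed
  ultimately have prob_pos: "prob {\<omega> \<in> space M. \<forall>k. real k * c \<le> Y (real k) \<omega>} > 0" by simp
  let ?G = "{\<omega> \<in> space M. filterlim (\<lambda>n. Y (real n) \<omega>) at_top sequentially}"
  define A where "A i = sigma_sets (space M) {\<xi> i -` B \<inter> space M | B. B \<in> sets borel}" for i
  have tail: "?G \<in> tail_events A"
    unfolding tail_events_def
  proof (rule INT_I)
    fix n
    define N where "N = sigma (space M) (\<Union> (A ` {n..}))"
    have Apow: "\<Union> (A ` {n..}) \<subseteq> Pow (space M)"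
      unfolding A_def by (auto dest: sigma_sets_into_sp[rotated])
    have spN: "space N = space M" unfolding N_def using Apow by (rule space_measure_of)
    have seN: "sets N = sigma_sets (space M) (\<Union> (A ` {n..}))" unfolding N_def using Apow by (rule sets_measure_of)
    have [measurable]: "\<xi> (n + i) \<in> borel_measurable N" for i
    proof (rule measurableI)
      fix B :: "real set" assume "B \<in> sets borel"
      then have "\<xi> (n + i) -` B \<inter> space M \<in> A (n + i)"
        unfolding A_def by (intro sigma_sets.Basic) blast
      then show "\<xi> (n + i) -` B \<inter> space N \<in> sets N"
        unfolding spN seN by (intro sigma_sets.Basic) auto
    qed simp
    \<comment> \<open>Subtracting \<open>Y (real n)\<close> does not affect divergence, so the event
      is described by the steps from index \<open>n\<close> on, with countably many thresholds to
      keep it measurable.\<close>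
    have eq: "filterlim (\<lambda>k. Y (real k) \<omega>) at_top sequentially \<longleftrightarrow> (\<forall>K::nat. \<exists>m. \<forall>k\<ge>m. real K \<le> (\<Sum>i<k. \<xi> (n + i) \<omega>))" for \<omega>
    proof -
      have sum: "(\<Sum>i<k. \<xi> (n + i) \<omega>) = Y (real (k + n)) \<omega> - Y (real n) \<omega>" for k
        unfolding \<xi>_def using sum_lessThan_telescope[of "\<lambda>i. Y (real (n + i)) \<omega>" k] by (simp add: add.commute)
      have "filterlim (\<lambda>k. Y (real k) \<omega>) at_top sequentially \<longleftrightarrow> filterlim (\<lambda>k. Y (real (k + n)) \<omega>) at_top sequentially"
      proof -
        have "eventually (\<lambda>k. Z \<le> Y (real (k + n)) \<omega>) sequentially \<longleftrightarrow> eventually (\<lambda>k. Z \<le> Y (real k) \<omega>) sequentially" for Z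
          by (rule eventually_sequentially_seg)
        then show ?thesis unfolding filterlim_at_top by (simp only:)
      qed
      also have "\<dots> \<longleftrightarrow> filterlim (\<lambda>k. Y (real (k + n)) \<omega> - Y (real n) \<omega>) at_top sequentially"
      proof
        assume "filterlim (\<lambda>k. Y (real (k + n)) \<omega>) at_top sequentially"
        from filterlim_tendsto_add_at_top[OF tendsto_const[of "- Y (real n) \<omega>"] this]
        show "filterlim (\<lambda>k. Y (real (k + n)) \<omega> - Y (real n) \<omega>) at_top sequentially" by simp
      next
        assume "filterlim (\<lambda>k. Y (real (k + n)) \<omega> - Y (real n) \<omega>) at_top sequentially"
        from filterlim_tendsto_add_at_top[OF tendsto_const[of "Y (real n) \<omega>"] this]
        show "filterlim (\<lambda>k. Y (real (k + n)) \<omega>) at_top sequentially" by simp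
      qed
      also have "\<dots> \<longleftrightarrow> (\<forall>K::nat. \<exists>m. \<forall>k\<ge>m. real K \<le> (\<Sum>i<k. \<xi> (n + i) \<omega>))"
        unfolding sum filterlim_at_top eventually_sequentially
      proof (intro iffI allI)
        fix Z :: real
        assume *: "\<forall>K::nat. \<exists>m. \<forall>k\<ge>m. real K \<le> Y (real (k + n)) \<omega> - Y (real n) \<omega>"
        obtain K :: nat where K: "Z \<le> real K" using real_arch_simple by blast
        obtain m where "\<forall>k\<ge>m. real K \<le> Y (real (k + n)) \<omega> - Y (real n) \<omega>" using * by blast
        with K show "\<exists>N. \<forall>k\<ge>N. Z \<le> Y (real (k + n)) \<omega> - Y (real n) \<omega>"
          by (intro exI[of _ m]) (metis order_trans)
      qed blast
      finally show ?thesis .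
    qed
    have "?G = {\<omega> \<in> space N. \<forall>K::nat. \<exists>m. \<forall>k\<in>{m..}. real K \<le> (\<Sum>i<k. \<xi> (n + i) \<omega>)}"
      unfolding eq spN Ball_def atLeast_iff ..
    also have "\<dots> \<in> sets N" by measurable
    finally show "?G \<in> sigma_sets (space M) (\<Union> (A ` {n..}))" unfolding seN .
  qed
  have indA: "indep_sets A UNIV"
    using ind[of 0] unfolding indep_vars_def A_def by simp
  have "prob ?G = 0 \<or> prob ?G = 1"
    by (rule kolmogorov_0_1_law[OF _ indA tail]) (auto simp: A_def intro!: sigma_algebra_sigma_sets)
  moreover have G [measurable]: "?G \<in> sets M"
  proof -
    have "A i \<subseteq> events" for i using indA unfolding indep_sets_def by blast
    then show ?thesis using tail_events_sets[of A] tail by blast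
  qed
  moreover have "prob {\<omega> \<in> space M. \<forall>k. real k * c \<le> Y (real k) \<omega>} \<le> prob ?G"
  proof (rule finite_measure_mono)
    show "{\<omega> \<in> space M. \<forall>k. real k * c \<le> Y (real k) \<omega>} \<subseteq> ?G"
    proof safe
      fix \<omega> assume *: "\<forall>k. real k * c \<le> Y (real k) \<omega>"
      have "filterlim (\<lambda>k. real k * c) at_top sequentially"
      proof -
        have "c > 0" using pos by (simp add: c_def)
        then show ?thesis by real_asymp
      qed
      then show "filterlim (\<lambda>n. Y (real n) \<omega>) at_top sequentially"
        by (rule filterlim_at_top_mono) (use * in auto)
    qed
  qed fact
  ultimately have "prob ?G = 1" using prob_pos by linarith
  then have "AE \<omega> in M. \<omega> \<in> ?G" using G prob_eq_1 by blast
  then show ?thesis by eventually_elim simp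
qed

text \<open>An Ottaviani-type inequality: once the path is below \<open>y - c\<close>, it is below \<open>y\<close> at the next
  integer time with probability at least \<open>q\<close>.\<close>

lemma ottaviani:
  assumes q: "\<And>s. s \<in> {0..1} \<Longrightarrow> q \<le> p s {-c..c} 0"
  shows "{\<omega> \<in> space M. \<exists>t\<ge>real n. Y t \<omega> < y - c} \<in> sets M" (is ?meas)
    and "q * emeasure M {\<omega> \<in> space M. \<exists>t\<ge>real n. Y t \<omega> < y - c} \<le> emeasure M {\<omega> \<in> space M. \<exists>k\<ge>n. Y (real k) \<omega> < y}" (is ?le)
proof -
  let ?T = "{\<omega> \<in> space M. \<exists>t\<ge>real n. Y t \<omega> < y - c}" and ?H = "{\<omega> \<in> space M. \<exists>k\<ge>n. Y (real k) \<omega> < y}"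
  define K where "K j = {\<omega> \<in> space M. \<exists>i::nat. Y (real n + real i / 2^j) \<omega> < y - c}" for j :: nat
  have [measurable]: "K j \<in> sets M" for j unfolding K_def by measurable
  have H [measurable]: "?H \<in> sets M"
  proof -
    have "?H = {\<omega> \<in> space M. \<exists>k\<in>{n..}. Y (real k) \<omega> < y}" by auto
    also have "\<dots> \<in> sets M" by measurable
    finally show ?thesis .
  qed
  \<comment> \<open>The level is crossed strictly, so right continuity finds a dyadic time slightly
    later at which the path is still below it; the uncountable union over times becomes
    countable.\<close>
  have "?T = (\<Union>j. K j)"
  proof safe
    fix \<omega> t assume \<omega>: "\<omega> \<in> space M" and t: "real n \<le> t" "Y t \<omega> < y - c"
    let ?\<tau> = "\<lambda>j::nat. real_of_int (\<lfloor>t * 2^j\<rfloor> + 1) / 2^j"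
    have "filterlim (\<lambda>j::nat. 2^j :: real) at_top sequentially" by real_asymp
    from filterlim_compose[OF rcont[OF \<omega>] dyadic_ceiling_tendsto[OF _ this, of t]]
    have "(\<lambda>j. Y (?\<tau> j) \<omega>) \<longlonglongrightarrow> Y t \<omega>" by simp
    from order_tendstoD(2)[OF this t(2)] obtain j where j: "Y (?\<tau> j) \<omega> < y - c"
      by (auto simp: eventually_sequentially)
    let ?i = "nat (\<lfloor>t * 2^j\<rfloor> + 1 - int n * 2^j)"
    have "real n * 2^j \<le> t * 2^j" using t by simp
    then have "int n * 2^j \<le> \<lfloor>t * 2^j\<rfloor>" by (simp add: le_floor_iff)
    then have "real ?i = of_int (\<lfloor>t * 2^j\<rfloor> + 1) - real n * 2^j" by simp
    then have "real n + real ?i / 2^j = ?\<tau> j" by (simp add: field_simps)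
    with j have "Y (real n + real ?i / 2^j) \<omega> < y - c" by (simp only:)
    with \<omega> show "\<omega> \<in> (\<Union>j. K j)" unfolding K_def by blast
  next
    fix \<omega> j assume "\<omega> \<in> K j"
    then obtain i where "\<omega> \<in> space M" "Y (real n + real i / 2^j) \<omega> < y - c" unfolding K_def by blast
    then show "\<omega> \<in> space M" "\<exists>t\<ge>real n. Y t \<omega> < y - c"
      by (auto intro!: exI[of _ "real n + real i / 2^j"])
  qed
  note T = this
  show ?meas unfolding T by measurable
  have "incseq K"
  proof (rule incseq_SucI)
    fix j show "K j \<subseteq> K (Suc j)"
    proof
      fix \<omega> assume "\<omega> \<in> K j"
      then obtain i where "\<omega> \<in> space M" and i: "Y (real n + real i / 2^j) \<omega> < y - c" unfolding K_def by blast
      moreover have "real i / 2^j = real (2 * i) / 2^Suc j" by simp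
      with i have "Y (real n + real (2 * i) / 2^Suc j) \<omega> < y - c" by (simp only:)
      ultimately show "\<omega> \<in> K (Suc j)" unfolding K_def by blast
    qed
  qed
  then have "q * emeasure M ?T = (SUP j. q * emeasure M (K j))"
    unfolding T by (subst SUP_emeasure_incseq[symmetric]) (auto simp: SUP_mult_left_ennreal)
  also have "\<dots> \<le> emeasure M ?H"
  proof (rule SUP_least)
    fix j :: nat
    define \<tau> where "\<tau> i = real n + real i / 2^j" for i :: nat
    define r where "r i = nat \<lceil>\<tau> i\<rceil>" for i
    have \<tau>: "\<tau> i \<ge> real n" for i by (simp add: \<tau>_def)
    have r: "n \<le> r i" "real (r i) - \<tau> i \<in> {0..1}" for i
    proof -
      have "\<tau> i \<ge> 0" using \<tau>[of i] by linarith
      then have "real (r i) = of_int \<lceil>\<tau> i\<rceil>" unfolding r_def by simp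
      then have "\<tau> i \<le> real (r i)" "real (r i) \<le> \<tau> i + 1" by linarith+
      moreover from this \<tau>[of i] have "real n \<le> real (r i)" by linarith
      ultimately show "n \<le> r i" "real (r i) - \<tau> i \<in> {0..1}" by auto
    qed
    \<comment> \<open>First-passage decomposition on the grid. Each piece belongs to the past at its
      own grid time, hence is independent of the displacement up to the next integer
      \<open>r i\<close>.\<close>
    define E where "E i = {\<omega> \<in> space M. Y (\<tau> i) \<omega> < y - c \<and> (\<forall>l\<in>{..<i}. \<not> Y (\<tau> l) \<omega> < y - c)}" for i
    have EF: "E i \<in> sets (F (\<tau> i))" for i
    proof -
      have [simp]: "{\<omega> \<in> space M. Y (\<tau> l) \<omega> < y - c} \<in> sets (F (\<tau> i))" if "l \<le> i" for l
      proof -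
        have [measurable]: "Y (\<tau> l) \<in> borel_measurable (F (\<tau> i))"
          using that by (intro rv_F) (simp add: \<tau>_def divide_right_mono)
        have "{\<omega> \<in> space (F (\<tau> i)). Y (\<tau> l) \<omega> < y - c} \<in> sets (F (\<tau> i))" by measurable
        then show ?thesis by simp
      qed
      have "{\<omega> \<in> space (F (\<tau> i)). Y (\<tau> i) \<omega> < y - c \<and> (\<forall>l\<in>{..<i}. \<not> Y (\<tau> l) \<omega> < y - c)} \<in> sets (F (\<tau> i))"
        by (intro sets.sets_Collect_conj sets.sets_Collect_finite_All sets.sets_Collect_neg) auto
      then show ?thesis unfolding E_def by simp
    qed
    have EM [measurable]: "E i \<in> sets M" for i using EF sets_F_subset by blast
    define D where "D i = {\<omega> \<in> E i. Y (real (r i)) \<omega> - Y (\<tau> i) \<omega> \<in> {-c..c}}" for i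
    have DM [measurable]: "D i \<in> sets M" for i
    proof -
      have "D i = E i \<inter> {\<omega> \<in> space M. Y (real (r i)) \<omega> - Y (\<tau> i) \<omega> \<in> {-c..c}}"
        using sets.sets_into_space[OF EM] by (auto simp: D_def)
      then show ?thesis by simp
    qed
    have disjE: "disjoint_family E"
    proof -
      have "E i \<inter> E l = {}" if "i < l" for i l using that by (auto simp: E_def)
      then show ?thesis unfolding disjoint_family_on_def by (metis inf_commute linorder_neqE_nat)
    qed
    have disjD: "disjoint_family D"
      by (rule disjoint_family_subset[OF disjE]) (auto simp: D_def)
    have "K j = (\<Union>i. E i)"
    proof safe
      fix \<omega> assume "\<omega> \<in> K j"
      then have \<omega>: "\<omega> \<in> space M" and ex: "\<exists>i. Y (\<tau> i) \<omega> < y - c" unfolding K_def \<tau>_def by auto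
      from ex have "Y (\<tau> (LEAST i. Y (\<tau> i) \<omega> < y - c)) \<omega> < y - c" by (rule LeastI_ex)
      with \<omega> not_less_Least[of _ "\<lambda>i. Y (\<tau> i) \<omega> < y - c"] show "\<omega> \<in> (\<Union>i. E i)"
        unfolding E_def by blast
    qed (auto simp: E_def K_def \<tau>_def)
    then have "q * emeasure M (K j) = (\<Sum>i. q * emeasure M (E i))"
      using suminf_emeasure[OF _ disjE] by (simp add: image_subset_iff)
    also have "\<dots> \<le> (\<Sum>i. emeasure M (D i))"
    proof (rule suminf_le)
      fix i
      have "q * emeasure M (E i) \<le> p (real (r i) - \<tau> i) {-c..c} 0 * emeasure M (E i)"
        by (intro mult_right_mono q r) simp
      also have "\<dots> = (\<integral>\<^sup>+\<omega>. indicator (E i) \<omega> * p (real (r i) - \<tau> i) {-c..c} 0 \<partial>M)"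
        by (subst nn_integral_indicator_F[OF EF]) (rule mult.commute)
      also have "\<dots> = (\<integral>\<^sup>+\<omega>. indicator (E i) \<omega> * indicator {-c..c} (0 + (Y (\<tau> i + (real (r i) - \<tau> i)) \<omega> - Y (\<tau> i) \<omega>)) \<partial>M)"
        using r[of i] \<tau>[of i] EF by (intro markov_p[symmetric]) auto
      also have "\<dots> = (\<integral>\<^sup>+\<omega>. indicator (D i) \<omega> \<partial>M)"
        by (intro nn_integral_cong) (auto simp: indicator_def D_def)
      finally show "q * emeasure M (E i) \<le> emeasure M (D i)" by simp
    qed auto
    also have "\<dots> = emeasure M (\<Union>i. D i)"
      by (rule suminf_emeasure[OF _ disjD]) auto
    also have "\<dots> \<le> emeasure M ?H"
    proof (rule emeasure_mono[OF _ H], safe)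
      fix i \<omega> assume "\<omega> \<in> D i"
      then have "\<omega> \<in> space M" "Y (real (r i)) \<omega> < y" by (auto simp: D_def E_def)
      then show "\<omega> \<in> space M" "\<exists>k\<ge>n. Y (real k) \<omega> < y" using r[of i] by auto
    qed
    finally show "q * emeasure M (K j) \<le> emeasure M ?H" .
  qed
  finally show ?le .
qed

text \<open>Dropping below \<open>y - c\<close> at some real time after \<open>n\<close> is at most
  four times as likely as the walk being below \<open>y\<close> at some integer time from
  \<open>n\<close> on, and the latter probability tends to 0.\<close>

lemma paths_tendsto_at_top:
  assumes "integrable M (Y 1)" "expectation (Y 1) > 0"
  shows "AE \<omega> in M. filterlim (\<lambda>t. Y t \<omega>) at_top at_top"
proof -
  obtain c where c: "c > 0" "\<And>s. s \<in> {0..1} \<Longrightarrow> 1/4 \<le> p s {-c..c} 0"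
    using tight_unit_interval by blast
  have "AE \<omega> in M. \<exists>n. \<forall>t\<ge>real n. y - c \<le> Y t \<omega>" for y :: real
  proof -
    let ?T = "\<lambda>n. {\<omega> \<in> space M. \<exists>t\<ge>real n. Y t \<omega> < y - c}"
    let ?H = "\<lambda>n. {\<omega> \<in> space M. \<exists>k\<in>{n..}. Y (real k) \<omega> < y}"
    have H: "{\<omega> \<in> space M. \<exists>k\<ge>n. Y (real k) \<omega> < y} = ?H n" for n :: nat by auto
    have [measurable]: "?T n \<in> sets M" for n :: nat using ottaviani(1)[OF c(2)] .
    have "AE \<omega> in M. \<omega> \<notin> (\<Inter>n. ?H n)"
      using walk_tendsto_at_top[OF assms]
    proof eventually_elim
      fix \<omega> assume "filterlim (\<lambda>n. Y (real n) \<omega>) at_top sequentially"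
      then obtain n where "\<And>k. n \<le> k \<Longrightarrow> y \<le> Y (real k) \<omega>"
        unfolding filterlim_at_top eventually_sequentially by meson
      then show "\<omega> \<notin> (\<Inter>n. ?H n)" by (auto simp: not_less intro!: exI[of _ n])
    qed
    moreover have "(\<Inter>n. ?H n) \<in> sets M" by (intro sets.countable_INT) auto
    ultimately have "emeasure M (\<Inter>n. ?H n) = 0"
      using AE_iff_null_sets by blast
    moreover have "(\<lambda>n. emeasure M (?H n)) \<longlonglongrightarrow> emeasure M (\<Inter>n. ?H n)"
      by (rule Lim_emeasure_decseq) (auto simp: decseq_def)
    ultimately have lim: "(\<lambda>n. emeasure M (?H n)) \<longlonglongrightarrow> 0" by simp
    have "1/4 * emeasure M (\<Inter>n. ?T n) \<le> 0"
    proof (rule LIMSEQ_le_const[OF lim], intro exI[of _ 0] allI impI)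
      fix n
      have "1/4 * emeasure M (\<Inter>n. ?T n) \<le> 1/4 * emeasure M (?T n)"
        by (intro mult_left_mono emeasure_mono) auto
      also have "\<dots> \<le> emeasure M (?H n)" using ottaviani(2)[OF c(2), of n y] unfolding H .
      finally show "1/4 * emeasure M (\<Inter>n. ?T n) \<le> emeasure M (?H n)" .
    qed
    then have "emeasure M (\<Inter>n. ?T n) = 0"
      by (auto simp: ennreal_quarter)
    then have "(\<Inter>n. ?T n) \<in> null_sets M" by (auto intro!: sets.countable_INT)
    from AE_not_in[OF this] AE_space show ?thesis
      by eventually_elim (auto simp: not_less)
  qed
  then have "AE \<omega> in M. \<forall>m::nat. \<exists>n. \<forall>t\<ge>real n. real m - c \<le> Y t \<omega>"
    by (subst AE_all_countable) auto
  then show ?thesis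
  proof eventually_elim
    fix \<omega> assume *: "\<forall>m::nat. \<exists>n. \<forall>t\<ge>real n. real m - c \<le> Y t \<omega>"
    show "filterlim (\<lambda>t. Y t \<omega>) at_top at_top"
      unfolding filterlim_at_top eventually_at_top_linorder
    proof
      fix Z :: real
      obtain m :: nat where "Z + c \<le> real m" using real_arch_simple by blast
      with * show "\<exists>N. \<forall>t\<ge>N. Z \<le> Y t \<omega>" by (smt (verit))
    qed
  qed
qed

end

section \<open>Comparison with Lebesgue measure\<close>

text \<open>An almost optimal cover by closed intervals with disjoint interiors is opened up; the
  price is the set of endpoints, which is countable.\<close>

lemma interval_cover:
  assumes A: "A \<in> sets (borel :: real measure)" "A \<subseteq> {-k..k}" and k: "0 < k" and e: "0 < e"
  obtains \<D> where "countable \<D>" "\<And>K. K \<in> \<D> \<Longrightarrow> \<exists>c d. c < d \<and> K = {c<..<d}" "disjoint \<D>"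
    "countable (A - \<Union>\<D>)" "emeasure lborel (\<Union>\<D>) \<le> emeasure lborel A + ennreal e"
proof -
  have Ab: "A \<subseteq> cbox (-k) k" using A(2) by simp
  have fin: "emeasure lborel A < \<infinity>"
    using emeasure_mono[OF A(2), of lborel] k by (auto simp: less_top intro: le_less_trans)
  have Am: "A \<in> lmeasurable"
    using A(1) fin by (intro fmeasurableI) (auto simp: emeasure_completion)
  obtain \<D> where D: "countable \<D>" "\<And>K. K \<in> \<D> \<Longrightarrow> K \<subseteq> cbox (-k) k \<and> K \<noteq> {} \<and> (\<exists>c d. K = cbox c d)"
    "pairwise (\<lambda>A B. interior A \<inter> interior B = {}) \<D>"
    "\<And>K. \<lbrakk>K \<in> \<D>; box (-k) k \<noteq> {}\<rbrakk> \<Longrightarrow> interior K \<noteq> {}"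
    "A \<subseteq> \<Union>\<D>" "\<Union>\<D> \<in> lmeasurable" "measure lebesgue (\<Union>\<D>) \<le> measure lebesgue A + e"
    by (rule measurable_outer_intervals_bounded[OF Am Ab e]) blast
  have K: "\<exists>c d. c < d \<and> K = {c..d} \<and> interior K = {c<..<d}" if "K \<in> \<D>" for K
  proof -
    obtain c d where "K = {c..d}" using D(2)[OF \<open>K \<in> \<D>\<close>] by auto
    moreover have "interior K \<noteq> {}" using D(4)[OF \<open>K \<in> \<D>\<close>] k by simp
    ultimately show ?thesis by (intro exI[of _ c] exI[of _ d]) (auto simp: interior_atLeastAtMost_real)
  qed
  show thesis
  proof (rule that[of "interior ` \<D>"])
    show "countable (interior ` \<D>)" using D(1) by simp
    show "disjoint (interior ` \<D>)"
    proof (rule disjointI)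
      fix a b assume "a \<in> interior ` \<D>" "b \<in> interior ` \<D>" "a \<noteq> b"
      then obtain A B where "a = interior A" "b = interior B" "A \<in> \<D>" "B \<in> \<D>" "A \<noteq> B" by auto
      with pairwiseD[OF D(3)] show "a \<inter> b = {}" by simp
    qed
    show "\<exists>c d. c < d \<and> K = {c<..<d}" if "K \<in> interior ` \<D>" for K
      using K that by blast
    have "A - \<Union>(interior ` \<D>) \<subseteq> (\<Union>K\<in>\<D>. K - interior K)" using D(5) by blast
    moreover have "countable (K - interior K)" if "K \<in> \<D>" for K
    proof -
      obtain c d where "K = {c..d}" "interior K = {c<..<d}" using K[OF \<open>K \<in> \<D>\<close>] by blast
      then have "K - interior K \<subseteq> {c, d}" by auto
      then show ?thesis by (meson countable_finite finite.intros finite_subset)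
    qed
    ultimately show "countable (A - \<Union>(interior ` \<D>))"
      using D(1) by (meson countable_UN countable_subset)
    have "emeasure lborel (\<Union>(interior ` \<D>)) = emeasure lebesgue (\<Union>(interior ` \<D>))"
    proof -
      have "open (\<Union>(interior ` \<D>))" by auto
      then have "\<Union>(interior ` \<D>) \<in> sets borel" by (rule borel_open)
      then show ?thesis by (simp add: emeasure_completion)
    qed
    also have "\<dots> \<le> emeasure lebesgue (\<Union>\<D>)"
      using D(6) interior_subset by (intro emeasure_mono) (auto simp: fmeasurableD)
    also have "\<dots> = ennreal (measure lebesgue (\<Union>\<D>))"
      using D(6) by (simp add: emeasure_eq_measure2)
    also have "\<dots> \<le> ennreal (measure lebesgue A + e)" by (rule ennreal_leI) (rule D(7))
    also have "\<dots> = emeasure lebesgue A + ennreal e"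
      using e Am by (simp add: ennreal_plus emeasure_eq_measure2)
    also have "emeasure lebesgue A = emeasure lborel A" using A(1) by (simp add: emeasure_completion)
    finally show "emeasure lborel (\<Union>(interior ` \<D>)) \<le> emeasure lborel A + ennreal e" .
  qed
qed

text \<open>Outer regularity of Lebesgue measure carries the bound from intervals to bounded Borel
  sets. Degenerate intervals show that points have no mass under \<open>N\<close>, so the uncovered
  endpoints are harmless; dividing the error by \<open>c + 1\<close> also covers
  \<open>c = 0\<close>.\<close>

lemma emeasure_le_lborel:
  assumes N: "sets N = sets (borel :: real measure)" and c: "0 \<le> c"
    and int: "\<And>a b. a \<le> b \<Longrightarrow> emeasure N {a..b} \<le> ennreal c * ennreal (b - a)"
    and A: "A \<in> sets borel"
  shows "emeasure N A \<le> ennreal c * emeasure lborel A"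
proof -
  have bounded: "emeasure N A \<le> ennreal c * emeasure lborel A" if A: "A \<in> sets borel" "A \<subseteq> {-k..k}" "0 < k" for A k
  proof (rule ennreal_le_epsilon)
    fix e :: real assume e: "0 < e"
    define e' where "e' = e / (c + 1)"
    have e': "e' > 0" "c * e' \<le> e" using e c by (auto simp: e'_def field_simps)
    obtain \<D> where D: "countable \<D>" "\<And>K. K \<in> \<D> \<Longrightarrow> \<exists>c d. c < d \<and> K = {c<..<d}" "disjoint \<D>"
      "countable (A - \<Union>\<D>)" "emeasure lborel (\<Union>\<D>) \<le> emeasure lborel A + ennreal e'"
      using interval_cover[OF A e'(1)] by metis
    have Dm: "K \<in> sets borel" if "K \<in> \<D>" for K using D(2)[OF that] by auto
    have UD: "\<Union>\<D> \<in> sets borel" using Dm D(1) by (intro sets.countable_Union) auto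
    have null: "emeasure N (A - \<Union>\<D>) = 0"
    proof -
      have "{x} \<in> null_sets N" for x
        using int[of x x] by (auto simp: null_sets_def N)
      then have "(\<Union>x\<in>A - \<Union>\<D>. {x}) \<in> null_sets N" by (intro null_sets_UN' D(4)) auto
      then show ?thesis by (simp add: null_setsD1)
    qed
    have "emeasure N A \<le> emeasure N (\<Union>\<D> \<union> (A - \<Union>\<D>))"
      using A UD by (intro emeasure_mono) (auto simp: N)
    also have "\<dots> \<le> emeasure N (\<Union>\<D>) + emeasure N (A - \<Union>\<D>)"
      using A UD by (intro emeasure_subadditive) (auto simp: N)
    also have "\<dots> = emeasure N (\<Union>\<D>)" by (simp add: null)
    also have "\<dots> = (\<integral>\<^sup>+K. emeasure N K \<partial>count_space \<D>)"
      using emeasure_UN_countable[of \<D> "\<lambda>K. K" N] D(1,3) Dm by (simp add: N disjoint_family_on_disjoint_image disjoint_def disjoint_family_on_def)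
    also have "\<dots> \<le> (\<integral>\<^sup>+K. ennreal c * emeasure lborel K \<partial>count_space \<D>)"
    proof (rule nn_integral_mono)
      fix K assume "K \<in> space (count_space \<D>)"
      then obtain a b where K: "a < b" "K = {a<..<b}" using D(2)[of K] by auto
      have "emeasure N K \<le> emeasure N {a..b}" unfolding K by (intro emeasure_mono) (auto simp: N)
      also have "\<dots> \<le> ennreal c * ennreal (b - a)" using K by (intro int) simp
      also have "ennreal (b - a) = emeasure lborel K" using K by simp
      finally show "emeasure N K \<le> ennreal c * emeasure lborel K" .
    qed
    also have "\<dots> = ennreal c * (\<integral>\<^sup>+K. emeasure lborel K \<partial>count_space \<D>)"
      by (rule nn_integral_cmult) simp
    also have "(\<integral>\<^sup>+K. emeasure lborel K \<partial>count_space \<D>) = emeasure lborel (\<Union>\<D>)"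
      using emeasure_UN_countable[of \<D> "\<lambda>K. K" lborel] D(1,3) Dm by (simp add: disjoint_def disjoint_family_on_def)
    also have "ennreal c * emeasure lborel (\<Union>\<D>) \<le> ennreal c * (emeasure lborel A + ennreal e')"
      by (intro mult_left_mono D) simp
    also have "\<dots> = ennreal c * emeasure lborel A + ennreal (c * e')"
      using c e' by (simp add: distrib_left ennreal_mult)
    also have "\<dots> \<le> ennreal c * emeasure lborel A + ennreal e"
      by (intro add_left_mono ennreal_leI e')
    finally show "emeasure N A \<le> ennreal c * emeasure lborel A + ennreal e" .
  qed
  let ?A = "\<lambda>n::nat. A \<inter> {-(real n + 1)..real n + 1}"
  have A_eq: "A = (\<Union>n. ?A n)"
  proof safe
    fix x assume "x \<in> A"
    moreover obtain n :: nat where "\<bar>x\<bar> \<le> real n" using real_arch_simple by blast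
    ultimately show "x \<in> (\<Union>n. ?A n)" by (auto intro!: exI[of _ n])
  qed
  have "emeasure N A = (SUP n. emeasure N (?A n))"
    using A by (subst A_eq, intro SUP_emeasure_incseq[symmetric]) (auto simp: N incseq_def)
  also have "\<dots> \<le> ennreal c * emeasure lborel A"
  proof (rule SUP_least)
    fix n :: nat
    have "emeasure N (?A n) \<le> ennreal c * emeasure lborel (?A n)"
      using A by (intro bounded[of _ "real n + 1"]) auto
    also have "\<dots> \<le> ennreal c * emeasure lborel A"
      using A by (intro mult_left_mono emeasure_mono) auto
    finally show "emeasure N (?A n) \<le> ennreal c * emeasure lborel A" .
  qed
  finally show ?thesis .
qed

context levy_paths
begin

section \<open>The potential as a measure; comparison of scales\<close>

text \<open>The image of probability times Lebesgue measure on \<open>J\<close> under the path, so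
  that whole functions can be integrated against the potential and measures compared.\<close>

definition potm :: "real set \<Rightarrow> real \<Rightarrow> real measure" where
  "potm J y = distr (density (M \<Otimes>\<^sub>M lborel) (\<lambda>(\<omega>, t). indicator J t)) borel (\<lambda>(\<omega>, t). y + Y t \<omega>)"

lemma sets_potm [simp, measurable_cong]: "sets (potm J y) = sets borel"
  and space_potm [simp]: "space (potm J y) = UNIV"
  by (simp_all add: potm_def)

lemma nn_integral_potm:
  assumes [measurable]: "J \<in> sets borel" "f \<in> borel_measurable borel"
  shows "(\<integral>\<^sup>+x. f x \<partial>potm J y) = (\<integral>\<^sup>+t\<in>J. (\<integral>\<^sup>+\<omega>. f (y + Y t \<omega>) \<partial>M) \<partial>lborel)"
    and "(\<integral>\<^sup>+x. f x \<partial>potm J y) = (\<integral>\<^sup>+\<omega>. (\<integral>\<^sup>+t\<in>J. f (y + Y t \<omega>) \<partial>lborel) \<partial>M)"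
proof -
  have "(\<integral>\<^sup>+x. f x \<partial>potm J y) = (\<integral>\<^sup>+z. indicator J (snd z) * f (y + Y (snd z) (fst z)) \<partial>(M \<Otimes>\<^sub>M lborel))"
    unfolding potm_def by (subst nn_integral_distr) (simp_all add: nn_integral_density case_prod_beta')
  also have "\<dots> = (\<integral>\<^sup>+\<omega>. (\<integral>\<^sup>+t. indicator J t * f (y + Y t \<omega>) \<partial>lborel) \<partial>M)"
    by (subst lborel.nn_integral_fst[symmetric]) simp_all
  finally show 2: "(\<integral>\<^sup>+x. f x \<partial>potm J y) = (\<integral>\<^sup>+\<omega>. (\<integral>\<^sup>+t\<in>J. f (y + Y t \<omega>) \<partial>lborel) \<partial>M)"
    by (simp add: mult.commute)
  show "(\<integral>\<^sup>+x. f x \<partial>potm J y) = (\<integral>\<^sup>+t\<in>J. (\<integral>\<^sup>+\<omega>. f (y + Y t \<omega>) \<partial>M) \<partial>lborel)"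
    unfolding 2 by (subst Fubini_time) (simp_all add: nn_integral_multc)
qed

lemma emeasure_potm:
  assumes [measurable]: "J \<in> sets borel" "A \<in> sets borel"
  shows "emeasure (potm J y) A = pot J A y"
  using nn_integral_potm(1)[of J "indicator A" y] by (simp add: pot_def p_nn_integral)

lemma pot_pieces:
  assumes c: "\<And>x. pot J {x..x+l} y \<le> c" and l: "0 \<le> l" and [measurable]: "J \<in> sets borel"
  shows "pot J {x..x + real (Suc n) * l} y \<le> of_nat (Suc n) * c"
proof (induction n)
  case (Suc n)
  have "{x..x + (q + l)} = {x..x + q} \<union> {x + q..x + q + l}" if "0 \<le> q" for q
    using l that by auto
  from this[of "real (Suc n) * l"] l
  have eq: "{x..x + real (Suc (Suc n)) * l} = {x..x + real (Suc n) * l} \<union> {x + real (Suc n) * l..x + real (Suc n) * l + l}"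
    by (simp add: algebra_simps)
  have "pot J {x..x + real (Suc (Suc n)) * l} y \<le> pot J {x..x + real (Suc n) * l} y + pot J {x + real (Suc n) * l..x + real (Suc n) * l + l} y"
    unfolding eq by (rule pot_subadditive) auto
  also have "\<dots> \<le> of_nat (Suc n) * c + c" by (intro add_mono Suc.IH c)
  finally show ?case by (simp add: algebra_simps)
qed (use c in simp)

text \<open>Just the two shapes of time set for which the interval bound is available. Half-open
  intervals starting at 0 are closed under nonnegative differences, as the second-moment bound
  requires.\<close>

definition horizon :: "real set \<Rightarrow> bool" where
  "horizon J \<longleftrightarrow> J = {0..} \<or> (\<exists>T>0. J = {0..<T})"

lemma horizon_inf [simp]: "horizon {0..}" and horizon_fin [simp]: "0 < T \<Longrightarrow> horizon {0..<T}"
  by (auto simp: horizon_def)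

lemma horizon_sets: "horizon J \<Longrightarrow> J \<in> sets borel" and horizon_nonneg: "horizon J \<Longrightarrow> J \<subseteq> {0..}"
  and horizon_diff: "horizon J \<Longrightarrow> t \<in> J \<Longrightarrow> 0 \<le> v \<Longrightarrow> t + v \<in> J \<Longrightarrow> v \<in> J"
  by (auto simp: horizon_def)

lemma pot_interval_le_horizon:
  assumes J: "horizon J" and l: "0 < l"
  shows "pot J {a..a+l} y \<le> 2 * pot J {-2*l..2*l} 0"
proof (cases "J = {0..}")
  case True
  show ?thesis
    unfolding True
  proof (subst pot_horizon, simp, rule SUP_least)
    fix n
    show "pot {0..<real n} {a..a+l} y \<le> 2 * pot {0..} {-2*l..2*l} 0"
    proof (cases "n = 0")
      case False
      then have "pot {0..<real n} {a..a+l} y \<le> 2 * pot {0..<real n} {-2*l..2*l} 0"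
        by (intro pot_interval_le l) simp
      also have "\<dots> \<le> 2 * pot {0..} {-2*l..2*l} 0"
        by (intro mult_left_mono pot_mono_time) auto
      finally show ?thesis .
    qed (simp add: pot_def)
  qed
next
  case False
  with J pot_interval_le[OF _ l] show ?thesis by (auto simp: horizon_def)
qed

text \<open>The wide window has length \<open>4 * a\<close> and is cut into eight pieces of length
  \<open>a / 2\<close>; each costs at most twice the window \<open>{-a..a}\<close>.\<close>

lemma pot_double:
  assumes J: "horizon J" and a: "0 < a"
  shows "pot J {-2*a..2*a} 0 \<le> 16 * pot J {-a..a} 0"
proof -
  have "pot J {x..x+a/2} 0 \<le> 2 * pot J {-a..a} 0" for x
    using pot_interval_le_horizon[OF J, of "a/2" x 0] a by simp
  from pot_pieces[of J "a/2" 0, OF this _ horizon_sets[OF J], of "-2*a" 7] a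
  have "pot J {-2*a..2*a} 0 \<le> 8 * (2 * pot J {-a..a} 0)" by simp
  then show ?thesis by (simp add: mult.assoc[symmetric])
qed

lemma pot_start_le:
  assumes "z \<in> {-a..a}"
  shows "pot J {-a..a} z \<le> pot J {-2*a..2*a} 0"
  unfolding pot_def
  using assms by (intro nn_integral_mono mult_right_mono order_trans[OF eq_refl[OF p_shift] p_mono]) auto

text \<open>The factor is 2 from ordering the visits times 16 from doubling the window. It depends
  on neither \<open>a\<close> nor \<open>J\<close>, and both later uses of
  \<open>paley_zygmund\<close> rely on this.\<close>

lemma second_moment_interval:
  assumes J: "horizon J" and a: "0 < a" and s: "0 \<le> s" and B: "B \<in> sets (F s)"
  shows "(\<integral>\<^sup>+\<omega>. indicator B \<omega> * (occ_from s J {-a..a} \<omega>)\<^sup>2 \<partial>M) \<le> 32 * emeasure M B * (pot J {-a..a} 0)\<^sup>2"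
proof -
  have "(\<integral>\<^sup>+\<omega>. indicator B \<omega> * (occ_from s J {-a..a} \<omega>)\<^sup>2 \<partial>M) \<le> 2 * (emeasure M B * pot J {-a..a} 0 * (16 * pot J {-a..a} 0))"
  proof (rule occ_from_second_moment[OF s B])
    show "pot J {-a..a} z \<le> 16 * pot J {-a..a} 0" if "z \<in> {-a..a}" for z
      using pot_start_le[OF that] pot_double[OF J a] by (rule order_trans)
    show "v \<in> J" if "t \<in> J" "0 \<le> v" "t + v \<in> J" for t v
      using horizon_diff[OF J] that by blast
  qed (use horizon_sets[OF J] horizon_nonneg[OF J] in auto)
  also have "\<dots> = 32 * emeasure M B * (pot J {-a..a} 0)\<^sup>2"
  proof -
    have "2 * (b * q * (16 * q)) = (2 * 16) * b * (q * q)" for b q :: ennreal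
      by (simp only: mult_ac)
    then show ?thesis by (simp add: power2_eq_square)
  qed
  finally show ?thesis .
qed

lemma pot_pos:
  assumes "0 < a"
  shows "0 < pot {0..} {-a..a} 0"
proof -
  obtain d where d: "d > 0" "\<And>s. s \<in> {0..d} \<Longrightarrow> 1/2 \<le> p s {-a..a} 0"
    using small_times[OF assms] by blast
  have "0 < (1/2 :: ennreal) * ennreal d" unfolding ennreal_half using d by (subst ennreal_mult[symmetric]) auto
  also have "\<dots> = (\<integral>\<^sup>+s\<in>{0..d}. (1/2) \<partial>lborel)"
    using d by (subst nn_integral_cmult_indicator) auto
  also have "\<dots> \<le> pot {0..} {-a..a} 0"
    unfolding pot_def using d(2) by (intro nn_integral_mono) (auto simp: indicator_def)
  finally show ?thesis .
qed

lemma pot_finite_horizon: "0 \<le> T \<Longrightarrow> pot {0..<T} A y \<le> ennreal T"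
proof -
  assume "0 \<le> T"
  have "pot {0..<T} A y \<le> (\<integral>\<^sup>+t\<in>{0..<T}. 1 \<partial>lborel)"
    unfolding pot_def by (intro nn_integral_mono mult_right_mono p_le_1) simp
  with \<open>0 \<le> T\<close> show ?thesis by simp
qed

end

section \<open>Finiteness of the potential of bounded intervals\<close>

locale transient_levy = levy_paths +
  assumes integrable_Y1: "integrable M (Y 1)" and mean_pos: "expectation (Y 1) > 0"
begin

lemma occ_finite: "AE \<omega> in M. occ {0..} {-a..a} \<omega> < \<infinity>"
  using paths_tendsto_at_top[OF integrable_Y1 mean_pos]
proof eventually_elim
  fix \<omega> assume "filterlim (\<lambda>t. Y t \<omega>) at_top at_top"
  then obtain T where T: "\<And>t. T \<le> t \<Longrightarrow> a + 1 \<le> Y t \<omega>"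
    unfolding filterlim_at_top eventually_at_top_linorder by meson
  have "occ {0..} {-a..a} \<omega> \<le> (\<integral>\<^sup>+t. indicator {0..max 0 T} t \<partial>lborel)"
    unfolding occ_def
  proof (rule nn_integral_mono)
    fix t show "indicator {-a..a} (Y t \<omega>) * indicator {0..} t \<le> (indicator {0..max 0 T} t :: ennreal)"
      using T[of t] by (auto simp: indicator_def le_max_iff_disj)
  qed
  also have "\<dots> < \<infinity>" by simp
  finally show "occ {0..} {-a..a} \<omega> < \<infinity>" .
qed

text \<open>Almost sure finiteness is upgraded to a finite mean. On a finite horizon with mean
  \<open>m\<close>, occupation exceeds \<open>m / 2\<close> with probability at least 1/128, where
  128 is \<open>4 * 32\<close>; once \<open>K\<close> is exceeded with probability below 1/129, no
  such mean can be larger than \<open>2 * K\<close>, and the horizon can be removed.\<close>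

lemma pot_finite:
  assumes a: "0 < a"
  shows "pot {0..} {-a..a} 0 < \<infinity>"
proof -
  let ?I = "{-a..a}"
  let ?B = "\<lambda>K::nat. {\<omega> \<in> space M. ennreal (real K) < occ {0..} ?I \<omega>}"
  have "AE \<omega> in M. \<omega> \<notin> (\<Inter>K. ?B K)"
    using occ_finite[of a]
  proof eventually_elim
    fix \<omega> assume "occ {0..} ?I \<omega> < \<infinity>"
    then obtain K :: nat where "occ {0..} ?I \<omega> < of_nat K"
      using ennreal_Ex_less_of_nat[of "occ {0..} ?I \<omega>"] by auto
    then show "\<omega> \<notin> (\<Inter>K. ?B K)" by (auto simp: ennreal_of_nat_eq_real_of_nat not_less intro!: exI[of _ K])
  qed
  moreover have "(\<Inter>K. ?B K) \<in> sets M" by (intro sets.countable_INT) auto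
  ultimately have "emeasure M (\<Inter>K. ?B K) = 0"
    using AE_iff_null_sets by blast
  moreover have "(\<lambda>K. emeasure M (?B K)) \<longlonglongrightarrow> emeasure M (\<Inter>K. ?B K)"
    by (rule Lim_emeasure_decseq) (auto simp: decseq_def intro: le_less_trans[OF ennreal_leI[OF of_nat_mono]])
  ultimately have "(\<lambda>K. emeasure M (?B K)) \<longlonglongrightarrow> 0" by simp
  from order_tendstoD(2)[OF this, of "ennreal (1/129)"]
  obtain K where K: "emeasure M (?B K) < ennreal (1/129)"
    by (auto simp: eventually_sequentially)
  have "pot {0..<real n} ?I 0 \<le> ennreal (2 * real K)" for n
  proof (rule ccontr)
    assume neg: "\<not> ?thesis"
    obtain m where m: "pot {0..<real n} ?I 0 = ennreal m" "0 \<le> m"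
      using pot_finite_horizon[of "real n" ?I 0] by (cases "pot {0..<real n} ?I 0") (auto simp: top_unique)
    with neg have mK: "2 * real K < m" by (simp add: not_le ennreal_less_iff)
    have n: "0 < real n" using neg by (cases "n = 0") (auto simp: pot_def)
    have sp: "space M \<in> sets (F 0)" using sets.top[of "F 0"] by simp
    have "emeasure M (space M) \<le> ennreal (4 * 32) * emeasure M {\<omega> \<in> space M. ennreal (m / 2) < occ {0..<real n} ?I \<omega>}"
    proof (rule paley_zygmund)
      show "ennreal m * emeasure M (space M) \<le> (\<integral>\<^sup>+\<omega>. occ {0..<real n} ?I \<omega> \<partial>M)"
        by (subst occ_mean) (auto simp: m emeasure_space_1)
      have "(\<integral>\<^sup>+\<omega>. (occ {0..<real n} ?I \<omega>)\<^sup>2 \<partial>M) = (\<integral>\<^sup>+\<omega>. indicator (space M) \<omega> * (occ_from 0 {0..<real n} ?I \<omega>)\<^sup>2 \<partial>M)"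
        by (intro nn_integral_cong) (simp add: occ_from_0)
      also have "\<dots> \<le> 32 * emeasure M (space M) * (pot {0..<real n} ?I 0)\<^sup>2"
        using n a sp by (intro second_moment_interval) auto
      also have "\<dots> = ennreal (32 * m\<^sup>2) * emeasure M (space M)"
        using m by (simp add: emeasure_space_1 ennreal_mult ennreal_power)
      finally show "(\<integral>\<^sup>+\<omega>. (occ {0..<real n} ?I \<omega>)\<^sup>2 \<partial>M) \<le> ennreal (32 * m\<^sup>2) * emeasure M (space M)" .
    qed (use mK in \<open>auto simp: emeasure_space_1 less_top\<close>)
    also have "\<dots> \<le> ennreal (4 * 32) * emeasure M (?B K)"
    proof (intro mult_left_mono emeasure_mono)
      show "{\<omega> \<in> space M. ennreal (m / 2) < occ {0..<real n} ?I \<omega>} \<subseteq> ?B K"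
      proof safe
        fix \<omega> assume "ennreal (m / 2) < occ {0..<real n} ?I \<omega>"
        moreover have "ennreal (real K) \<le> ennreal (m / 2)" using mK by (intro ennreal_leI) simp
        moreover have "occ {0..<real n} ?I \<omega> \<le> occ {0..} ?I \<omega>"
          unfolding occ_def by (intro nn_integral_mono) (auto simp: indicator_def)
        ultimately show "ennreal (real K) < occ {0..} ?I \<omega>" by (meson le_less_trans less_le_trans)
      qed
    qed auto
    also have "\<dots> \<le> ennreal (4 * 32) * ennreal (1/129)"
      using K by (intro mult_left_mono) auto
    also have "\<dots> = ennreal (128/129)" by (subst ennreal_mult[symmetric]) auto
    also have "\<dots> < ennreal 1" by (subst ennreal_less_iff) auto
    finally show False by (simp add: emeasure_space_1)
  qed
  then have "pot {0..} ?I 0 \<le> ennreal (2 * real K)"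
    by (subst pot_horizon) (auto intro!: SUP_least)
  then show ?thesis by (auto simp: less_top intro: le_less_trans)
qed

end

section \<open>Bounded potential density\<close>

text \<open>The form in which local times enter. The quantifier over null sets stands inside the
  almost sure statement because the null set to which it will be applied depends on the
  path.\<close>

locale local_time_levy = transient_levy +
  assumes occ_ac: "AE \<omega> in M. \<forall>N\<in>null_sets lborel. occ {0..} N \<omega> = 0"
begin

definition occ_around :: "real \<Rightarrow> 'a \<Rightarrow> real \<Rightarrow> ennreal" where
  "occ_around \<epsilon> \<omega> y = (\<integral>\<^sup>+t\<in>{0..}. indicator {-\<epsilon>..\<epsilon>} (Y t \<omega> - y) \<partial>lborel)"

lemma occ_around_measurable [measurable (raw)]:
  assumes [measurable]: "f \<in> N \<rightarrow>\<^sub>M M" "g \<in> borel_measurable N"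
  shows "(\<lambda>x. occ_around \<epsilon> (f x) (g x)) \<in> borel_measurable N"
  unfolding occ_around_def by measurable

text \<open>Visits before \<open>s\<close> are added. The future part is independent of the past,
  which suits moment computations; the full occupation depends on \<open>s\<close> only through the
  position \<open>Y s\<close>, so it can be integrated over positions.\<close>

lemma occ_from_le_occ_around:
  assumes "0 \<le> s" and [measurable]: "\<omega> \<in> space M"
  shows "occ_from s {0..} {-\<epsilon>..\<epsilon>} \<omega> \<le> occ_around \<epsilon> \<omega> (Y s \<omega>)"
proof -
  have "occ_from s {0..} {-\<epsilon>..\<epsilon>} \<omega> \<le> (\<integral>\<^sup>+t. indicator {-\<epsilon>..\<epsilon>} (Y (s + t) \<omega> - Y s \<omega>) * indicator {0..} (s + t) \<partial>lborel)"
    unfolding occ_from_def using assms(1) by (intro nn_integral_mono) (auto simp: indicator_def)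
  also have "\<dots> = occ_around \<epsilon> \<omega> (Y s \<omega>)"
    unfolding occ_around_def
    by (rule nn_integral_shift[of "\<lambda>t. indicator {-\<epsilon>..\<epsilon>} (Y t \<omega> - Y s \<omega>) * indicator {0..} t"]) measurable
  finally show ?thesis .
qed

text \<open>Occupation near the current position, seen under the measure \<open>1\<^sub>W(Y\<^sub>s) ds dP\<close>: the second moment
  bound makes it comparable to its mean with a probability bounded below.\<close>

lemma high_occupation_points:
  assumes \<epsilon>: "0 < \<epsilon>" and m: "0 < m" "pot {0..} {-\<epsilon>..\<epsilon>} 0 = ennreal m"
  shows "pot {0..} {-1..1} 0 \<le> 128 *
    (\<integral>\<^sup>+x. indicator {-1..1} (Y (snd x) (fst x)) * indicator {0..} (snd x) *
       indicator {x. ennreal (m / 2) < occ_around \<epsilon> (fst x) (Y (snd x) (fst x))} x \<partial>(M \<Otimes>\<^sub>M lborel))"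
proof -
  let ?g = "\<lambda>x. indicator {-1..1} (Y (snd x) (fst x)) * indicator {0..} (snd x) :: ennreal"
  let ?N = "density (M \<Otimes>\<^sub>M lborel) ?g"
  \<comment> \<open>Moments are computed for future occupation only, since it is independent of the
    event that the current position lies in \<open>{-1..1}\<close>; occupation around the position
    is restored at the end by monotonicity.\<close>
  let ?Z = "\<lambda>x. occ_from (snd x) {0..} {-\<epsilon>..\<epsilon>} (fst x)"
  let ?B = "\<lambda>s. {\<omega> \<in> space M. Y s \<omega> \<in> {-1..1}}"
  have B: "?B s \<in> sets (F s)" for s
  proof -
    have [measurable]: "Y s \<in> borel_measurable (F s)" by (rule rv_F) simp
    have "{\<omega> \<in> space (F s). Y s \<omega> \<in> {-1..1}} \<in> sets (F s)" by measurable
    then show ?thesis by simp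
  qed
  have pB: "emeasure M (?B s) = p s {-1..1} 0" for s by (simp add: p_def)
  have [measurable]: "?g \<in> borel_measurable (M \<Otimes>\<^sub>M lborel)" "?Z \<in> borel_measurable (M \<Otimes>\<^sub>M lborel)"
    by measurable
  have int: "(\<integral>\<^sup>+x. h x \<partial>?N) = (\<integral>\<^sup>+s. (\<integral>\<^sup>+\<omega>. indicator (?B s) \<omega> * h (\<omega>, s) \<partial>M) * indicator {0..} s \<partial>lborel)"
    if [measurable]: "h \<in> borel_measurable (M \<Otimes>\<^sub>M borel)" for h
  proof -
    have "(\<integral>\<^sup>+x. h x \<partial>?N) = (\<integral>\<^sup>+x. ?g x * h x \<partial>(M \<Otimes>\<^sub>M lborel))"
      by (rule nn_integral_density) measurable
    also have "\<dots> = (\<integral>\<^sup>+\<omega>. (\<integral>\<^sup>+s. ?g (\<omega>, s) * h (\<omega>, s) \<partial>lborel) \<partial>M)"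
      by (rule lborel.nn_integral_fst[symmetric]) measurable
    also have "\<dots> = (\<integral>\<^sup>+s. (\<integral>\<^sup>+\<omega>. ?g (\<omega>, s) * h (\<omega>, s) \<partial>M) \<partial>lborel)"
      by (rule Fubini_time) measurable
    also have "\<dots> = (\<integral>\<^sup>+s. (\<integral>\<^sup>+\<omega>. indicator (?B s) \<omega> * h (\<omega>, s) \<partial>M) * indicator {0..} s \<partial>lborel)"
    proof (rule nn_integral_cong)
      fix s
      have "(\<integral>\<^sup>+\<omega>. ?g (\<omega>, s) * h (\<omega>, s) \<partial>M) = (\<integral>\<^sup>+\<omega>. (indicator (?B s) \<omega> * h (\<omega>, s)) * indicator {0..} s \<partial>M)"
        by (rule nn_integral_cong) (simp add: indicator_def)
      also have "\<dots> = (\<integral>\<^sup>+\<omega>. indicator (?B s) \<omega> * h (\<omega>, s) \<partial>M) * indicator {0..} s"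
        by (rule nn_integral_multc) measurable
      finally show "(\<integral>\<^sup>+\<omega>. ?g (\<omega>, s) * h (\<omega>, s) \<partial>M) = (\<integral>\<^sup>+\<omega>. indicator (?B s) \<omega> * h (\<omega>, s) \<partial>M) * indicator {0..} s" .
    qed
    finally show ?thesis .
  qed
  have mass: "emeasure ?N (space ?N) = pot {0..} {-1..1} 0"
  proof -
    have "emeasure ?N (space ?N) = (\<integral>\<^sup>+x. 1 \<partial>?N)" by simp
    also have "\<dots> = (\<integral>\<^sup>+s. (\<integral>\<^sup>+\<omega>. indicator (?B s) \<omega> * 1 \<partial>M) * indicator {0..} s \<partial>lborel)"
      by (rule int) simp
    also have "\<dots> = pot {0..} {-1..1} 0"
      unfolding pot_def by (intro nn_integral_cong) (simp only: nn_integral_indicator_F[OF B] pB, simp)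
    finally show ?thesis .
  qed
  have "emeasure ?N (space ?N) \<le> ennreal (4 * 32) * emeasure ?N {x \<in> space ?N. ennreal (m / 2) < ?Z x}"
  proof (rule paley_zygmund)
    show "emeasure ?N (space ?N) < \<infinity>" unfolding mass using pot_finite[of 1] by simp
    have "(\<integral>\<^sup>+x. ?Z x \<partial>?N) = (\<integral>\<^sup>+s. (\<integral>\<^sup>+\<omega>. indicator (?B s) \<omega> * occ_from s {0..} {-\<epsilon>..\<epsilon>} \<omega> \<partial>M) * indicator {0..} s \<partial>lborel)"
      by (subst int) simp_all
    also have "\<dots> = (\<integral>\<^sup>+s. ennreal m * (p s {-1..1} 0 * indicator {0..} s) \<partial>lborel)"
    proof (rule nn_integral_cong)
      fix s
      show "(\<integral>\<^sup>+\<omega>. indicator (?B s) \<omega> * occ_from s {0..} {-\<epsilon>..\<epsilon>} \<omega> \<partial>M) * indicator {0..} s = ennreal m * (p s {-1..1} 0 * indicator {0..} s)"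
      proof (cases "0 \<le> s")
        case True
        have "(\<integral>\<^sup>+\<omega>. indicator (?B s) \<omega> * occ_from s {0..} {-\<epsilon>..\<epsilon>} \<omega> \<partial>M) = p s {-1..1} 0 * ennreal m"
          using occ_from_mean[OF True B, of "{-\<epsilon>..\<epsilon>}" "{0..}"] unfolding pB m by simp
        with True show ?thesis by (simp add: mult.commute)
      qed simp
    qed
    also have "\<dots> = ennreal m * emeasure ?N (space ?N)"
      unfolding mass pot_def by (rule nn_integral_cmult) measurable
    finally show "ennreal m * emeasure ?N (space ?N) \<le> (\<integral>\<^sup>+x. ?Z x \<partial>?N)" by simp
    have "(\<integral>\<^sup>+x. (?Z x)\<^sup>2 \<partial>?N) = (\<integral>\<^sup>+s. (\<integral>\<^sup>+\<omega>. indicator (?B s) \<omega> * (occ_from s {0..} {-\<epsilon>..\<epsilon>} \<omega>)\<^sup>2 \<partial>M) * indicator {0..} s \<partial>lborel)"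
      by (subst int) simp_all
    also have "\<dots> \<le> (\<integral>\<^sup>+s. ennreal (32 * m\<^sup>2) * (p s {-1..1} 0 * indicator {0..} s) \<partial>lborel)"
    proof (rule nn_integral_mono)
      fix s
      show "(\<integral>\<^sup>+\<omega>. indicator (?B s) \<omega> * (occ_from s {0..} {-\<epsilon>..\<epsilon>} \<omega>)\<^sup>2 \<partial>M) * indicator {0..} s \<le> ennreal (32 * m\<^sup>2) * (p s {-1..1} 0 * indicator {0..} s)"
      proof (cases "0 \<le> s")
        case True
        have "ennreal (32 * m\<^sup>2) * p s {-1..1} 0 = 32 * emeasure M (?B s) * (pot {0..} {-\<epsilon>..\<epsilon>} 0)\<^sup>2"
          unfolding pB m(2) using m(1) by (simp add: ennreal_mult ennreal_power mult_ac)
        with second_moment_interval[OF horizon_inf \<epsilon> True B] True show ?thesis by simp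
      qed simp
    qed
    also have "\<dots> = ennreal (32 * m\<^sup>2) * emeasure ?N (space ?N)"
      unfolding mass pot_def by (rule nn_integral_cmult) measurable
    finally show "(\<integral>\<^sup>+x. (?Z x)\<^sup>2 \<partial>?N) \<le> ennreal (32 * m\<^sup>2) * emeasure ?N (space ?N)" .
  qed (use m in auto)
  also have "emeasure ?N {x \<in> space ?N. ennreal (m / 2) < ?Z x} = (\<integral>\<^sup>+x. ?g x * indicator {x \<in> space ?N. ennreal (m / 2) < ?Z x} x \<partial>(M \<Otimes>\<^sub>M lborel))"
  proof (rule emeasure_density)
    show "{x \<in> space ?N. ennreal (m / 2) < ?Z x} \<in> sets (M \<Otimes>\<^sub>M lborel)"
      unfolding space_density by measurable
  qed fact
  also have "\<dots> \<le> (\<integral>\<^sup>+x. ?g x * indicator {x. ennreal (m / 2) < occ_around \<epsilon> (fst x) (Y (snd x) (fst x))} x \<partial>(M \<Otimes>\<^sub>M lborel))"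
  proof (intro nn_integral_mono)
    fix x :: "'a \<times> real" assume "x \<in> space (M \<Otimes>\<^sub>M lborel)"
    then have \<omega>: "fst x \<in> space M" by (auto simp: space_pair_measure)
    show "?g x * indicator {x \<in> space ?N. ennreal (m / 2) < ?Z x} x \<le> ?g x * indicator {x. ennreal (m / 2) < occ_around \<epsilon> (fst x) (Y (snd x) (fst x))} x"
    proof (cases "0 \<le> snd x")
      case True
      then show ?thesis
        using less_le_trans[OF _ occ_from_le_occ_around[OF True \<omega>], of "ennreal (m / 2)" \<epsilon>]
        by (intro mult_left_mono) (auto simp: indicator_def)
    qed simp
  qed
  finally show ?thesis unfolding mass by (simp add: mult_left_mono)
qed

text \<open>Markov's inequality in the space variable. A time \<open>t\<close> contributes to
  positions within \<open>\<epsilon>\<close> of \<open>Y t\<close> only, a set of length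
  \<open>2 * \<epsilon>\<close>, and for positions in \<open>{-1..1}\<close> this forces
  \<open>Y t\<close> into \<open>{-2..2}\<close> because \<open>\<epsilon> \<le> 1\<close>; dividing
  by the threshold \<open>m / 2\<close> gives \<open>4 * \<epsilon> / m\<close>.\<close>

lemma small_set_of_high_occupation:
  assumes \<epsilon>: "0 < \<epsilon>" "\<epsilon> \<le> 1" and m: "0 < m"
  shows "(\<integral>\<^sup>+\<omega>. (\<integral>\<^sup>+y. indicator {-1..1} y * indicator {y. ennreal (m / 2) < occ_around \<epsilon> \<omega> y} y \<partial>lborel) \<partial>M)
    \<le> ennreal (4 * \<epsilon> / m) * pot {0..} {-2..2} 0"
proof -
  have "(\<integral>\<^sup>+\<omega>. (\<integral>\<^sup>+y. indicator {-1..1} y * indicator {y. ennreal (m / 2) < occ_around \<epsilon> \<omega> y} y \<partial>lborel) \<partial>M)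
    \<le> (\<integral>\<^sup>+\<omega>. ennreal (4 * \<epsilon> / m) * occ {0..} {-2..2} \<omega> \<partial>M)"
  proof (rule nn_integral_mono)
    fix \<omega> assume \<omega> [measurable]: "\<omega> \<in> space M"
    have "(\<integral>\<^sup>+y. indicator {-1..1} y * indicator {y. ennreal (m / 2) < occ_around \<epsilon> \<omega> y} y \<partial>lborel)
      \<le> (\<integral>\<^sup>+y. ennreal (2 / m) * (\<integral>\<^sup>+t. indicator {-1..1} y * (indicator {-\<epsilon>..\<epsilon>} (Y t \<omega> - y) * indicator {0..} t) \<partial>lborel) \<partial>lborel)"
    proof (rule nn_integral_mono)
      fix y
      have *: "(\<integral>\<^sup>+t. indicator {-1..1} y * (indicator {-\<epsilon>..\<epsilon>} (Y t \<omega> - y) * indicator {0..} t) \<partial>lborel) = indicator {-1..1} y * occ_around \<epsilon> \<omega> y"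
        unfolding occ_around_def by (rule nn_integral_cmult) measurable
      have "1 \<le> ennreal (2 / m) * occ_around \<epsilon> \<omega> y" if "ennreal (m / 2) < occ_around \<epsilon> \<omega> y"
      proof -
        have "1 = ennreal (2 / m) * ennreal (m / 2)" using m by (subst ennreal_mult[symmetric]) auto
        also have "\<dots> \<le> ennreal (2 / m) * occ_around \<epsilon> \<omega> y" using that by (intro mult_left_mono) auto
        finally show ?thesis .
      qed
      then show "indicator {-1..1} y * indicator {y. ennreal (m / 2) < occ_around \<epsilon> \<omega> y} y \<le> ennreal (2 / m) * (\<integral>\<^sup>+t. indicator {-1..1} y * (indicator {-\<epsilon>..\<epsilon>} (Y t \<omega> - y) * indicator {0..} t) \<partial>lborel)"
        unfolding * by (auto simp: indicator_def)
    qed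
    also have "\<dots> = ennreal (2 / m) * (\<integral>\<^sup>+y. (\<integral>\<^sup>+t. indicator {-1..1} y * (indicator {-\<epsilon>..\<epsilon>} (Y t \<omega> - y) * indicator {0..} t) \<partial>lborel) \<partial>lborel)"
      by (rule nn_integral_cmult) measurable
    also have "(\<integral>\<^sup>+y. (\<integral>\<^sup>+t. indicator {-1..1} y * (indicator {-\<epsilon>..\<epsilon>} (Y t \<omega> - y) * indicator {0..} t) \<partial>lborel) \<partial>lborel)
      = (\<integral>\<^sup>+t. (\<integral>\<^sup>+y. indicator {-1..1} y * (indicator {-\<epsilon>..\<epsilon>} (Y t \<omega> - y) * indicator {0..} t) \<partial>lborel) \<partial>lborel)"
      by (rule lborel_pair.Fubini') measurable
    also have "\<dots> \<le> (\<integral>\<^sup>+t. ennreal (2 * \<epsilon>) * (indicator {-2..2} (Y t \<omega>) * indicator {0..} t) \<partial>lborel)"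
    proof (rule nn_integral_mono)
      fix t
      have "(\<integral>\<^sup>+y. indicator {-1..1} y * (indicator {-\<epsilon>..\<epsilon>} (Y t \<omega> - y) * indicator {0..} t) \<partial>lborel)
         \<le> (\<integral>\<^sup>+y. (indicator {-2..2} (Y t \<omega>) * indicator {0..} t) * indicator {Y t \<omega> - \<epsilon>..Y t \<omega> + \<epsilon>} y \<partial>lborel)"
        using \<epsilon> by (intro nn_integral_mono) (auto simp: indicator_def)
      also have "\<dots> = ennreal (2 * \<epsilon>) * (indicator {-2..2} (Y t \<omega>) * indicator {0..} t)"
        using \<epsilon> by (subst nn_integral_cmult_indicator) (auto simp: mult.commute)
      finally show "(\<integral>\<^sup>+y. indicator {-1..1} y * (indicator {-\<epsilon>..\<epsilon>} (Y t \<omega> - y) * indicator {0..} t) \<partial>lborel)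
         \<le> ennreal (2 * \<epsilon>) * (indicator {-2..2} (Y t \<omega>) * indicator {0..} t)" .
    qed
    also have "\<dots> = ennreal (2 * \<epsilon>) * occ {0..} {-2..2} \<omega>"
      unfolding occ_def by (rule nn_integral_cmult) measurable
    finally have "(\<integral>\<^sup>+y. indicator {-1..1} y * indicator {y. ennreal (m / 2) < occ_around \<epsilon> \<omega> y} y \<partial>lborel)
      \<le> ennreal (2 / m) * (ennreal (2 * \<epsilon>) * occ {0..} {-2..2} \<omega>)" by (simp add: mult_left_mono)
    also have "\<dots> = ennreal (4 * \<epsilon> / m) * occ {0..} {-2..2} \<omega>"
      using m \<epsilon> by (simp add: mult.assoc[symmetric] ennreal_mult[symmetric])
    finally show "(\<integral>\<^sup>+y. indicator {-1..1} y * indicator {y. ennreal (m / 2) < occ_around \<epsilon> \<omega> y} y \<partial>lborel)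
      \<le> ennreal (4 * \<epsilon> / m) * occ {0..} {-2..2} \<omega>" .
  qed
  also have "\<dots> = ennreal (4 * \<epsilon> / m) * (\<integral>\<^sup>+\<omega>. occ {0..} {-2..2} \<omega> \<partial>M)"
    by (rule nn_integral_cmult) measurable
  also have "(\<integral>\<^sup>+\<omega>. occ {0..} {-2..2} \<omega> \<partial>M) = pot {0..} {-2..2} 0" by (rule occ_mean) auto
  finally show ?thesis .
qed

text \<open>A Borel-Cantelli argument over pairs of outcome and position. Along bad radii almost
  every position has high occupation only finitely often; absolute continuity transfers this from
  positions to times, and dominated convergence sends the share of high-occupation times to 0,
  although \<open>high_occupation_points\<close> keeps it at 1/128 or more.\<close>

lemma pot_small_interval:
  obtains C where "0 \<le> C" "\<And>\<epsilon>. 0 < \<epsilon> \<Longrightarrow> \<epsilon> \<le> 1 \<Longrightarrow> pot {0..} {-\<epsilon>..\<epsilon>} 0 \<le> ennreal (C * \<epsilon>)"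
proof -
  have "\<exists>C\<ge>0. \<forall>\<epsilon>. 0 < \<epsilon> \<and> \<epsilon> \<le> 1 \<longrightarrow> pot {0..} {-\<epsilon>..\<epsilon>} 0 \<le> ennreal (C * \<epsilon>)"
  proof (rule ccontr)
    assume "\<not> ?thesis"
    then have "\<forall>C\<ge>0. \<exists>\<epsilon>. 0 < \<epsilon> \<and> \<epsilon> \<le> 1 \<and> ennreal (C * \<epsilon>) < pot {0..} {-\<epsilon>..\<epsilon>} 0"
      by (simp only: not_ex not_all not_le de_Morgan_conj not_imp) (metis not_le)
    \<comment> \<open>Growth of the ratio like \<open>2^n\<close> makes the expected lengths of the
      exceptional position sets summable.\<close>
    then have "\<forall>n::nat. \<exists>\<epsilon>. 0 < \<epsilon> \<and> \<epsilon> \<le> 1 \<and> ennreal (2^n * \<epsilon>) < pot {0..} {-\<epsilon>..\<epsilon>} 0" by simp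
    from choice[OF this] obtain \<epsilon> where \<epsilon>: "\<And>n::nat. 0 < \<epsilon> n" "\<And>n. \<epsilon> n \<le> 1" "\<And>n. ennreal (2^n * \<epsilon> n) < pot {0..} {-\<epsilon> n..\<epsilon> n} 0"
      by blast
    define m where "m n = enn2real (pot {0..} {-\<epsilon> n..\<epsilon> n} 0)" for n
    have m: "pot {0..} {-\<epsilon> n..\<epsilon> n} 0 = ennreal (m n)" for n
      using pot_finite[OF \<epsilon>(1)[of n]] by (simp add: m_def less_top)
    have m_gt: "2^n * \<epsilon> n < m n" for n
      using \<epsilon>(3)[of n] \<epsilon>(1)[of n] unfolding m by (subst (asm) ennreal_less_iff) auto
    have m_pos: "0 < m n" for n
      using m_gt[of n] \<epsilon>(1)[of n] by (smt (verit) mult_pos_pos zero_less_power)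
    define H where "H n x = (indicator {x. ennreal (m n / 2) < occ_around (\<epsilon> n) (fst x) (snd x)} x :: ennreal)" for n and x :: "'a \<times> real"
    have H_meas [measurable]: "H n \<in> borel_measurable (M \<Otimes>\<^sub>M borel)" for n
      unfolding H_def by measurable
    have H_le: "H n x \<le> 1" for n x by (simp add: H_def indicator_def)
    obtain b where b: "pot {0..} {-2..2} 0 = ennreal b" "0 \<le> b"
      using pot_finite[of 2] by (cases "pot {0..} {-2..2} 0") auto
    have "(\<integral>\<^sup>+\<omega>. (\<integral>\<^sup>+y. (\<Sum>n. indicator {-1..1} y * H n (\<omega>, y)) \<partial>lborel) \<partial>M)
        = (\<integral>\<^sup>+\<omega>. (\<Sum>n. \<integral>\<^sup>+y. indicator {-1..1} y * H n (\<omega>, y) \<partial>lborel) \<partial>M)"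
      by (intro nn_integral_cong nn_integral_suminf) measurable
    also have "\<dots> = (\<Sum>n. \<integral>\<^sup>+\<omega>. (\<integral>\<^sup>+y. indicator {-1..1} y * H n (\<omega>, y) \<partial>lborel) \<partial>M)"
      by (rule nn_integral_suminf) measurable
    also have "\<dots> \<le> (\<Sum>n. ennreal (4 * b * (1/2)^n))"
    proof (rule suminf_le)
      fix n
      have "(\<integral>\<^sup>+\<omega>. (\<integral>\<^sup>+y. indicator {-1..1} y * H n (\<omega>, y) \<partial>lborel) \<partial>M) =
        (\<integral>\<^sup>+\<omega>. (\<integral>\<^sup>+y. indicator {-1..1} y * indicator {y. ennreal (m n / 2) < occ_around (\<epsilon> n) \<omega> y} y \<partial>lborel) \<partial>M)"
        by (simp add: H_def indicator_def)
      also have "\<dots> \<le> ennreal (4 * \<epsilon> n / m n) * ennreal b"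
        unfolding b(1)[symmetric] by (rule small_set_of_high_occupation[OF \<epsilon>(1,2) m_pos])
      also have "\<dots> = ennreal (4 * \<epsilon> n / m n * b)"
        using \<epsilon>(1)[of n] m_pos[of n] b(2) by (intro ennreal_mult[symmetric]) auto
      also have "\<dots> \<le> ennreal (4 * b * (1/2)^n)"
      proof (rule ennreal_leI)
        have "\<epsilon> n / m n \<le> (1/2)^n"
          using m_gt[of n] m_pos[of n] by (simp add: field_simps power_one_over)
        then have "4 * b * (\<epsilon> n / m n) \<le> 4 * b * (1/2)^n" using b(2) by (intro mult_left_mono) auto
        then show "4 * \<epsilon> n / m n * b \<le> 4 * b * (1/2)^n" by (simp add: mult_ac)
      qed
      finally show "(\<integral>\<^sup>+\<omega>. (\<integral>\<^sup>+y. indicator {-1..1} y * H n (\<omega>, y) \<partial>lborel) \<partial>M) \<le> ennreal (4 * b * (1/2)^n)" .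
    qed auto
    also have "\<dots> < \<infinity>"
    proof -
      have "summable (\<lambda>n. 4 * b * (1/2)^n)" by (intro summable_mult summable_geometric) simp
      then have "(\<Sum>n. ennreal (4 * b * (1/2)^n)) = ennreal (\<Sum>n. 4 * b * (1/2)^n)"
        using b(2) by (intro suminf_ennreal2) auto
      then show ?thesis by simp
    qed
    finally have fin: "(\<integral>\<^sup>+\<omega>. (\<integral>\<^sup>+y. (\<Sum>n. indicator {-1..1} y * H n (\<omega>, y)) \<partial>lborel) \<partial>M) < \<infinity>" .
    have "AE \<omega> in M. (\<integral>\<^sup>+y. (\<Sum>n. indicator {-1..1} y * H n (\<omega>, y)) \<partial>lborel) \<noteq> \<infinity>"
      by (rule nn_integral_PInf_AE) (use fin in auto)
    then have AE_fib: "AE \<omega> in M. AE s in lborel. indicator {-1..1} (Y s \<omega>) * indicator {0..} s = (0::ennreal) \<or> (\<Sum>n. H n (\<omega>, Y s \<omega>)) \<noteq> \<infinity>"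
      using occ_ac AE_space
    proof eventually_elim
      fix \<omega> assume fin: "(\<integral>\<^sup>+y. (\<Sum>n. indicator {-1..1} y * H n (\<omega>, y)) \<partial>lborel) \<noteq> \<infinity>"
        and ac: "\<forall>N\<in>null_sets lborel. occ {0..} N \<omega> = 0" and \<omega> [measurable]: "\<omega> \<in> space M"
      \<comment> \<open>The positions with infinitely many high occupations: a Lebesgue-null set
        that depends on the path itself, yet is charged no time by that path.\<close>
      let ?N = "{y. (\<Sum>n. indicator {-1..1} y * H n (\<omega>, y)) = \<infinity>}"
      have [measurable]: "?N \<in> sets borel" by measurable
      have "AE y in lborel. y \<notin> ?N"
        using nn_integral_PInf_AE[OF _ fin] by simp
      then have "?N \<in> null_sets lborel" by (subst AE_iff_null_sets) auto
      with ac have "occ {0..} ?N \<omega> = 0" by blast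
      then have "AE s in lborel. indicator ?N (Y s \<omega>) * indicator {0..} s = (0 :: ennreal)"
        unfolding occ_def by (subst (asm) nn_integral_0_iff_AE) measurable
      then show "AE s in lborel. indicator {-1..1} (Y s \<omega>) * indicator {0..} s = (0::ennreal) \<or> (\<Sum>n. H n (\<omega>, Y s \<omega>)) \<noteq> \<infinity>"
        by eventually_elim (auto simp: indicator_def split: if_splits)
    qed
    interpret MT: pair_sigma_finite M "lborel :: real measure" ..
    from AE_fib have AE: "AE x in M \<Otimes>\<^sub>M lborel. indicator {-1..1} (Y (snd x) (fst x)) * indicator {0..} (snd x) = (0::ennreal) \<or> (\<Sum>n. H n (fst x, Y (snd x) (fst x))) \<noteq> \<infinity>"
    proof (intro MT.AE_pair_measure)
      have "(\<lambda>x. \<Sum>n. H n (fst x, Y (snd x) (fst x))) \<in> borel_measurable (M \<Otimes>\<^sub>M lborel)"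
        by measurable
      then have [measurable]: "Measurable.pred (M \<Otimes>\<^sub>M lborel) (\<lambda>x. (\<Sum>n. H n (fst x, Y (snd x) (fst x))) \<noteq> \<infinity>)"
        by measurable
      show "{x \<in> space (M \<Otimes>\<^sub>M lborel). indicator {-1..1} (Y (snd x) (fst x)) * indicator {0..} (snd x) = (0::ennreal) \<or> (\<Sum>n. H n (fst x, Y (snd x) (fst x))) \<noteq> \<infinity>} \<in> sets (M \<Otimes>\<^sub>M lborel)"
        by measurable
    qed simp
    let ?g = "\<lambda>x. indicator {-1..1} (Y (snd x) (fst x)) * indicator {0..} (snd x) :: ennreal"
    have "(\<lambda>n. \<integral>\<^sup>+x. ?g x * H n (fst x, Y (snd x) (fst x)) \<partial>(M \<Otimes>\<^sub>M lborel)) \<longlonglongrightarrow> (\<integral>\<^sup>+x. 0 \<partial>(M \<Otimes>\<^sub>M (lborel :: real measure)))"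
    proof (rule nn_integral_dominated_convergence[where w = ?g])
      have "(\<integral>\<^sup>+x. ?g x \<partial>(M \<Otimes>\<^sub>M lborel)) = (\<integral>\<^sup>+\<omega>. occ {0..} {-1..1} \<omega> \<partial>M)"
        by (subst lborel.nn_integral_fst[symmetric]) (simp_all add: occ_def[abs_def])
      also have "\<dots> = pot {0..} {-1..1} 0" by (rule occ_mean) auto
      finally show "(\<integral>\<^sup>+x. ?g x \<partial>(M \<Otimes>\<^sub>M lborel)) < \<infinity>" using pot_finite[of 1] by simp
      show "AE x in M \<Otimes>\<^sub>M lborel. ?g x * H n (fst x, Y (snd x) (fst x)) \<le> ?g x" for n
        using mult_left_mono[OF H_le] by (intro AE_I2) (metis mult_1_right zero_le)
      show "AE x in M \<Otimes>\<^sub>M lborel. (\<lambda>n. ?g x * H n (fst x, Y (snd x) (fst x))) \<longlonglongrightarrow> 0"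
        using AE
      proof eventually_elim
        fix x assume *: "?g x = 0 \<or> (\<Sum>n. H n (fst x, Y (snd x) (fst x))) \<noteq> \<infinity>"
        show "(\<lambda>n. ?g x * H n (fst x, Y (snd x) (fst x))) \<longlonglongrightarrow> 0"
        proof (cases "?g x = 0")
          case False
          let ?h = "\<lambda>n. indicat_real {x. ennreal (m n / 2) < occ_around (\<epsilon> n) (fst x) (snd x)} (fst x, Y (snd x) (fst x))"
          have h: "H n (fst x, Y (snd x) (fst x)) = ennreal (?h n)" for n
            by (simp add: H_def indicator_def)
          have "(\<Sum>n. ennreal (?h n)) \<noteq> \<top>" using * False unfolding h by simp
          then have "summable ?h" by (intro summable_suminf_not_top) auto
          then have "?h \<longlonglongrightarrow> 0" by (rule summable_LIMSEQ_zero)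
          then have "(\<lambda>n. ennreal (?h n)) \<longlonglongrightarrow> ennreal 0" by (rule tendsto_ennrealI)
          moreover have "?g x = 1" using False by (auto simp: indicator_def split: if_splits)
          ultimately show ?thesis unfolding h by simp
        next
          case True
          show ?thesis unfolding True by simp
        qed
      qed
    qed measurable
    then have "(\<lambda>n. 128 * (\<integral>\<^sup>+x. ?g x * H n (fst x, Y (snd x) (fst x)) \<partial>(M \<Otimes>\<^sub>M lborel))) \<longlonglongrightarrow> 128 * 0"
      by (intro tendsto_mult_ennreal tendsto_const) auto
    moreover have "pot {0..} {-1..1} 0 \<le> 128 * (\<integral>\<^sup>+x. ?g x * H n (fst x, Y (snd x) (fst x)) \<partial>(M \<Otimes>\<^sub>M lborel))" for n
      using high_occupation_points[OF \<epsilon>(1) m_pos m, of n] by (simp add: H_def indicator_def)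
    ultimately have "pot {0..} {-1..1} 0 \<le> 0"
      by (intro LIMSEQ_le_const[of _ 0]) auto
    with pot_pos[of 1] show False by simp
  qed
  then obtain C where C: "0 \<le> C" "\<forall>\<epsilon>. 0 < \<epsilon> \<and> \<epsilon> \<le> 1 \<longrightarrow> pot {0..} {-\<epsilon>..\<epsilon>} 0 \<le> ennreal (C * \<epsilon>)"
    by blast
  then show thesis by (intro that[of C]) auto
qed

text \<open>The interval bound removes centring and starting point for lengths up to 1/2, longer
  intervals are cut into pieces, and single points follow by shrinking. The added 1 only makes the
  constant positive.\<close>

lemma pot_density_bound:
  obtains C where "0 < C" "\<And>A y. A \<in> sets borel \<Longrightarrow> pot {0..} A y \<le> ennreal C * emeasure lborel A"
proof -
  obtain C where C: "0 \<le> C" "\<And>\<epsilon>. 0 < \<epsilon> \<Longrightarrow> \<epsilon> \<le> 1 \<Longrightarrow> pot {0..} {-\<epsilon>..\<epsilon>} 0 \<le> ennreal (C * \<epsilon>)"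
    using pot_small_interval by metis
  have short: "pot {0..} {x..x+l} y \<le> ennreal (4 * C * l)" if "0 < l" "l \<le> 1/2" for x y l
  proof -
    have "pot {0..} {x..x+l} y \<le> 2 * pot {0..} {-2*l..2*l} 0"
      by (rule pot_interval_le_horizon) (use that in auto)
    also have "\<dots> \<le> 2 * ennreal (C * (2 * l))"
      using C(2)[of "2*l"] that by (intro mult_left_mono) auto
    also have "\<dots> = ennreal (2 * (C * (2 * l)))"
      using C(1) that by (subst ennreal_mult) auto
    finally show ?thesis by (simp add: mult_ac)
  qed
  have pos: "pot {0..} {x..x+l} y \<le> ennreal (4 * C * l)" if "0 < l" for x y l
  proof -
    obtain n :: nat where n: "2 * l \<le> real n" using real_arch_simple by blast
    let ?l = "l / real (Suc n)"
    have l: "0 < ?l" "?l \<le> 1/2" "real (Suc n) * ?l = l" using n that by (auto simp: field_simps)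
    from pot_pieces[of "{0..}" ?l y, OF short[OF l(1,2)], of x n] l
    have "pot {0..} {x..x+l} y \<le> of_nat (Suc n) * ennreal (4 * C * ?l)" by simp
    also have "\<dots> = ennreal (real (Suc n) * (4 * C * ?l))"
      unfolding ennreal_of_nat_eq_real_of_nat
      using C(1) l(1) by (intro ennreal_mult[symmetric] mult_nonneg_nonneg) auto
    also have "real (Suc n) * (4 * C * ?l) = 4 * C * l" by (simp del: of_nat_Suc)
    finally show ?thesis .
  qed
  have closed: "emeasure (potm {0..} y) {a..b} \<le> ennreal (4 * C + 1) * ennreal (b - a)" if "a \<le> b" for a b y
  proof -
    have "pot {0..} {a..b} y \<le> ennreal (4 * C * (b - a))"
    proof (cases "a < b")
      case True
      with pos[of "b - a" a y] show ?thesis by simp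
    next
      case False
      with that have ab: "b = a" by simp
      have "pot {0..} {a..a} y \<le> 0"
      proof (rule ennreal_le_epsilon)
        fix e :: real assume e: "0 < e"
        define l where "l = e / (4 * C + 1)"
        have l: "0 < l" "4 * C * l \<le> e" using e C(1) by (auto simp: l_def field_simps)
        have "pot {0..} {a..a} y \<le> pot {0..} {a..a+l} y" using l by (intro pot_mono) auto
        also have "\<dots> \<le> ennreal e" using pos[OF l(1)] ennreal_leI[OF l(2)] by (rule order_trans)
        finally show "pot {0..} {a..a} y \<le> 0 + ennreal e" by simp
      qed
      then show ?thesis unfolding ab by simp
    qed
    also have "\<dots> \<le> ennreal ((4 * C + 1) * (b - a))"
      using that by (intro ennreal_leI mult_right_mono) auto
    also have "\<dots> = ennreal (4 * C + 1) * ennreal (b - a)"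
      using C(1) that by (intro ennreal_mult) auto
    finally show ?thesis by (simp add: emeasure_potm)
  qed
  show thesis
  proof (rule that[of "4 * C + 1"])
    show "pot {0..} A y \<le> ennreal (4 * C + 1) * emeasure lborel A" if "A \<in> sets borel" for A y
      using emeasure_le_lborel[OF sets_potm _ closed that, of y] C(1) that by (simp add: emeasure_potm)
  qed (use C in simp)
qed

end

section \<open>Lower bound on the potential density\<close>

lemma ennreal_term_le_suminf: "f j \<le> suminf f" for f :: "nat \<Rightarrow> ennreal"
  using sum_le_suminf[of f "{j}"] by simp

text \<open>The windows of length \<open>T\<close> started at integer times cover any given time at
  most \<open>T\<close> times.\<close>

lemma nn_integral_overlapping_segments:
  fixes \<phi> :: "real \<Rightarrow> ennreal"
  assumes [measurable]: "\<phi> \<in> borel_measurable borel"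
  shows "(\<Sum>n<N. \<integral>\<^sup>+t\<in>{0..<real T}. \<phi> (real n + t) \<partial>lborel) \<le> of_nat T * (\<integral>\<^sup>+t\<in>{0..}. \<phi> t \<partial>lborel)"
proof -
  define a where "a k = (\<integral>\<^sup>+s\<in>{0..<1}. \<phi> (real k + s) \<partial>lborel)" for k :: nat
  have seg: "(\<integral>\<^sup>+t\<in>{0..<real T}. \<phi> (real n + t) \<partial>lborel) = (\<Sum>j<T. a (n + j))" for n T
    using nn_integral_segments[of "\<lambda>t. \<phi> (real n + t)" 1 T] by (simp add: a_def add.assoc)
  have "(\<Sum>n<N. a (n + j)) \<le> (\<integral>\<^sup>+t\<in>{0..}. \<phi> t \<partial>lborel)" for j
  proof -
    have "(\<Sum>n<N. a (n + j)) = sum a ((\<lambda>n. n + j) ` {..<N})"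
      by (subst sum.reindex) (auto simp: inj_on_def)
    also have "\<dots> \<le> sum a {..<N + j}" by (rule sum_mono2) auto
    also have "\<dots> = (\<integral>\<^sup>+t\<in>{0..<real (N + j)}. \<phi> t \<partial>lborel)"
      using seg[where n = 0 and T = "N + j"] by simp
    also have "\<dots> \<le> (\<integral>\<^sup>+t\<in>{0..}. \<phi> t \<partial>lborel)"
      by (intro nn_integral_mono) (auto simp: indicator_def)
    finally show ?thesis .
  qed
  then have "(\<Sum>j<T. \<Sum>n<N. a (n + j)) \<le> (\<Sum>j<T. \<integral>\<^sup>+t\<in>{0..}. \<phi> t \<partial>lborel)"
    by (intro sum_mono)
  then show ?thesis
    unfolding seg by (subst sum.swap) simp
qed

text \<open>Steinhaus: a set of positive measure fills most of some interval, so it overlaps its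
  reflections at all nearby points.\<close>

lemma steinhaus:
  fixes D :: "real set"
  assumes D: "D \<in> sets borel" "D \<subseteq> {-k..k}" "0 < k" and pos: "0 < emeasure lborel D"
  obtains a b \<rho> where "a < b" "0 < \<rho>" "\<And>z. z \<in> {a..b} \<Longrightarrow> ennreal \<rho> \<le> emeasure lborel {y \<in> D. z - y \<in> D}"
proof -
  have "emeasure lborel D < \<infinity>"
    using emeasure_mono[OF D(2), of lborel] D(3) by (auto simp: less_top intro: le_less_trans)
  then obtain \<delta> where \<delta>: "emeasure lborel D = ennreal \<delta>" "0 < \<delta>"
    using pos by (cases "emeasure lborel D") auto
  obtain \<D> where \<D>: "countable \<D>" "\<And>K. K \<in> \<D> \<Longrightarrow> \<exists>c d. c < d \<and> K = {c<..<d}" "disjoint \<D>"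
    "countable (D - \<Union>\<D>)" "emeasure lborel (\<Union>\<D>) \<le> emeasure lborel D + ennreal (\<delta> / 8)"
    using interval_cover[OF D, of "\<delta> / 8"] \<delta>(2) by (metis divide_pos_pos zero_less_numeral)
  have \<D>m: "K \<in> sets borel" if "K \<in> \<D>" for K using \<D>(2)[OF that] by auto
  have U: "\<Union>\<D> \<in> sets borel" using \<D>m \<D>(1) by (intro sets.countable_Union) auto
  \<comment> \<open>The cover exceeds \<open>D\<close> by at most an eighth, and 4/5 times 9/8 is
    still below 1; so the density of \<open>D\<close> cannot be 4/5 or less in every covering
    interval.\<close>
  have "\<exists>K\<in>\<D>. ennreal (4/5) * emeasure lborel K < emeasure lborel (D \<inter> K)"
  proof (rule ccontr)
    assume "\<not> ?thesis"
    then have le: "emeasure lborel (D \<inter> K) \<le> ennreal (4/5) * emeasure lborel K" if "K \<in> \<D>" for K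
      using that by (auto simp: not_less)
    have "emeasure lborel D \<le> emeasure lborel ((D \<inter> \<Union>\<D>) \<union> (D - \<Union>\<D>))"
      using D(1) U by (intro emeasure_mono) auto
    also have "\<dots> \<le> emeasure lborel (D \<inter> \<Union>\<D>) + emeasure lborel (D - \<Union>\<D>)"
      using D(1) U by (intro emeasure_subadditive) auto
    also have "emeasure lborel (D - \<Union>\<D>) = 0"
      using countable_imp_null_set_lborel[OF \<D>(4)] by auto
    also have "D \<inter> \<Union>\<D> = (\<Union>K\<in>\<D>. D \<inter> K)" by auto
    also have "emeasure lborel (\<Union>K\<in>\<D>. D \<inter> K) = (\<integral>\<^sup>+K. emeasure lborel (D \<inter> K) \<partial>count_space \<D>)"
      using \<D>(1,3) \<D>m D(1) by (intro emeasure_UN_countable) (auto simp: disjoint_def disjoint_family_on_def)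
    also have "\<dots> \<le> (\<integral>\<^sup>+K. ennreal (4/5) * emeasure lborel K \<partial>count_space \<D>)"
      using le by (intro nn_integral_mono) auto
    also have "\<dots> = ennreal (4/5) * (\<integral>\<^sup>+K. emeasure lborel K \<partial>count_space \<D>)"
      by (rule nn_integral_cmult) simp
    also have "(\<integral>\<^sup>+K. emeasure lborel K \<partial>count_space \<D>) = emeasure lborel (\<Union>\<D>)"
      using emeasure_UN_countable[of \<D> "\<lambda>K. K" lborel] \<D>(1,3) \<D>m by (simp add: disjoint_def disjoint_family_on_def)
    also have "ennreal (4/5) * emeasure lborel (\<Union>\<D>) \<le> ennreal (4/5) * (ennreal \<delta> + ennreal (\<delta> / 8))"
      using \<D>(5) unfolding \<delta> by (intro mult_left_mono) auto
    also have "\<dots> = ennreal (4/5 * (\<delta> + \<delta> / 8))"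
      using \<delta>(2) by (simp only: ennreal_plus[symmetric] less_imp_le) (subst ennreal_mult[symmetric], auto)
    finally have "ennreal \<delta> \<le> ennreal (4/5 * (\<delta> + \<delta> / 8))" using \<delta> by simp
    then have "\<delta> \<le> 4/5 * (\<delta> + \<delta> / 8)" using \<delta>(2) by (subst (asm) ennreal_le_iff) auto
    with \<delta>(2) show False by simp
  qed
  then obtain c d where cd: "c < d" and big: "ennreal (4/5) * emeasure lborel {c<..<d} < emeasure lborel (D \<inter> {c<..<d})"
    using \<D>(2) by blast
  define l where "l = d - c"
  have l: "0 < l" using cd by (simp add: l_def)
  define E where "E = D \<inter> {c<..<d}"
  have E [measurable]: "E \<in> sets borel" using D(1) by (simp add: E_def)
  have Efin: "emeasure lborel E < \<infinity>"
    using emeasure_mono[of E "{c<..<d}" lborel] cd by (auto simp: less_top E_def intro: le_less_trans)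
  then obtain \<eta> where \<eta>: "emeasure lborel E = ennreal \<eta>" "0 \<le> \<eta>" by (cases "emeasure lborel E") auto
  have \<eta>_gt: "4/5 * l < \<eta>"
  proof -
    have "ennreal (4/5) * ennreal l < ennreal \<eta>"
      using big cd \<eta> unfolding E_def l_def by simp
    then show ?thesis using l by (subst (asm) ennreal_mult[symmetric]) (auto simp: ennreal_less_iff)
  qed
  show thesis
  \<comment> \<open>Reflection by \<open>z\<close> moves the interval by at most
    \<open>l / 10\<close>, so \<open>E\<close> and its reflection lie in a common interval of length
    \<open>6/5 * l\<close>. Their lengths add up to more than \<open>8/5 * l\<close>, which leaves
    an overlap of \<open>2/5 * l\<close>.\<close>
  proof (rule that[of "c + d - l / 10" "c + d + l / 10" "2/5 * l"])
    fix z assume z: "z \<in> {c + d - l / 10..c + d + l / 10}"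
    let ?R = "(\<lambda>y. z - y) -` E"
    have R [measurable]: "?R \<in> sets borel"
      using measurable_sets[of "\<lambda>y. z - y" borel borel E] by simp
    have Rm: "emeasure lborel ?R = ennreal \<eta>"
    proof -
      have "emeasure lborel ?R = (\<integral>\<^sup>+y. indicator ?R y \<partial>lborel)" by simp
      also have "\<dots> = (\<integral>\<^sup>+y. indicator E (z + (-1) * y) \<partial>lborel)"
        by (intro nn_integral_cong) (simp add: indicator_def)
      also have "\<dots> = (\<integral>\<^sup>+y. indicator E y \<partial>lborel)"
        using nn_integral_real_affine[of "indicator E" "-1" z] by simp
      finally show ?thesis using \<eta> by simp
    qed
    have "E \<union> ?R \<subseteq> {c - l / 10..d + l / 10}"
      using z l by (auto simp: E_def l_def)
    then have "emeasure lborel (E \<union> ?R) \<le> emeasure lborel {c - l / 10..d + l / 10}"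
      by (intro emeasure_mono) auto
    also have "\<dots> = ennreal (6/5 * l)" using l by (simp add: l_def field_simps)
    finally have un: "emeasure lborel (E \<union> ?R) \<le> ennreal (6/5 * l)" .
    have "emeasure lborel (E \<inter> ?R) \<le> emeasure lborel E" by (intro emeasure_mono) auto
    then obtain i where i: "emeasure lborel (E \<inter> ?R) = ennreal i" "0 \<le> i"
      using \<eta> by (cases "emeasure lborel (E \<inter> ?R)") (auto simp: top_unique)
    have "ennreal \<eta> + ennreal \<eta> = emeasure lborel (E \<union> ?R) + emeasure lborel (E \<inter> ?R)"
      using emeasure_Un_Int[of E lborel ?R] Rm \<eta> by simp
    also have "\<dots> \<le> ennreal (6/5 * l) + ennreal i" using un i by (intro add_mono) auto
    finally have "ennreal (\<eta> + \<eta>) \<le> ennreal (6/5 * l + i)" using \<eta>(2) i(2) l by (subst (1 2) ennreal_plus) auto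
    then have "\<eta> + \<eta> \<le> 6/5 * l + i" using i l by (subst (asm) ennreal_le_iff) auto
    then have "2/5 * l \<le> i" using \<eta>_gt by simp
    then have "ennreal (2/5 * l) \<le> emeasure lborel (E \<inter> ?R)" unfolding i by (rule ennreal_leI)
    also have "\<dots> \<le> emeasure lborel {y \<in> D. z - y \<in> D}"
    proof (rule emeasure_mono)
      have "{y \<in> D. z - y \<in> D} = D \<inter> ((\<lambda>y. z - y) -` D)" by auto
      also have "\<dots> \<in> sets lborel" using measurable_sets[of "\<lambda>y. z - y" borel borel D] D(1) by simp
      finally show "{y \<in> D. z - y \<in> D} \<in> sets lborel" .
    qed (auto simp: E_def)
    finally show "ennreal (2/5 * l) \<le> emeasure lborel {y \<in> D. z - y \<in> D}" .
  qed (use l in auto)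
qed

context local_time_levy
begin

section \<open>Lower bounds of paths and the convergent case\<close>

text \<open>Divergence at infinity alone would not do, since a merely right-continuous path may be
  unbounded below on a bounded time interval. Instead \<open>ottaviani\<close> is applied from time
  0 on: the diverging walk has a finite minimum, so its chance of passing below
  \<open>- real m\<close> tends to 0, and the path inherits this.\<close>

lemma paths_bounded_below: "AE \<omega> in M. \<exists>k::nat. \<forall>t\<ge>0. - real k \<le> Y t \<omega>"
proof -
  obtain c where c: "c > 0" "\<And>s. s \<in> {0..1} \<Longrightarrow> 1/4 \<le> p s {-c..c} 0"
    using tight_unit_interval by blast
  let ?T = "\<lambda>m::nat. {\<omega> \<in> space M. \<exists>t\<ge>0. Y t \<omega> < - real m - c}"
  let ?H = "\<lambda>m::nat. {\<omega> \<in> space M. \<exists>k. Y (real k) \<omega> < - real m}"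
  have [measurable]: "?T m \<in> sets M" for m using ottaviani(1)[OF c(2), of 0 "- real m"] by simp
  have "AE \<omega> in M. \<omega> \<notin> (\<Inter>m. ?H m)"
    using walk_tendsto_at_top[OF integrable_Y1 mean_pos]
  proof eventually_elim
    fix \<omega> assume "filterlim (\<lambda>n. Y (real n) \<omega>) at_top sequentially"
    then obtain n where n: "\<And>k. n \<le> k \<Longrightarrow> 0 \<le> Y (real k) \<omega>"
      unfolding filterlim_at_top eventually_sequentially by meson
    define b where "b = Min ((\<lambda>k. Y (real k) \<omega>) ` {..n})"
    obtain m :: nat where m: "- b \<le> real m" using real_arch_simple by blast
    have "- real m \<le> Y (real k) \<omega>" for k
    proof (cases "k \<le> n")
      case True
      then have "b \<le> Y (real k) \<omega>" unfolding b_def by (intro Min_le) auto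
      with m show ?thesis by simp
    next
      case False
      with n[of k] show ?thesis by simp
    qed
    then show "\<omega> \<notin> (\<Inter>m. ?H m)" by (auto simp: not_less intro!: exI[of _ m])
  qed
  moreover have "(\<Inter>m. ?H m) \<in> sets M" by (intro sets.countable_INT) auto
  ultimately have "emeasure M (\<Inter>m. ?H m) = 0"
    using AE_iff_null_sets by blast
  moreover have "(\<lambda>m. emeasure M (?H m)) \<longlonglongrightarrow> emeasure M (\<Inter>m. ?H m)"
  proof (rule Lim_emeasure_decseq)
    have "?H n \<subseteq> ?H m" if "m \<le> n" for m n
    proof safe
      fix \<omega> k assume "Y (real k) \<omega> < - real n"
      moreover have "real m \<le> real n" using that by simp
      ultimately show "\<exists>k. Y (real k) \<omega> < - real m" by (intro exI[of _ k]) linarith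
    qed
    then show "decseq ?H" unfolding decseq_def by blast
  qed auto
  ultimately have lim: "(\<lambda>m. emeasure M (?H m)) \<longlonglongrightarrow> 0" by simp
  have "1/4 * emeasure M (\<Inter>m. ?T m) \<le> 0"
  proof (rule LIMSEQ_le_const[OF lim], intro exI[of _ 0] allI impI)
    fix m
    have "1/4 * emeasure M (\<Inter>m. ?T m) \<le> 1/4 * emeasure M (?T m)"
      by (intro mult_left_mono emeasure_mono) auto
    also have "\<dots> \<le> emeasure M (?H m)" using ottaviani(2)[OF c(2), of 0 "- real m"] by simp
    finally show "1/4 * emeasure M (\<Inter>m. ?T m) \<le> emeasure M (?H m)" .
  qed
  then have "emeasure M (\<Inter>m. ?T m) = 0"
    by (auto simp: ennreal_quarter)
  then have "(\<Inter>m. ?T m) \<in> null_sets M" by (auto intro!: sets.countable_INT)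
  from AE_not_in[OF this] AE_space show ?thesis
  proof eventually_elim
    fix \<omega> assume "\<omega> \<notin> (\<Inter>m. ?T m)" "\<omega> \<in> space M"
    then obtain m where m: "\<And>t. 0 \<le> t \<Longrightarrow> - real m - c \<le> Y t \<omega>" by (auto simp: not_less)
    obtain k :: nat where "real m + c \<le> real k" using real_arch_simple by blast
    with m show "\<exists>k::nat. \<forall>t\<ge>0. - real k \<le> Y t \<omega>" by (intro exI[of _ k]) force
  qed
qed

text \<open>Finite expectations are available only after truncation to \<open>{- real k..}\<close>,
  where \<open>g\<close> is integrable. The lower bound of the path is random, so all
  \<open>k\<close> are treated on one almost sure event and the right one is chosen path by
  path.\<close>

lemma integral_finite:
  assumes [measurable]: "g \<in> borel_measurable borel"
    and fin: "\<And>k::nat. (\<integral>\<^sup>+x\<in>{- real k..}. g x \<partial>lborel) < \<infinity>"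
  shows "AE \<omega> in M. (\<integral>\<^sup>+t\<in>{0..}. g (Y t \<omega>) \<partial>lborel) < \<infinity>"
proof -
  obtain C where C: "0 < C" "\<And>A y. A \<in> sets borel \<Longrightarrow> pot {0..} A y \<le> ennreal C * emeasure lborel A"
    using pot_density_bound by metis
  have le: "potm {0..} 0 \<le> density lborel (\<lambda>_. ennreal C)"
    using C by (subst le_measure) (auto simp: emeasure_potm emeasure_density nn_integral_cmult)
  have "AE \<omega> in M. (\<integral>\<^sup>+t\<in>{0..}. g (0 + Y t \<omega>) * indicator {- real k..} (0 + Y t \<omega>) \<partial>lborel) \<noteq> \<infinity>" for k :: nat
  proof (rule nn_integral_PInf_AE)
    have "(\<integral>\<^sup>+\<omega>. (\<integral>\<^sup>+t\<in>{0..}. g (0 + Y t \<omega>) * indicator {- real k..} (0 + Y t \<omega>) \<partial>lborel) \<partial>M)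
        = (\<integral>\<^sup>+x\<in>{- real k..}. g x \<partial>potm {0..} 0)"
      by (rule nn_integral_potm(2)[symmetric]) measurable
    also have "\<dots> \<le> (\<integral>\<^sup>+x\<in>{- real k..}. g x \<partial>density lborel (\<lambda>_. ennreal C))"
      by (rule nn_integral_mono_measure[OF _ le]) simp
    also have "\<dots> = ennreal C * (\<integral>\<^sup>+x\<in>{- real k..}. g x \<partial>lborel)"
      by (subst nn_integral_density) (auto simp: nn_integral_cmult)
    also have "\<dots> < \<infinity>" using fin[of k] by (simp add: ennreal_mult_less_top)
    finally show "(\<integral>\<^sup>+\<omega>. (\<integral>\<^sup>+t\<in>{0..}. g (0 + Y t \<omega>) * indicator {- real k..} (0 + Y t \<omega>) \<partial>lborel) \<partial>M) \<noteq> \<infinity>"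
      by simp
  qed measurable
  then have "AE \<omega> in M. \<forall>k::nat. (\<integral>\<^sup>+t\<in>{0..}. g (0 + Y t \<omega>) * indicator {- real k..} (0 + Y t \<omega>) \<partial>lborel) \<noteq> \<infinity>"
    by (subst AE_all_countable) auto
  with paths_bounded_below show ?thesis
  proof eventually_elim
    fix \<omega> assume "\<exists>k::nat. \<forall>t\<ge>0. - real k \<le> Y t \<omega>"
      and fin: "\<forall>k::nat. (\<integral>\<^sup>+t\<in>{0..}. g (0 + Y t \<omega>) * indicator {- real k..} (0 + Y t \<omega>) \<partial>lborel) \<noteq> \<infinity>"
    then obtain k :: nat where k: "\<And>t. 0 \<le> t \<Longrightarrow> - real k \<le> Y t \<omega>" by blast
    then have "(\<integral>\<^sup>+t\<in>{0..}. g (Y t \<omega>) \<partial>lborel) = (\<integral>\<^sup>+t\<in>{0..}. g (0 + Y t \<omega>) * indicator {- real k..} (0 + Y t \<omega>) \<partial>lborel)"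
      by (intro nn_integral_cong) (auto simp: indicator_def)
    with fin show "(\<integral>\<^sup>+t\<in>{0..}. g (Y t \<omega>) \<partial>lborel) < \<infinity>" by (simp add: less_top)
  qed
qed

section \<open>Visits of the integer skeleton to intervals\<close>

definition renewal :: "real set \<Rightarrow> ennreal" where
  "renewal A = (\<Sum>n. p (real n) A 0)"

text \<open>Each integer-time visit is spread over the following unit of time: the path stays within
  \<open>c\<close> at each such time with probability at least 1/4, and the bounded density of the
  potential does the rest. The constant absorbs \<open>2 * c\<close> so that the bound has the form
  used for jumps.\<close>

lemma renewal_le:
  obtains C where "0 < C" "\<And>a b. a \<le> b \<Longrightarrow> renewal {a..b} \<le> ennreal (C * (b - a + 1))"
proof -
  obtain C where C: "0 < C" "\<And>A y. A \<in> sets borel \<Longrightarrow> pot {0..} A y \<le> ennreal C * emeasure lborel A"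
    using pot_density_bound by metis
  obtain c where c: "c > 0" "\<And>s. s \<in> {0..1} \<Longrightarrow> 1/4 \<le> p s {-c..c} 0"
    using tight_unit_interval by blast
  show thesis
  proof (rule that[of "4 * C * (2 * c + 1)"])
    fix a b :: real assume ab: "a \<le> b"
    have "(\<Sum>k<N. p (real k) {a..b} 0) \<le> ennreal (4 * C * (b - a + 2 * c))" for N
    proof -
      let ?S = "\<Sum>k<N. p (real k) {a..b} 0"
      have "1/4 * (ennreal 1 * (\<Sum>k<N. p (real k * 1) {a..b} 0)) \<le> pot {0..<real N * 1} {a-c..b+c} 0"
        by (rule skeleton_le_pot) (use c in auto)
      then have "1/4 * ?S \<le> pot {0..<real N} {a-c..b+c} 0"
        by (simp only: mult_1_right ennreal_1 mult_1)
      also have "\<dots> \<le> pot {0..} {a-c..b+c} 0" by (rule pot_mono_time) auto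
      also have "\<dots> \<le> ennreal C * emeasure lborel {a-c..b+c}" by (rule C) simp
      also have "\<dots> = ennreal (C * (b - a + 2 * c))"
      proof -
        have "emeasure lborel {a-c..b+c} = ennreal (b - a + 2 * c)"
          using c(1) ab by (simp add: algebra_simps)
        then show ?thesis using C(1) c(1) ab by (simp only: ennreal_mult[of C "b - a + 2 * c"])
      qed
      finally have "4 * (1/4 * ?S) \<le> 4 * ennreal (C * (b - a + 2 * c))" by (rule mult_left_mono) simp
      moreover have "4 * (1/4 * ?S) = ?S"
        unfolding ennreal_quarter mult.assoc[symmetric]
        by (subst ennreal_numeral[symmetric], subst ennreal_mult[symmetric]) auto
      moreover have "4 * ennreal (C * (b - a + 2 * c)) = ennreal (4 * C * (b - a + 2 * c))"
        using C(1) c(1) ab by (subst ennreal_numeral[symmetric], subst ennreal_mult[symmetric]) (auto simp: mult.assoc)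
      ultimately show ?thesis by simp
    qed
    then have "renewal {a..b} \<le> ennreal (4 * C * (b - a + 2 * c))"
      unfolding renewal_def by (intro suminf_le_const) auto
    also have "\<dots> \<le> ennreal (4 * C * (2 * c + 1) * (b - a + 1))"
    proof (rule ennreal_leI)
      have "0 \<le> 2 * c * (b - a)" using c ab by simp
      then have "b - a + 2 * c \<le> (2 * c + 1) * (b - a + 1)" by (simp add: algebra_simps)
      then have "4 * C * (b - a + 2 * c) \<le> 4 * C * ((2 * c + 1) * (b - a + 1))"
        using C(1) by (intro mult_left_mono) auto
      then show "4 * C * (b - a + 2 * c) \<le> 4 * C * (2 * c + 1) * (b - a + 1)" by (simp only: mult.assoc)
    qed
    finally show "renewal {a..b} \<le> ennreal (4 * C * (2 * c + 1) * (b - a + 1))" .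
  qed (use C c in simp)
qed

text \<open>The walk passes every level \<open>x\<close>, and the expected number of jumps across \<open>[x, x + L]\<close> is
  small for large \<open>L\<close> because the steps are integrable.\<close>

lemma renewal_ge:
  obtains L :: real where "0 < L" "\<And>x. 0 \<le> x \<Longrightarrow> 1/2 \<le> renewal {x..x+L}"
proof -
  obtain C where C: "0 < C" "\<And>a b. a \<le> b \<Longrightarrow> renewal {a..b} \<le> ennreal (C * (b - a + 1))"
    using renewal_le by metis
  have "(\<lambda>n. \<integral>\<omega>. indicat_real {real n<..} (Y 1 \<omega>) * Y 1 \<omega> \<partial>M) \<longlonglongrightarrow> (\<integral>\<omega>. 0 \<partial>M)"
  proof (rule integral_dominated_convergence[where w = "\<lambda>\<omega>. norm (Y 1 \<omega>)"])
    show "AE \<omega> in M. (\<lambda>n. indicat_real {real n<..} (Y 1 \<omega>) * Y 1 \<omega>) \<longlonglongrightarrow> 0"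
    proof (rule AE_I2)
      fix \<omega>
      obtain m :: nat where "Y 1 \<omega> \<le> real m" using real_arch_simple by blast
      then have "\<forall>\<^sub>F n in sequentially. 0 = indicat_real {real n<..} (Y 1 \<omega>) * Y 1 \<omega>"
        unfolding eventually_sequentially by (intro exI[of _ m]) auto
      then show "(\<lambda>n. indicat_real {real n<..} (Y 1 \<omega>) * Y 1 \<omega>) \<longlonglongrightarrow> 0"
        by (rule Lim_transform_eventually[OF tendsto_const])
    qed
  qed (use integrable_Y1 in \<open>auto simp: indicator_def\<close>)
  then have "(\<lambda>n. C * (\<integral>\<omega>. indicat_real {real n<..} (Y 1 \<omega>) * Y 1 \<omega> \<partial>M)) \<longlonglongrightarrow> C * 0"
    by (intro tendsto_mult tendsto_const) simp
  then have "\<forall>\<^sub>F n in sequentially. C * (\<integral>\<omega>. indicat_real {real n<..} (Y 1 \<omega>) * Y 1 \<omega> \<partial>M) < 1/2"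
    by (intro order_tendstoD(2)[where a = "1/2"]) auto
  then have "\<forall>\<^sub>F n in sequentially. C * (\<integral>\<omega>. indicat_real {real n<..} (Y 1 \<omega>) * Y 1 \<omega> \<partial>M) < 1/2 \<and> 1 \<le> n"
    by (rule eventually_conj[OF _ eventually_ge_at_top])
  then obtain n where n: "C * (\<integral>\<omega>. indicat_real {real n<..} (Y 1 \<omega>) * Y 1 \<omega> \<partial>M) < 1/2" "1 \<le> n"
    by (auto simp: eventually_sequentially)
  define L where "L = real n"
  have L: "1 \<le> L" using n by (simp add: L_def)
  have nn: "0 \<le> indicat_real {L<..} (Y 1 \<omega>) * Y 1 \<omega>" for \<omega> using L by (auto simp: indicator_def)
  have tail: "(\<integral>\<^sup>+\<omega>. ennreal (C * (indicat_real {L<..} (Y 1 \<omega>) * Y 1 \<omega>)) \<partial>M) \<le> 1/2"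
  proof -
    have "integrable M (\<lambda>\<omega>. indicat_real {L<..} (Y 1 \<omega>) * Y 1 \<omega>)"
      by (rule Bochner_Integration.integrable_bound[OF integrable_Y1]) (auto simp: indicator_def)
    then have "(\<integral>\<^sup>+\<omega>. ennreal (C * (indicat_real {L<..} (Y 1 \<omega>) * Y 1 \<omega>)) \<partial>M) = ennreal (\<integral>\<omega>. C * (indicat_real {L<..} (Y 1 \<omega>) * Y 1 \<omega>) \<partial>M)"
      using nn C(1) by (intro nn_integral_eq_integral) auto
    also have "\<dots> \<le> ennreal (1/2)" using n(1) by (intro ennreal_leI) (simp add: L_def)
    finally show ?thesis unfolding ennreal_half .
  qed
  show thesis
  proof (rule that[of L])
    fix x :: real assume x: "0 \<le> x"
    let ?G = "\<lambda>k \<omega>'. \<integral>\<^sup>+\<omega>. indicator {..x} (Y (real k) \<omega>) * indicator {x+L<..} (Y (real k) \<omega> + Y 1 \<omega>') \<partial>M"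
    have "AE \<omega> in M. 1 \<le> (\<Sum>k. indicator {x..x+L} (0 + Y (real k) \<omega>)) + (\<Sum>k. indicator {..x} (Y (real k) \<omega>) * indicator {x+L<..} (Y (real k) \<omega> + (Y (real k + 1) \<omega> - Y (real k) \<omega>)) :: ennreal)"
      using walk_tendsto_at_top[OF integrable_Y1 mean_pos]
    proof eventually_elim
      fix \<omega> assume "filterlim (\<lambda>n. Y (real n) \<omega>) at_top sequentially"
      then obtain k0 where "x + 1 \<le> Y (real k0) \<omega>"
        unfolding filterlim_at_top eventually_sequentially by (meson order_refl)
      then have ex: "\<exists>k. x < Y (real k) \<omega>" by (intro exI[of _ k0]) simp
      \<comment> \<open>The first index beyond the level; it is not 0 because the walk starts at 0
        and \<open>x\<close> is nonnegative. This step either lands in \<open>{x..x+L}\<close> or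
        jumps over it from below.\<close>
      define k where "k = (LEAST k. x < Y (real k) \<omega>)"
      have k: "x < Y (real k) \<omega>" unfolding k_def using ex by (rule LeastI_ex)
      have "k \<noteq> 0" using k x zero[of 0] by (intro notI) simp
      then obtain j where j: "k = Suc j" by (cases k) auto
      have jx: "Y (real j) \<omega> \<le> x"
        using not_less_Least[of j "\<lambda>k. x < Y (real k) \<omega>"] j unfolding k_def by (simp add: not_less)
      have jk: "real j + 1 = real k" by (simp add: j)
      let ?a = "\<lambda>k. indicator {x..x+L} (0 + Y (real k) \<omega>) :: ennreal"
      let ?b = "\<lambda>k. indicator {..x} (Y (real k) \<omega>) * indicator {x+L<..} (Y (real k) \<omega> + (Y (real k + 1) \<omega> - Y (real k) \<omega>)) :: ennreal"
      show "1 \<le> (\<Sum>k. ?a k) + (\<Sum>k. ?b k)"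
      proof (cases "Y (real k) \<omega> \<le> x + L")
        case True
        then have "1 = ?a k" using k by simp
        also have "\<dots> \<le> (\<Sum>k. ?a k)" by (rule ennreal_term_le_suminf)
        finally show ?thesis by (simp add: add_increasing2)
      next
        case False
        then have "1 = ?b j" using jx by (simp add: jk)
        also have "\<dots> \<le> (\<Sum>k. ?b k)" by (rule ennreal_term_le_suminf)
        finally show ?thesis by (simp add: add_increasing)
      qed
    qed
    then have "(\<integral>\<^sup>+\<omega>. 1 \<partial>M) \<le> (\<integral>\<^sup>+\<omega>. (\<Sum>k. indicator {x..x+L} (0 + Y (real k) \<omega>)) + (\<Sum>k. indicator {..x} (Y (real k) \<omega>) * indicator {x+L<..} (Y (real k) \<omega> + (Y (real k + 1) \<omega> - Y (real k) \<omega>))) \<partial>M)"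
      by (rule nn_integral_mono_AE)
    also have "\<dots> = (\<Sum>k. \<integral>\<^sup>+\<omega>. indicator {x..x+L} (0 + Y (real k) \<omega>) \<partial>M) + (\<Sum>k. \<integral>\<^sup>+\<omega>. indicator {..x} (Y (real k) \<omega>) * indicator {x+L<..} (Y (real k) \<omega> + (Y (real k + 1) \<omega> - Y (real k) \<omega>)) \<partial>M)"
      by (subst nn_integral_add) (simp_all add: nn_integral_suminf)
    also have "(\<Sum>k. \<integral>\<^sup>+\<omega>. indicator {x..x+L} (0 + Y (real k) \<omega>) \<partial>M) = renewal {x..x+L}"
      unfolding renewal_def by (subst p_nn_integral) auto
    finally have main: "(\<integral>\<^sup>+\<omega>. 1 \<partial>M) \<le> renewal {x..x+L} + (\<Sum>k. \<integral>\<^sup>+\<omega>. indicator {..x} (Y (real k) \<omega>) * indicator {x+L<..} (Y (real k) \<omega> + (Y (real k + 1) \<omega> - Y (real k) \<omega>)) \<partial>M)" .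
    have "(\<integral>\<^sup>+\<omega>. indicator {..x} (Y (real k) \<omega>) * indicator {x+L<..} (Y (real k) \<omega> + (Y (real k + 1) \<omega> - Y (real k) \<omega>)) \<partial>M)
       = (\<integral>\<^sup>+\<omega>'. ?G k \<omega>' \<partial>M)" for k
    proof -
      have Yk [measurable]: "Y (real k) \<in> borel_measurable (F (real k))" by (rule rv_F) simp
      have "(\<integral>\<^sup>+\<omega>. indicator {..x} (Y (real k) \<omega>) * indicator {x+L<..} (Y (real k) \<omega> + (Y (real k + 1) \<omega> - Y (real k) \<omega>)) \<partial>M)
        = (\<integral>\<^sup>+\<omega>. (\<integral>\<^sup>+\<omega>'. indicator {..x} (Y (real k) \<omega>) * indicator {x+L<..} (Y (real k) \<omega> + Y 1 \<omega>') \<partial>M) \<partial>M)"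
        using markov[of "real k" 1 "\<lambda>(\<omega>, z). indicator {..x} (Y (real k) \<omega>) * indicator {x+L<..} (Y (real k) \<omega> + z)"] by simp
      also have "\<dots> = (\<integral>\<^sup>+\<omega>'. ?G k \<omega>' \<partial>M)"
      proof -
        interpret MM: pair_sigma_finite M M ..
        show ?thesis by (rule MM.Fubini'[symmetric]) measurable
      qed
      finally show ?thesis .
    qed
    then have "(\<Sum>k. \<integral>\<^sup>+\<omega>. indicator {..x} (Y (real k) \<omega>) * indicator {x+L<..} (Y (real k) \<omega> + (Y (real k + 1) \<omega> - Y (real k) \<omega>)) \<partial>M) = (\<Sum>k. \<integral>\<^sup>+\<omega>'. ?G k \<omega>' \<partial>M)"
      by simp
    also have "(\<Sum>k. \<integral>\<^sup>+\<omega>'. ?G k \<omega>' \<partial>M) = (\<integral>\<^sup>+\<omega>'. (\<Sum>k. ?G k \<omega>') \<partial>M)"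
      by (rule nn_integral_suminf[symmetric]) measurable
    also have "\<dots> \<le> (\<integral>\<^sup>+\<omega>. ennreal (C * (indicat_real {L<..} (Y 1 \<omega>) * Y 1 \<omega>)) \<partial>M)"
    proof (rule nn_integral_mono)
      fix \<omega>'
      show "(\<Sum>k. ?G k \<omega>') \<le> ennreal (C * (indicat_real {L<..} (Y 1 \<omega>') * Y 1 \<omega>'))"
      proof (cases "L < Y 1 \<omega>'")
        case True
        \<comment> \<open>A jump of size \<open>Y 1 \<omega>'\<close> over the interval must start
          within \<open>Y 1 \<omega>' - L\<close> below \<open>x\<close>. The additive 1 in the
          renewal bound is absorbed by \<open>L\<close>, which is why \<open>L \<ge> 1\<close> was
          arranged.\<close>
        have "(\<Sum>k. ?G k \<omega>') \<le> renewal {x + L - Y 1 \<omega>'..x}"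
          unfolding renewal_def
          by (intro suminf_le, subst p_nn_integral) (auto intro!: nn_integral_mono simp: indicator_def)
        also have "\<dots> \<le> ennreal (C * (x - (x + L - Y 1 \<omega>') + 1))" using True by (intro C) simp
        also have "\<dots> \<le> ennreal (C * Y 1 \<omega>')" using L C(1) by (intro ennreal_leI mult_left_mono) auto
        finally show ?thesis using True by simp
      next
        case False
        then have "?G k \<omega>' = 0" for k
          by (subst nn_integral_0_iff_AE) (auto simp: indicator_def)
        then show ?thesis by simp
      qed
    qed
    also note tail
    finally have "renewal {x..x+L} + (\<Sum>k. \<integral>\<^sup>+\<omega>. indicator {..x} (Y (real k) \<omega>) * indicator {x+L<..} (Y (real k) \<omega> + (Y (real k + 1) \<omega> - Y (real k) \<omega>)) \<partial>M) \<le> renewal {x..x+L} + 1/2"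
      by (rule add_left_mono)
    with main have le: "1 \<le> renewal {x..x+L} + 1/2"
      by (simp only: nn_integral_const emeasure_space_1 mult_1_right)
    show "1/2 \<le> renewal {x..x+L}"
    proof (cases "renewal {x..x+L}")
      case (real r)
      with le have "ennreal 1 \<le> ennreal (r + 1/2)" by (simp add: ennreal_half ennreal_plus)
      then have "1/2 \<le> r" using real by (subst (asm) ennreal_le_iff) auto
      then show ?thesis unfolding real ennreal_half by (intro ennreal_leI)
    qed simp
  qed (use L in simp)
qed

section \<open>Spreading out the potential by convolution\<close>

text \<open>Stated for the potential over a bounded time, not for the law of one \<open>Y t\<close>,
  because only the potential is known to have a density. The horizon is a natural number since
  windows of this length will be attached to the integer skeleton.\<close>

definition minorized :: "nat \<Rightarrow> real \<Rightarrow> real set \<Rightarrow> bool" where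
  "minorized T \<eta> D \<longleftrightarrow> 0 < T \<and> 0 < \<eta> \<and> D \<in> sets borel \<and>
     (\<forall>A\<in>sets borel. ennreal \<eta> * emeasure lborel (A \<inter> D) \<le> pot {0..<real T} A 0)"

lemma minorized_nn_integral:
  assumes min: "minorized T \<eta> D" and [measurable]: "g \<in> borel_measurable borel"
  shows "ennreal \<eta> * (\<integral>\<^sup>+x\<in>D. g x \<partial>lborel) \<le> (\<integral>\<^sup>+x. g x \<partial>potm {0..<real T} 0)"
proof -
  have D [measurable]: "D \<in> sets borel" using min by (simp add: minorized_def)
  have "density lborel (\<lambda>x. ennreal \<eta> * indicator D x) \<le> potm {0..<real T} 0"
  proof (subst le_measure, simp, intro ballI)
    fix A assume "A \<in> sets (density lborel (\<lambda>x. ennreal \<eta> * indicator D x))"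
    then have [measurable]: "A \<in> sets borel" by simp
    have "emeasure (density lborel (\<lambda>x. ennreal \<eta> * indicator D x)) A = (\<integral>\<^sup>+x. ennreal \<eta> * indicator (A \<inter> D) x \<partial>lborel)"
      by (subst emeasure_density) (auto intro!: nn_integral_cong simp: indicator_def)
    also have "\<dots> = ennreal \<eta> * emeasure lborel (A \<inter> D)"
      by (rule nn_integral_cmult_indicator) simp
    also have "\<dots> \<le> emeasure (potm {0..<real T} 0) A"
      using min by (simp add: minorized_def emeasure_potm)
    finally show "emeasure (density lborel (\<lambda>x. ennreal \<eta> * indicator D x)) A \<le> emeasure (potm {0..<real T} 0) A" .
  qed
  then have "(\<integral>\<^sup>+x. g x \<partial>density lborel (\<lambda>x. ennreal \<eta> * indicator D x)) \<le> (\<integral>\<^sup>+x. g x \<partial>potm {0..<real T} 0)"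
    by (intro nn_integral_mono_measure) auto
  then show ?thesis
    by (subst (asm) nn_integral_density) (auto simp: nn_integral_cmult mult_ac)
qed

text \<open>Two successive times below \<open>T\<close> add up to a time below \<open>2 * T\<close>;
  each fixed first time contributes at most one full potential, and the first times have total
  length \<open>T\<close>.\<close>

lemma pot_convolution_le:
  assumes [measurable]: "A \<in> sets borel"
  shows "(\<integral>\<^sup>+y. pot {0..<real T} A y \<partial>potm {0..<real T} 0) \<le> of_nat T * pot {0..<real (2 * T)} A 0"
proof -
  have "(\<integral>\<^sup>+y. pot {0..<real T} A y \<partial>potm {0..<real T} 0)
      = (\<integral>\<^sup>+s\<in>{0..<real T}. (\<integral>\<^sup>+\<omega>. pot {0..<real T} A (0 + Y s \<omega>) \<partial>M) \<partial>lborel)"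
    by (rule nn_integral_potm(1)) measurable
  also have "\<dots> \<le> (\<integral>\<^sup>+s\<in>{0..<real T}. pot {0..<real (2 * T)} A 0 \<partial>lborel)"
  proof (rule nn_integral_mono)
    fix s
    show "(\<integral>\<^sup>+\<omega>. pot {0..<real T} A (0 + Y s \<omega>) \<partial>M) * indicator {0..<real T} s \<le> pot {0..<real (2 * T)} A 0 * indicator {0..<real T} s"
    proof (cases "s \<in> {0..<real T}")
      case True
      have "(\<integral>\<^sup>+\<omega>. pot {0..<real T} A (0 + Y s \<omega>) \<partial>M) = (\<integral>\<^sup>+t. (\<integral>\<^sup>+\<omega>. p t A (0 + Y s \<omega>) * indicator {0..<real T} t \<partial>M) \<partial>lborel)"
        unfolding pot_def by (rule Fubini_time) measurable
      also have "\<dots> = (\<integral>\<^sup>+t. p (s + t) A 0 * indicator {0..<real T} t \<partial>lborel)"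
      proof (rule nn_integral_cong)
        fix t
        show "(\<integral>\<^sup>+\<omega>. p t A (0 + Y s \<omega>) * indicator {0..<real T} t \<partial>M) = p (s + t) A 0 * indicator {0..<real T} t"
          using True by (cases "t \<in> {0..<real T}") (simp_all add: chapman_kolmogorov)
      qed
      also have "\<dots> \<le> (\<integral>\<^sup>+t. p (s + t) A 0 * indicator {0..<real (2 * T)} (s + t) \<partial>lborel)"
        using True by (intro nn_integral_mono) (auto simp: indicator_def)
      also have "\<dots> = pot {0..<real (2 * T)} A 0"
        unfolding pot_def by (rule nn_integral_shift[of "\<lambda>t. p t A 0 * indicator {0..<real (2 * T)} t"]) measurable
      finally show ?thesis using True by simp
    qed simp
  qed
  also have "\<dots> = of_nat T * pot {0..<real (2 * T)} A 0"
    by (subst nn_integral_cmult_indicator) (auto simp: mult.commute ennreal_of_nat_eq_real_of_nat)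
  finally show ?thesis .
qed

text \<open>Convolving two copies of \<open>\<eta>\<close> times Lebesgue measure on
  \<open>D\<close> gives the density \<open>\<eta>\<^sup>2\<close> times the overlap of
  \<open>D\<close> with its reflection at \<open>z\<close>, at least \<open>\<rho>\<close> on
  \<open>D'\<close>. The division by \<open>T\<close> undoes the factor of
  \<open>pot_convolution_le\<close>.\<close>

lemma minorized_convolution:
  assumes min: "minorized T \<eta> D" and \<rho>: "0 < \<rho>" and D' [measurable]: "D' \<in> sets borel"
    and overlap: "\<And>z. z \<in> D' \<Longrightarrow> ennreal \<rho> \<le> emeasure lborel {y \<in> D. z - y \<in> D}"
  shows "minorized (2 * T) (\<eta>\<^sup>2 * \<rho> / real T) D'"
  unfolding minorized_def
proof (intro conjI ballI)
  have D [measurable]: "D \<in> sets borel" and \<eta>: "0 < \<eta>" and T: "0 < T" using min by (auto simp: minorized_def)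
  show "0 < \<eta>\<^sup>2 * \<rho> / real T" using \<eta> \<rho> T by simp
  show "0 < 2 * T" using T by simp
  fix A :: "real set" assume [measurable]: "A \<in> sets borel"
  let ?A = "A \<inter> D'"
  have "ennreal \<eta> * (ennreal \<eta> * (ennreal \<rho> * emeasure lborel ?A))
     = ennreal \<eta> * (ennreal \<eta> * (\<integral>\<^sup>+z. ennreal \<rho> * indicator ?A z \<partial>lborel))"
    by (subst nn_integral_cmult_indicator) auto
  also have "\<dots> \<le> ennreal \<eta> * (ennreal \<eta> * (\<integral>\<^sup>+z. (\<integral>\<^sup>+y. indicator ?A z * (indicator D y * indicator D (z - y)) \<partial>lborel) \<partial>lborel))"
  proof (intro mult_left_mono nn_integral_mono)
    fix z
    show "ennreal \<rho> * indicator ?A z \<le> (\<integral>\<^sup>+y. indicator ?A z * (indicator D y * indicator D (z - y)) \<partial>lborel)"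
    proof (cases "z \<in> ?A")
      case True
      have "{y \<in> D. z - y \<in> D} = {y \<in> space borel. y \<in> D \<and> z - y \<in> D}" by simp
      also have "\<dots> \<in> sets borel" by measurable
      finally have [measurable]: "{y \<in> D. z - y \<in> D} \<in> sets borel" .
      have "(\<integral>\<^sup>+y. indicator ?A z * (indicator D y * indicator D (z - y)) \<partial>lborel) = (\<integral>\<^sup>+y. indicator {y \<in> D. z - y \<in> D} y \<partial>lborel)"
        using True by (intro nn_integral_cong) (auto simp: indicator_def)
      then show ?thesis using overlap[of z] True by simp
    qed simp
  qed auto
  also have "(\<integral>\<^sup>+z. (\<integral>\<^sup>+y. indicator ?A z * (indicator D y * indicator D (z - y)) \<partial>lborel) \<partial>lborel)
    = (\<integral>\<^sup>+y. (\<integral>\<^sup>+z. indicator ?A z * (indicator D y * indicator D (z - y)) \<partial>lborel) \<partial>lborel)"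
    by (rule lborel_pair.Fubini') measurable
  also have "\<dots> = (\<integral>\<^sup>+y\<in>D. (\<integral>\<^sup>+x\<in>D. indicator ?A (y + x) \<partial>lborel) \<partial>lborel)"
  proof (rule nn_integral_cong)
    fix y
    have "(\<integral>\<^sup>+z. indicator ?A z * (indicator D y * indicator D (z - y)) \<partial>lborel)
      = (\<integral>\<^sup>+x. indicator ?A (y + x) * (indicator D y * indicator D (y + x - y)) \<partial>lborel)"
      by (rule nn_integral_shift[symmetric]) measurable
    also have "\<dots> = (\<integral>\<^sup>+x. (indicator ?A (y + x) * indicator D x) * indicator D y \<partial>lborel)"
      by (simp add: mult_ac)
    also have "\<dots> = (\<integral>\<^sup>+x\<in>D. indicator ?A (y + x) \<partial>lborel) * indicator D y"
      by (rule nn_integral_multc) measurable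
    finally show "(\<integral>\<^sup>+z. indicator ?A z * (indicator D y * indicator D (z - y)) \<partial>lborel) = (\<integral>\<^sup>+x\<in>D. indicator ?A (y + x) \<partial>lborel) * indicator D y" .
  qed
  also have "ennreal \<eta> * (\<integral>\<^sup>+y\<in>D. (\<integral>\<^sup>+x\<in>D. indicator ?A (y + x) \<partial>lborel) \<partial>lborel)
      = (\<integral>\<^sup>+y\<in>D. ennreal \<eta> * (\<integral>\<^sup>+x\<in>D. indicator ?A (y + x) \<partial>lborel) \<partial>lborel)"
    by (subst nn_integral_cmult[symmetric]) (auto simp: mult.assoc)
  also have "\<dots> \<le> (\<integral>\<^sup>+y\<in>D. pot {0..<real T} ?A y \<partial>lborel)"
  proof (intro nn_integral_mono mult_right_mono)
    fix y
    have "ennreal \<eta> * (\<integral>\<^sup>+x\<in>D. indicator ?A (y + x) \<partial>lborel) \<le> (\<integral>\<^sup>+x. indicator ?A (y + x) \<partial>potm {0..<real T} 0)"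
      by (rule minorized_nn_integral[OF min]) measurable
    also have "\<dots> = pot {0..<real T} ?A y"
      by (subst nn_integral_potm(1)) (auto simp: pot_def p_nn_integral)
    finally show "ennreal \<eta> * (\<integral>\<^sup>+x\<in>D. indicator ?A (y + x) \<partial>lborel) \<le> pot {0..<real T} ?A y" .
  qed auto
  finally have "ennreal \<eta> * (ennreal \<eta> * (ennreal \<rho> * emeasure lborel ?A)) \<le> ennreal \<eta> * (\<integral>\<^sup>+y\<in>D. pot {0..<real T} ?A y \<partial>lborel)"
    by (simp add: mult_left_mono)
  also have "\<dots> \<le> (\<integral>\<^sup>+y. pot {0..<real T} ?A y \<partial>potm {0..<real T} 0)"
    by (rule minorized_nn_integral[OF min]) measurable
  also have "\<dots> \<le> of_nat T * pot {0..<real (2 * T)} ?A 0" by (rule pot_convolution_le) simp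
  finally have le: "ennreal (1 / real T) * (ennreal \<eta> * (ennreal \<eta> * (ennreal \<rho> * emeasure lborel ?A))) \<le> ennreal (1 / real T) * (of_nat T * pot {0..<real (2 * T)} ?A 0)"
    by (rule mult_left_mono) simp
  have "ennreal (1 / real T) * (of_nat T * pot {0..<real (2 * T)} ?A 0) = pot {0..<real (2 * T)} ?A 0"
    unfolding ennreal_of_nat_eq_real_of_nat mult.assoc[symmetric] using T by (subst ennreal_mult[symmetric]) auto
  moreover have "ennreal (1 / real T) * (ennreal \<eta> * (ennreal \<eta> * (ennreal \<rho> * emeasure lborel ?A))) = ennreal (\<eta>\<^sup>2 * \<rho> / real T) * emeasure lborel ?A"
  proof -
    have "ennreal (\<eta>\<^sup>2 * \<rho> / real T) = ennreal (1 / real T * (\<eta> * (\<eta> * \<rho>)))"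
      by (simp add: power2_eq_square mult.assoc)
    also have "\<dots> = ennreal (1 / real T) * (ennreal \<eta> * (ennreal \<eta> * ennreal \<rho>))"
      using \<eta> \<rho> T by (subst ennreal_mult, simp, simp)+ simp
    finally show ?thesis by (simp only: mult.assoc)
  qed
  ultimately have "ennreal (\<eta>\<^sup>2 * \<rho> / real T) * emeasure lborel ?A \<le> pot {0..<real (2 * T)} ?A 0"
    using le by (simp only:)
  also have "\<dots> \<le> pot {0..<real (2 * T)} A 0" by (rule pot_mono) auto
  finally show "ennreal (\<eta>\<^sup>2 * \<rho> / real T) * emeasure lborel ?A \<le> pot {0..<real (2 * T)} A 0" .
qed fact

text \<open>The potential over one unit of time has mass 1 and, by the upper bound, a Radon-Nikodym
  density; so this density exceeds some \<open>1 / real (Suc n)\<close> on a bounded set of positive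
  measure. Steinhaus' theorem and one convolution replace this set by an interval.\<close>

lemma minorized_interval_start:
  obtains T \<eta> a b where "a < b" "minorized T \<eta> {a..b}"
proof -
  obtain C where C: "0 < C" "\<And>A y. A \<in> sets borel \<Longrightarrow> pot {0..} A y \<le> ennreal C * emeasure lborel A"
    using pot_density_bound by metis
  let ?P = "potm {0..<real 1} 0"
  have "absolutely_continuous lborel ?P"
    unfolding absolutely_continuous_def
  proof
    fix N assume "N \<in> null_sets (lborel :: real measure)"
    then have N: "N \<in> sets borel" "emeasure lborel N = 0" by auto
    have "pot {0..<real 1} N 0 \<le> pot {0..} N 0" by (rule pot_mono_time) auto
    also have "\<dots> \<le> ennreal C * emeasure lborel N" by (rule C) fact
    finally show "N \<in> null_sets ?P" using N by (auto simp: null_sets_def emeasure_potm)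
  qed
  then have dens: "density lborel (RN_deriv lborel ?P) = ?P"
    by (intro sigma_finite_measure.density_RN_deriv[OF lborel.sigma_finite_measure_axioms]) auto
  define u where "u = RN_deriv lborel ?P"
  have [measurable]: "u \<in> borel_measurable borel" unfolding u_def using borel_measurable_RN_deriv[of lborel ?P] by simp
  have P: "pot {0..<real 1} A 0 = (\<integral>\<^sup>+x\<in>A. u x \<partial>lborel)" if [measurable]: "A \<in> sets borel" for A
  proof -
    have "pot {0..<real 1} A 0 = emeasure ?P A" by (simp add: emeasure_potm)
    also have "\<dots> = emeasure (density lborel u) A" unfolding u_def dens ..
    also have "\<dots> = (\<integral>\<^sup>+x\<in>A. u x \<partial>lborel)" by (rule emeasure_density) simp_all
    finally show ?thesis .
  qed
  let ?D = "\<lambda>n::nat. {x. ennreal (1 / real (Suc n)) < u x} \<inter> {- real (Suc n)..real (Suc n)}"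
  have D [measurable]: "?D n \<in> sets borel" for n by measurable
  have "\<exists>n. 0 < emeasure lborel (?D n)"
  proof (rule ccontr)
    assume "\<not> ?thesis"
    then have "?D n \<in> null_sets lborel" for n by (auto simp: null_sets_def)
    then have "(\<Union>n. ?D n) \<in> null_sets lborel" by (rule null_sets_UN)
    from AE_not_in[OF this] have "AE x in lborel. u x = 0"
    proof eventually_elim
      fix x assume x: "x \<notin> (\<Union>n. ?D n)"
      show "u x = 0"
      proof (rule ccontr)
        assume "u x \<noteq> 0"
        have "\<exists>r. 0 < r \<and> ennreal r < u x"
        proof (cases "u x")
          case (real r)
          with \<open>u x \<noteq> 0\<close> have "0 < r" by (auto simp: less_le)
          then show ?thesis unfolding real by (intro exI[of _ "r / 2"]) (auto simp: ennreal_less_iff)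
        qed (auto intro!: exI[of _ 1])
        then obtain r where r: "0 < r" "ennreal r < u x" by blast
        obtain n1 :: nat where n1: "1 / r < real n1" using reals_Archimedean2 by blast
        obtain n2 :: nat where n2: "\<bar>x\<bar> \<le> real n2" using real_arch_simple by blast
        let ?n = "max n1 n2"
        have "1 / r < real (Suc ?n)" using n1 by (simp add: max_def)
        then have "1 / real (Suc ?n) < r" using r(1) by (simp add: field_simps)
        then have "ennreal (1 / real (Suc ?n)) < u x" using r by (meson ennreal_leI le_less_trans less_imp_le)
        moreover have "\<bar>x\<bar> \<le> real (Suc ?n)" using n2 by (simp add: max_def)
        ultimately have "x \<in> ?D ?n" by auto
        with x show False by blast
      qed
    qed
    then have "pot {0..<real 1} UNIV 0 = 0"
      by (subst P, simp, subst nn_integral_0_iff_AE) auto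
    moreover have "pot {0..<real 1} UNIV 0 = 1"
      using emeasure_space_1 by (simp add: pot_def p_def)
    ultimately show False by simp
  qed
  then obtain n where n: "0 < emeasure lborel (?D n)" by blast
  have min: "minorized 1 (1 / real (Suc n)) (?D n)"
    unfolding minorized_def
  proof (intro conjI ballI)
    fix A :: "real set" assume [measurable]: "A \<in> sets borel"
    have "ennreal (1 / real (Suc n)) * emeasure lborel (A \<inter> ?D n) = (\<integral>\<^sup>+x. ennreal (1 / real (Suc n)) * indicator (A \<inter> ?D n) x \<partial>lborel)"
      by (rule nn_integral_cmult_indicator[symmetric]) simp
    also have "\<dots> \<le> (\<integral>\<^sup>+x\<in>A. u x \<partial>lborel)"
      by (intro nn_integral_mono) (simp add: indicator_def less_imp_le)
    also have "\<dots> = pot {0..<real 1} A 0" by (rule P[symmetric]) simp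
    finally show "ennreal (1 / real (Suc n)) * emeasure lborel (A \<inter> ?D n) \<le> pot {0..<real 1} A 0" .
  qed auto
  show thesis
  proof (rule steinhaus[OF D _ _ n, of "real (Suc n)"])
    fix a b \<rho> assume "a < b" "0 < \<rho>" "\<And>z. z \<in> {a..b} \<Longrightarrow> ennreal \<rho> \<le> emeasure lborel {y \<in> ?D n. z - y \<in> ?D n}"
    from that[OF this(1) minorized_convolution[OF min this(2) _ this(3)]] show thesis by simp
  qed auto
qed

text \<open>The overlap of an interval with its reflection is a tent function on the doubled
  interval. Cutting a quarter of the original length from either end keeps the height at least
  \<open>(b - a) / 4\<close> and still lengthens the interval by the factor 3/2.\<close>

lemma minorized_interval_step:
  assumes min: "minorized T \<eta> {a..b}" and ab: "a < b"
  shows "minorized (2 * T) (\<eta>\<^sup>2 * ((b - a) / 4) / real T) {2 * a + (b - a) / 4..2 * b - (b - a) / 4}"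
proof (rule minorized_convolution[OF min])
  fix z assume z: "z \<in> {2 * a + (b - a) / 4..2 * b - (b - a) / 4}"
  have "{y \<in> {a..b}. z - y \<in> {a..b}} = {max a (z - b)..min b (z - a)}" by auto
  moreover have "(b - a) / 4 \<le> min b (z - a) - max a (z - b)"
    using z ab by (auto simp: min_def max_def field_simps)
  ultimately show "ennreal ((b - a) / 4) \<le> emeasure lborel {y \<in> {a..b}. z - y \<in> {a..b}}"
    using ab by (auto simp del: max.bounded_iff min.bounded_iff intro!: ennreal_leI)
qed (use ab in auto)

lemma minorized_long_interval:
  obtains T \<eta> a b where "minorized T \<eta> {a..b}" "a + L \<le> b"
proof -
  obtain T0 \<eta>0 a0 b0 where start: "a0 < b0" "minorized T0 \<eta>0 {a0..b0}"
    by (rule minorized_interval_start)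
  have "\<exists>T \<eta> a b. minorized T \<eta> {a..b} \<and> (3/2)^n * (b0 - a0) \<le> b - a" for n
  proof (induction n)
    case 0
    show ?case using start by (intro exI[of _ T0] exI[of _ \<eta>0] exI[of _ a0] exI[of _ b0]) simp
  next
    case (Suc n)
    then obtain T \<eta> a b where min: "minorized T \<eta> {a..b}" and le: "(3/2)^n * (b0 - a0) \<le> b - a" by blast
    have "0 < (3/2)^n * (b0 - a0)" using start by simp
    with le have "a < b" by linarith
    from minorized_interval_step[OF min this] show ?case
      using le by (intro exI[of _ "2 * T"] exI[of _ "\<eta>\<^sup>2 * ((b - a) / 4) / real T"]
        exI[of _ "2 * a + (b - a) / 4"] exI[of _ "2 * b - (b - a) / 4"] conjI) (simp_all add: field_simps)
  qed
  moreover obtain n where "L / (b0 - a0) < (3/2)^n"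
    using real_arch_pow[of "3/2"] by auto
  then have "L < (3/2)^n * (b0 - a0)" using start by (simp add: field_simps)
  ultimately show thesis using that by (smt (verit))
qed

text \<open>Whenever the walk is suitably placed before a set of diameter at most 1, the next
  \<open>T\<close> units of time contribute \<open>\<eta>\<close> times its measure. The expected
  number of such placements is at least 1/2 and the time windows overlap at most \<open>T\<close>
  times, so \<open>c = \<eta> / (2 * T)\<close>; general sets are sums of unit pieces.\<close>

lemma pot_lower_bound:
  obtains c x0 where "0 < c" "\<And>A. A \<in> sets borel \<Longrightarrow> A \<subseteq> {x0..} \<Longrightarrow> ennreal c * emeasure lborel A \<le> pot {0..} A 0"
proof -
  obtain L where L: "0 < L" "\<And>x. 0 \<le> x \<Longrightarrow> 1/2 \<le> renewal {x..x+L}"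
    using renewal_ge by metis
  obtain T \<eta> a b where min: "minorized T \<eta> {a..b}" and ab: "a + (L + 1) \<le> b"
    by (rule minorized_long_interval[of "L + 1"])
  have T: "0 < T" and \<eta>: "0 < \<eta>" using min by (auto simp: minorized_def)
  define c where "c = \<eta> / (2 * real T)"
  define x0 where "x0 = max b 0"
  have unit: "ennreal c * emeasure lborel A \<le> pot {0..} A 0"
    if A [measurable]: "A \<in> sets borel" and Ax: "A \<subseteq> {x..x+1}" and x: "x0 \<le> x" for A x
  proof -
    \<comment> \<open>From any point of this interval the set \<open>A\<close> is seen inside
      \<open>{a..b}\<close>. Its length is \<open>b - a - 1\<close>, and the 1 in
      \<open>L + 1\<close> was reserved for exactly this loss; \<open>x0\<close> keeps its left end
      nonnegative.\<close>
    let ?I = "{x + 1 - b..x - a}"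
    have "ennreal \<eta> * emeasure lborel A * (\<Sum>n<N. p (real n) ?I 0) \<le> of_nat T * pot {0..} A 0" for N
    proof -
      have "ennreal \<eta> * emeasure lborel A * (\<Sum>n<N. p (real n) ?I 0)
        = (\<Sum>n<N. \<integral>\<^sup>+\<omega>. ennreal \<eta> * emeasure lborel A * indicator ?I (0 + Y (real n) \<omega>) \<partial>M)"
        by (simp add: sum_distrib_left nn_integral_cmult p_nn_integral)
      also have "\<dots> \<le> (\<Sum>n<N. \<integral>\<^sup>+\<omega>. pot {0..<real T} A (0 + Y (real n) \<omega>) \<partial>M)"
      proof (intro sum_mono nn_integral_mono)
        fix n \<omega>
        let ?y = "0 + Y (real n) \<omega>"
        show "ennreal \<eta> * emeasure lborel A * indicator ?I ?y \<le> pot {0..<real T} A ?y"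
        proof (cases "?y \<in> ?I")
          case True
          let ?B = "(\<lambda>z. z + ?y) -` A"
          have "?B \<inter> {a..b} = ?B" using Ax True by fastforce
          then have "ennreal \<eta> * emeasure lborel A \<le> pot {0..<real T} ?B 0"
            using min emeasure_lborel_translate[OF A] unfolding minorized_def by metis
          then show ?thesis using True by (simp add: pot_shift[symmetric])
        qed simp
      qed
      also have "\<dots> = (\<Sum>n<N. \<integral>\<^sup>+t\<in>{0..<real T}. p (real n + t) A 0 \<partial>lborel)"
      proof (rule sum.cong[OF refl])
        fix n
        have "(\<integral>\<^sup>+\<omega>. pot {0..<real T} A (0 + Y (real n) \<omega>) \<partial>M) = (\<integral>\<^sup>+t. (\<integral>\<^sup>+\<omega>. p t A (0 + Y (real n) \<omega>) * indicator {0..<real T} t \<partial>M) \<partial>lborel)"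
          unfolding pot_def by (rule Fubini_time) measurable
        also have "\<dots> = (\<integral>\<^sup>+t\<in>{0..<real T}. p (real n + t) A 0 \<partial>lborel)"
        proof (rule nn_integral_cong)
          fix t
          show "(\<integral>\<^sup>+\<omega>. p t A (0 + Y (real n) \<omega>) * indicator {0..<real T} t \<partial>M) = p (real n + t) A 0 * indicator {0..<real T} t"
            by (cases "t \<in> {0..<real T}") (simp_all add: chapman_kolmogorov)
        qed
        finally show "(\<integral>\<^sup>+\<omega>. pot {0..<real T} A (0 + Y (real n) \<omega>) \<partial>M) = (\<integral>\<^sup>+t\<in>{0..<real T}. p (real n + t) A 0 \<partial>lborel)" .
      qed
      also have "\<dots> \<le> of_nat T * (\<integral>\<^sup>+t\<in>{0..}. p t A 0 \<partial>lborel)"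
        by (rule nn_integral_overlapping_segments) measurable
      finally show ?thesis by (simp add: pot_def)
    qed
    then have "(SUP N. ennreal \<eta> * emeasure lborel A * (\<Sum>n<N. p (real n) ?I 0)) \<le> of_nat T * pot {0..} A 0"
      by (intro SUP_least)
    then have "ennreal \<eta> * emeasure lborel A * renewal ?I \<le> of_nat T * pot {0..} A 0"
      unfolding renewal_def suminf_eq_SUP by (simp add: SUP_mult_left_ennreal)
    moreover have "1/2 \<le> renewal ?I"
    proof -
      have "1/2 \<le> renewal {x + 1 - b..x + 1 - b + L}" using x by (intro L) (simp add: x0_def)
      also have "\<dots> \<le> renewal ?I"
        unfolding renewal_def using ab by (intro suminf_le p_mono) auto
      finally show ?thesis .
    qed
    then have "ennreal \<eta> * emeasure lborel A * (1/2) \<le> ennreal \<eta> * emeasure lborel A * renewal ?I"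
      by (rule mult_left_mono) simp
    ultimately have "ennreal \<eta> * emeasure lborel A * (1/2) \<le> of_nat T * pot {0..} A 0" by (rule order_trans[rotated])
    then have "ennreal (1 / real T) * (ennreal \<eta> * emeasure lborel A * (1/2)) \<le> ennreal (1 / real T) * (of_nat T * pot {0..} A 0)"
      by (rule mult_left_mono) simp
    moreover have "ennreal (1 / real T) * (of_nat T * pot {0..} A 0) = pot {0..} A 0"
      unfolding ennreal_of_nat_eq_real_of_nat mult.assoc[symmetric] using T by (subst ennreal_mult[symmetric]) auto
    moreover have "ennreal (1 / real T) * (ennreal \<eta> * emeasure lborel A * (1/2)) = ennreal c * emeasure lborel A"
    proof -
      have "ennreal c = ennreal (1 / real T * (\<eta> * (1/2)))" by (simp add: c_def mult.commute)
      also have "\<dots> = ennreal (1 / real T) * (ennreal \<eta> * (1/2))"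
        unfolding ennreal_half using \<eta> T by (subst ennreal_mult, simp, simp)+ simp
      finally show ?thesis by (simp only: mult_ac)
    qed
    ultimately show ?thesis by simp
  qed
  show thesis
  proof (rule that[of c x0])
    show "0 < c" using \<eta> T by (simp add: c_def)
    fix A :: "real set" assume A [measurable]: "A \<in> sets borel" and Ax: "A \<subseteq> {x0..}"
    let ?A = "\<lambda>n::nat. A \<inter> {x0 + real n..<x0 + real n + 1}"
    have disj: "disjoint_family ?A"
      unfolding disjoint_family_on_def
    proof safe
      fix m n :: nat and x assume "m \<noteq> n" "x \<in> {x0 + real m..<x0 + real m + 1}" "x \<in> {x0 + real n..<x0 + real n + 1}"
      then have "real m < real n + 1" "real n < real m + 1" by auto
      then have "m = n" by linarith
      with \<open>m \<noteq> n\<close> show "x \<in> {}" by simp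
    qed
    have eq: "(\<Union>n. ?A n) = A"
    proof
      show "A \<subseteq> (\<Union>n. ?A n)"
      proof
        fix x assume "x \<in> A"
        moreover from this Ax have "x0 \<le> x" by auto
        then have "x \<in> {x0 + real (nat \<lfloor>x - x0\<rfloor>)..<x0 + real (nat \<lfloor>x - x0\<rfloor>) + 1}"
          by simp linarith
        ultimately show "x \<in> (\<Union>n. ?A n)" by blast
      qed
    qed auto
    have ranges: "range ?A \<subseteq> sets borel" by auto
    have "ennreal c * emeasure lborel A = ennreal c * (\<Sum>n. emeasure lborel (?A n))"
      using suminf_emeasure[of ?A lborel, OF _ disj] ranges unfolding eq by simp
    also have "\<dots> = (\<Sum>n. ennreal c * emeasure lborel (?A n))" by simp
    also have "\<dots> \<le> (\<Sum>n. emeasure (potm {0..} 0) (?A n))"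
    proof (rule suminf_le)
      fix n
      show "ennreal c * emeasure lborel (?A n) \<le> emeasure (potm {0..} 0) (?A n)"
      proof -
        have "?A n \<in> sets borel" "?A n \<subseteq> {x0 + real n..x0 + real n + 1}" by auto
        from unit[OF this] show ?thesis by (simp add: emeasure_potm)
      qed
    qed auto
    also have "\<dots> = emeasure (potm {0..} 0) A"
      using suminf_emeasure[of ?A "potm {0..} 0", OF _ disj] ranges unfolding eq by simp
    finally show "ennreal c * emeasure lborel A \<le> pot {0..} A 0" by (simp add: emeasure_potm)
  qed
qed

end

section \<open>Perpetual integrals\<close>

context local_time_levy
begin

lemma second_moment_density:
  assumes [measurable]: "A \<in> sets borel" and C: "0 \<le> C" "\<And>y. pot {0..} A y \<le> ennreal C * emeasure lborel A"
  shows "(\<integral>\<^sup>+\<omega>. (occ {0..} A \<omega>)\<^sup>2 \<partial>M) \<le> 2 * (ennreal C * emeasure lborel A)\<^sup>2"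
proof -
  have sp: "space M \<in> sets (F 0)" using sets.top[of "F 0"] by simp
  have "(\<integral>\<^sup>+\<omega>. (occ {0..} A \<omega>)\<^sup>2 \<partial>M) = (\<integral>\<^sup>+\<omega>. indicator (space M) \<omega> * (occ_from 0 {0..} A \<omega>)\<^sup>2 \<partial>M)"
    by (intro nn_integral_cong) (simp add: occ_from_0)
  also have "\<dots> \<le> 2 * (emeasure M (space M) * pot {0..} A 0 * (ennreal C * emeasure lborel A))"
    by (rule occ_from_second_moment[OF order_refl sp]) (auto intro: C)
  also have "\<dots> \<le> 2 * (ennreal C * emeasure lborel A)\<^sup>2"
    unfolding power2_eq_square emeasure_space_1 mult_1 by (intro mult_left_mono mult_right_mono C) auto
  finally show ?thesis .
qed

text \<open>Given a positive-probability event that is a decreasing limit of events depending only on an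
  initial piece of the path, the occupation measure restricted to it dominates Lebesgue measure far
  to the right: the late path is independent of the early events, and the correction term is
  controlled by the second moment.\<close>

lemma occ_on_event_ge:
  assumes B: "\<And>n. B n \<in> sets (F (real n))" "decseq B" and pos: "0 < prob (\<Inter>n. B n)"
  obtains c R where "0 < c"
    "\<And>A. A \<in> sets borel \<Longrightarrow> A \<subseteq> {R..} \<Longrightarrow> emeasure lborel A < \<infinity> \<Longrightarrow>
      ennreal c * emeasure lborel A \<le> (\<integral>\<^sup>+\<omega>. indicator (\<Inter>n. B n) \<omega> * occ {0..} A \<omega> \<partial>M)"
proof -
  obtain c x0 where c: "0 < c" "\<And>A. A \<in> sets borel \<Longrightarrow> A \<subseteq> {x0..} \<Longrightarrow> ennreal c * emeasure lborel A \<le> pot {0..} A 0"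
    using pot_lower_bound by metis
  obtain C where C: "0 < C" "\<And>A y. A \<in> sets borel \<Longrightarrow> pot {0..} A y \<le> ennreal C * emeasure lborel A"
    using pot_density_bound by metis
  define I where "I = (\<Inter>n. B n)"
  define q where "q = prob I"
  have q: "0 < q" using pos by (simp add: q_def I_def)
  have BM [measurable]: "B n \<in> sets M" for n using B(1) sets_F_subset by blast
  have IM [measurable]: "I \<in> sets M" unfolding I_def by (intro sets.countable_INT) auto
  \<comment> \<open>Chosen to balance two errors, the squared occupation and the discarded event
    \<open>B n - I\<close>: each becomes \<open>q * c / 8 * \<alpha>\<close>, together half of the
    main term \<open>q * c / 2 * \<alpha>\<close>.\<close>
  define \<theta> where "\<theta> = q * c / (16 * C\<^sup>2)"
  have \<theta>: "0 < \<theta>" using q c C by (simp add: \<theta>_def)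
  have "(\<lambda>n. prob (B n)) \<longlonglongrightarrow> q"
    unfolding q_def I_def by (rule finite_Lim_measure_decseq) (use B in auto)
  moreover have "q < q + q * c * \<theta> / 2" using q c \<theta> by simp
  ultimately obtain n where n: "prob (B n) < q + q * c * \<theta> / 2"
    using order_tendstoD(2) by (metis eventually_sequentially order_refl)
  have IB: "I \<subseteq> B n" by (auto simp: I_def)
  have diff: "prob (B n - I) \<le> q * c * \<theta> / 2"
    using n IB by (subst finite_measure_Diff) (auto simp: q_def)
  have "(\<lambda>k. prob {\<omega> \<in> space M. real k < Y (real n) \<omega>}) \<longlonglongrightarrow> prob (\<Inter>k. {\<omega> \<in> space M. real k < Y (real n) \<omega>})"
    by (rule finite_Lim_measure_decseq) (auto simp: decseq_def)
  moreover have "(\<Inter>k. {\<omega> \<in> space M. real k < Y (real n) \<omega>}) = {}"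
  proof -
    have "\<exists>k::nat. \<not> real k < x" for x using real_arch_simple[of x] by (auto simp: not_less)
    then show ?thesis by blast
  qed
  ultimately have "(\<lambda>k. prob {\<omega> \<in> space M. real k < Y (real n) \<omega>}) \<longlonglongrightarrow> 0" by simp
  from order_tendstoD(2)[OF this, of "q / 2"] q
  obtain k where k: "prob {\<omega> \<in> space M. real k < Y (real n) \<omega>} < q / 2"
    by (auto simp: eventually_sequentially)
  \<comment> \<open>Bounding the position at time \<open>n\<close> guarantees that a set to the
    right of \<open>x0 + real k\<close>, seen from there, lies to the right of \<open>x0\<close>.
    The bound costs at most half of the probability.\<close>
  define G where "G = B n \<inter> {\<omega> \<in> space M. Y (real n) \<omega> \<le> real k}"
  have GF: "G \<in> sets (F (real n))"
  proof -
    have [measurable]: "Y (real n) \<in> borel_measurable (F (real n))" by (rule rv_F) simp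
    have "{\<omega> \<in> space (F (real n)). Y (real n) \<omega> \<le> real k} \<in> sets (F (real n))" by measurable
    then show ?thesis unfolding G_def using B(1)[of n] by simp
  qed
  have GM [measurable]: "G \<in> sets M" using GF sets_F_subset by blast
  have Gprob: "q / 2 \<le> prob G"
  proof -
    have "q \<le> prob (B n)" unfolding q_def by (rule finite_measure_mono[OF IB]) simp
    also have "\<dots> \<le> prob (G \<union> {\<omega> \<in> space M. real k < Y (real n) \<omega>})"
      using sets.sets_into_space[OF BM[of n]] by (intro finite_measure_mono) (auto simp: G_def)
    also have "\<dots> \<le> prob G + prob {\<omega> \<in> space M. real k < Y (real n) \<omega>}"
      by (rule measure_Un_le) auto
    finally show ?thesis using k by simp
  qed
  show thesis
  proof (rule that[of "q * c / 4" "x0 + real k"])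
    show "0 < q * c / 4" using q c by simp
    fix A :: "real set" assume A [measurable]: "A \<in> sets borel" and AR: "A \<subseteq> {x0 + real k..}" and fin: "emeasure lborel A < \<infinity>"
    obtain \<alpha> where \<alpha>: "emeasure lborel A = ennreal \<alpha>" "0 \<le> \<alpha>" using fin by (cases "emeasure lborel A") auto
    show "ennreal (q * c / 4) * emeasure lborel A \<le> (\<integral>\<^sup>+\<omega>. indicator (\<Inter>n. B n) \<omega> * occ {0..} A \<omega> \<partial>M)"
    proof (cases "\<alpha> = 0")
      case True
      then show ?thesis by (simp add: \<alpha>)
    next
      case False
      with \<alpha> have \<alpha>0: "0 < \<alpha>" by simp
      have Yn [measurable]: "Y (real n) \<in> borel_measurable (F (real n))" by (rule rv_F) simp
      note GF [measurable]
      have "ennreal (q / 2) * ennreal (c * \<alpha>) \<le> emeasure M G * (ennreal c * emeasure lborel A)"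
        unfolding emeasure_eq_measure \<alpha> using c(1) \<alpha>(2) Gprob by (intro mult_mono ennreal_leI) (auto simp: ennreal_mult)
      also have "\<dots> = (\<integral>\<^sup>+\<omega>. indicator G \<omega> * (ennreal c * emeasure lborel A) \<partial>M)"
        by (rule nn_integral_indicator_F[OF GF, symmetric])
      also have "\<dots> \<le> (\<integral>\<^sup>+\<omega>. indicator G \<omega> * pot {0..} A (Y (real n) \<omega>) \<partial>M)"
      proof (rule nn_integral_mono)
        fix \<omega>
        let ?y = "Y (real n) \<omega>"
        show "indicator G \<omega> * (ennreal c * emeasure lborel A) \<le> indicator G \<omega> * pot {0..} A ?y"
        proof (cases "\<omega> \<in> G")
          case True
          let ?B = "(\<lambda>z. z + ?y) -` A"
          have "?B \<subseteq> {x0..}" using AR True unfolding G_def by fastforce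
          from c(2)[OF emeasure_lborel_translate(1)[OF A] this]
          have "ennreal c * emeasure lborel A \<le> pot {0..} A ?y"
            unfolding emeasure_lborel_translate(2)[OF A] pot_shift[symmetric] .
          then show ?thesis using True by simp
        qed simp
      qed
      also have "\<dots> = (\<integral>\<^sup>+\<omega>. (\<integral>\<^sup>+t. indicator G \<omega> * (p t A (Y (real n) \<omega>) * indicator {0..} t) \<partial>lborel) \<partial>M)"
        unfolding pot_def by (intro nn_integral_cong nn_integral_cmult[symmetric]) measurable
      also have "\<dots> = (\<integral>\<^sup>+t. (\<integral>\<^sup>+\<omega>. indicator G \<omega> * (p t A (Y (real n) \<omega>) * indicator {0..} t) \<partial>M) \<partial>lborel)"
        by (rule Fubini_time) measurable
      also have "\<dots> = (\<integral>\<^sup>+t. (\<integral>\<^sup>+\<omega>. indicator G \<omega> * (indicator A (Y (real n + t) \<omega>) * indicator {0..} t) \<partial>M) \<partial>lborel)"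
      proof (rule nn_integral_cong)
        fix t
        show "(\<integral>\<^sup>+\<omega>. indicator G \<omega> * (p t A (Y (real n) \<omega>) * indicator {0..} t) \<partial>M) = (\<integral>\<^sup>+\<omega>. indicator G \<omega> * (indicator A (Y (real n + t) \<omega>) * indicator {0..} t) \<partial>M)"
        proof (cases "0 \<le> t")
          case True
          have "(\<integral>\<^sup>+\<omega>. indicator G \<omega> * indicator A (Y (real n) \<omega> + (Y (real n + t) \<omega> - Y (real n) \<omega>)) \<partial>M) = (\<integral>\<^sup>+\<omega>. indicator G \<omega> * p t A (Y (real n) \<omega>) \<partial>M)"
            using True by (intro markov_p) (auto intro: Yn)
          with True show ?thesis by simp
        qed simp
      qed
      also have "\<dots> = (\<integral>\<^sup>+\<omega>. (\<integral>\<^sup>+t. indicator G \<omega> * (indicator A (Y (real n + t) \<omega>) * indicator {0..} t) \<partial>lborel) \<partial>M)"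
        by (rule Fubini_time[symmetric]) measurable
      also have "\<dots> \<le> (\<integral>\<^sup>+\<omega>. indicator (B n) \<omega> * occ {0..} A \<omega> \<partial>M)"
      proof (rule nn_integral_mono)
        fix \<omega> assume \<omega>: "\<omega> \<in> space M"
        have [measurable]: "(\<lambda>t. Y t \<omega>) \<in> borel_measurable borel" using \<omega> by measurable
        have "(\<integral>\<^sup>+t. indicator A (Y (real n + t) \<omega>) * indicator {0..} t \<partial>lborel) \<le> (\<integral>\<^sup>+t. indicator A (Y (real n + t) \<omega>) * indicator {0..} (real n + t) \<partial>lborel)"
          by (intro nn_integral_mono) (auto simp: indicator_def)
        also have "\<dots> = occ {0..} A \<omega>"
          unfolding occ_def by (rule nn_integral_shift[of "\<lambda>t. indicator A (Y t \<omega>) * indicator {0..} t"]) measurable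
        finally show "(\<integral>\<^sup>+t. indicator G \<omega> * (indicator A (Y (real n + t) \<omega>) * indicator {0..} t) \<partial>lborel) \<le> indicator (B n) \<omega> * occ {0..} A \<omega>"
          by (cases "\<omega> \<in> G") (auto simp: G_def)
      qed
      \<comment> \<open>On \<open>B n - I\<close> occupation is traded for its square plus a
        constant. Scaling the weight by \<open>1 / \<alpha>\<close> makes both error terms linear in
        \<open>\<alpha>\<close>, like the main term.\<close>
      also have "\<dots> \<le> (\<integral>\<^sup>+\<omega>. indicator I \<omega> * occ {0..} A \<omega> + (ennreal (\<theta> / \<alpha>) * (occ {0..} A \<omega>)\<^sup>2 + ennreal (1 / (4 * (\<theta> / \<alpha>))) * indicator (B n - I) \<omega>) \<partial>M)"
      proof (rule nn_integral_mono)
        fix \<omega>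
        show "indicator (B n) \<omega> * occ {0..} A \<omega> \<le> indicator I \<omega> * occ {0..} A \<omega> + (ennreal (\<theta> / \<alpha>) * (occ {0..} A \<omega>)\<^sup>2 + ennreal (1 / (4 * (\<theta> / \<alpha>))) * indicator (B n - I) \<omega>)"
        proof (cases "\<omega> \<in> B n - I")
          case True
          then show ?thesis using ennreal_le_square[of "\<theta> / \<alpha>" "occ {0..} A \<omega>"] \<theta> \<alpha>0 by simp
        next
          case False
          then show ?thesis by (intro add_increasing2) (auto simp: indicator_def)
        qed
      qed
      also have "\<dots> = (\<integral>\<^sup>+\<omega>. indicator I \<omega> * occ {0..} A \<omega> \<partial>M) + (ennreal (\<theta> / \<alpha>) * (\<integral>\<^sup>+\<omega>. (occ {0..} A \<omega>)\<^sup>2 \<partial>M) + ennreal (1 / (4 * (\<theta> / \<alpha>))) * ennreal (prob (B n - I)))"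
        by (simp add: nn_integral_add nn_integral_cmult nn_integral_cmult_indicator emeasure_eq_measure)
      also have "\<dots> \<le> (\<integral>\<^sup>+\<omega>. indicator I \<omega> * occ {0..} A \<omega> \<partial>M) + (ennreal (\<theta> / \<alpha>) * ennreal (2 * (C * \<alpha>)\<^sup>2) + ennreal (1 / (4 * (\<theta> / \<alpha>))) * ennreal (q * c * \<theta> / 2))"
      proof (intro add_left_mono add_mono mult_left_mono ennreal_leI diff)
        have "(\<integral>\<^sup>+\<omega>. (occ {0..} A \<omega>)\<^sup>2 \<partial>M) \<le> 2 * (ennreal C * emeasure lborel A)\<^sup>2"
          using C by (intro second_moment_density) auto
        also have "\<dots> = ennreal (2 * (C * \<alpha>)\<^sup>2)"
          using C(1) \<alpha> by (subst ennreal_mult) (auto simp: ennreal_mult[symmetric] ennreal_power)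
        finally show "(\<integral>\<^sup>+\<omega>. (occ {0..} A \<omega>)\<^sup>2 \<partial>M) \<le> ennreal (2 * (C * \<alpha>)\<^sup>2)" .
      qed auto
      also have "ennreal (\<theta> / \<alpha>) * ennreal (2 * (C * \<alpha>)\<^sup>2) + ennreal (1 / (4 * (\<theta> / \<alpha>))) * ennreal (q * c * \<theta> / 2) = ennreal (q * c / 4 * \<alpha>)"
      proof -
        have "ennreal (\<theta> / \<alpha>) * ennreal (2 * (C * \<alpha>)\<^sup>2) + ennreal (1 / (4 * (\<theta> / \<alpha>))) * ennreal (q * c * \<theta> / 2)
          = ennreal (\<theta> / \<alpha> * (2 * (C * \<alpha>)\<^sup>2)) + ennreal (1 / (4 * (\<theta> / \<alpha>)) * (q * c * \<theta> / 2))"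
          using \<theta> \<alpha>0 q c(1) by (intro arg_cong2[where f = "(+)"] ennreal_mult[symmetric]) auto
        also have "\<dots> = ennreal (\<theta> / \<alpha> * (2 * (C * \<alpha>)\<^sup>2) + 1 / (4 * (\<theta> / \<alpha>)) * (q * c * \<theta> / 2))"
          using \<theta> \<alpha>0 q c(1) by (intro ennreal_plus[symmetric] mult_nonneg_nonneg) auto
        also have "\<theta> / \<alpha> * (2 * (C * \<alpha>)\<^sup>2) = q * c / 8 * \<alpha>"
          using C(1) \<alpha>0 by (simp add: \<theta>_def power2_eq_square)
        also have "1 / (4 * (\<theta> / \<alpha>)) * (q * c * \<theta> / 2) = q * c / 8 * \<alpha>"
          using \<theta> \<alpha>0 by (simp add: field_simps)
        finally show ?thesis by (simp add: mult_ac)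
      qed
      finally have main: "ennreal (q / 2) * ennreal (c * \<alpha>) \<le> (\<integral>\<^sup>+\<omega>. indicator I \<omega> * occ {0..} A \<omega> \<partial>M) + ennreal (q * c / 4 * \<alpha>)" .
      have split: "ennreal (q / 2) * ennreal (c * \<alpha>) = ennreal (q * c / 4 * \<alpha>) + ennreal (q * c / 4 * \<alpha>)"
      proof -
        have "ennreal (q / 2) * ennreal (c * \<alpha>) = ennreal (q / 2 * (c * \<alpha>))"
          using q c(1) \<alpha>0 by (intro ennreal_mult[symmetric]) auto
        also have "q / 2 * (c * \<alpha>) = q * c / 4 * \<alpha> + q * c / 4 * \<alpha>" by simp
        also have "ennreal \<dots> = ennreal (q * c / 4 * \<alpha>) + ennreal (q * c / 4 * \<alpha>)"
          using q c(1) \<alpha>0 by (intro ennreal_plus) auto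
        finally show ?thesis .
      qed
      have "ennreal (q * c / 4 * \<alpha>) \<le> (\<integral>\<^sup>+\<omega>. indicator I \<omega> * occ {0..} A \<omega> \<partial>M)"
        using main unfolding split by (subst (asm) ennreal_add_left_cancel_le[symmetric] | simp add: add.commute ennreal_add_left_cancel_le)+
      moreover have "ennreal (q * c / 4) * emeasure lborel A = ennreal (q * c / 4 * \<alpha>)"
        unfolding \<alpha>(1) using q c(1) \<alpha>(2) by (intro ennreal_mult[symmetric]) auto
      ultimately show ?thesis unfolding I_def by simp
    qed
  qed
qed

text \<open>A finite integral lies below some natural number \<open>K\<close>, so it suffices to
  exclude each \<open>K\<close>. On the event that the integral is at most \<open>K\<close> its
  expectation is at most \<open>K\<close>, whereas \<open>occ_on_event_ge\<close> makes it dominate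
  a multiple of the divergent integral of \<open>g\<close>.\<close>

lemma integral_infinite:
  assumes [measurable]: "g \<in> borel_measurable borel"
    and inf: "\<And>a. (\<integral>\<^sup>+x\<in>{a..}. g x \<partial>lborel) = \<infinity>"
  shows "AE \<omega> in M. (\<integral>\<^sup>+t\<in>{0..}. g (Y t \<omega>) \<partial>lborel) = \<infinity>"
proof -
  let ?J = "\<lambda>\<omega>. \<integral>\<^sup>+t\<in>{0..}. g (Y t \<omega>) \<partial>lborel"
  have "AE \<omega> in M. \<not> ?J \<omega> \<le> of_nat K" for K :: nat
  proof (rule ccontr)
    assume notAE: "\<not> (AE \<omega> in M. \<not> ?J \<omega> \<le> of_nat K)"
    define B where "B n = {\<omega> \<in> space M. (\<integral>\<^sup>+t\<in>{0..<real n}. g (Y t \<omega>) \<partial>lborel) \<le> of_nat K}" for n :: nat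
    have BF: "B n \<in> sets (F (real n))" for n
    proof -
      have [measurable]: "(\<lambda>(\<omega>, t). Y (min t (real n)) \<omega>) \<in> borel_measurable (F (real n) \<Otimes>\<^sub>M lborel)"
        using joint_measurable_F by simp
      have "(\<lambda>\<omega>. \<integral>\<^sup>+t. g ((\<lambda>(\<omega>, t). Y (min t (real n)) \<omega>) (\<omega>, t)) * indicator {0..<real n} t \<partial>lborel) \<in> borel_measurable (F (real n))"
        by measurable
      then have [measurable]: "(\<lambda>\<omega>. \<integral>\<^sup>+t\<in>{0..<real n}. g (Y (min t (real n)) \<omega>) \<partial>lborel) \<in> borel_measurable (F (real n))"
        by simp
      have eq: "(\<integral>\<^sup>+t\<in>{0..<real n}. g (Y t \<omega>) \<partial>lborel) = (\<integral>\<^sup>+t\<in>{0..<real n}. g (Y (min t (real n)) \<omega>) \<partial>lborel)" for \<omega>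
        by (intro nn_integral_cong) (auto simp: indicator_def min_def)
      have "{\<omega> \<in> space (F (real n)). (\<integral>\<^sup>+t\<in>{0..<real n}. g (Y (min t (real n)) \<omega>) \<partial>lborel) \<le> of_nat K} \<in> sets (F (real n))"
        by measurable
      then show ?thesis unfolding B_def eq by simp
    qed
    have dec: "decseq B"
    proof (rule decseq_SucI)
      fix n
      have "(\<integral>\<^sup>+t\<in>{0..<real n}. g (Y t \<omega>) \<partial>lborel) \<le> (\<integral>\<^sup>+t\<in>{0..<real (Suc n)}. g (Y t \<omega>) \<partial>lborel)" for \<omega>
        by (intro nn_integral_mono) (auto simp: indicator_def)
      then show "B (Suc n) \<subseteq> B n" unfolding B_def using order_trans by blast
    qed
    have I: "(\<Inter>n. B n) = {\<omega> \<in> space M. ?J \<omega> \<le> of_nat K}"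
    proof -
      have "?J \<omega> \<le> of_nat K \<longleftrightarrow> (\<forall>n::nat. (\<integral>\<^sup>+t\<in>{0..<real n}. g (Y t \<omega>) \<partial>lborel) \<le> of_nat K)" if [measurable]: "\<omega> \<in> space M" for \<omega>
        by (subst nn_integral_horizon) (simp_all add: SUP_le_iff)
      then show ?thesis by (auto simp: B_def)
    qed
    have [measurable]: "(\<Inter>n. B n) \<in> sets M" unfolding I by measurable
    have "prob (\<Inter>n. B n) \<noteq> 0"
    proof
      assume "prob (\<Inter>n. B n) = 0"
      then have "(\<Inter>n. B n) \<in> null_sets M" by (auto simp: null_sets_def emeasure_eq_measure)
      from AE_not_in[OF this] AE_space have "AE \<omega> in M. \<not> ?J \<omega> \<le> of_nat K"
        unfolding I by eventually_elim simp
      with notAE show False by simp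
    qed
    then have "0 < prob (\<Inter>n. B n)" using measure_nonneg[of M "\<Inter>n. B n"] by linarith
    then obtain c R where c: "0 < c"
      "\<And>A. A \<in> sets borel \<Longrightarrow> A \<subseteq> {R..} \<Longrightarrow> emeasure lborel A < \<infinity> \<Longrightarrow>
        ennreal c * emeasure lborel A \<le> (\<integral>\<^sup>+\<omega>. indicator (\<Inter>n. B n) \<omega> * occ {0..} A \<omega> \<partial>M)"
      using occ_on_event_ge[OF BF dec] by metis
    let ?I = "\<Inter>n. B n"
    \<comment> \<open>The mean occupation measure restricted to the event, as a measure on the line,
      so that a bound on sets turns into a bound on integrals of \<open>g\<close>.\<close>
    define \<nu> where "\<nu> = distr (density (M \<Otimes>\<^sub>M lborel) (\<lambda>x. indicator ?I (fst x) * indicator {0..} (snd x))) borel (\<lambda>x. Y (snd x) (fst x))"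
    have sets_\<nu>: "sets \<nu> = sets borel" by (simp add: \<nu>_def)
    have \<nu>: "(\<integral>\<^sup>+x. h x \<partial>\<nu>) = (\<integral>\<^sup>+\<omega>. indicator ?I \<omega> * (\<integral>\<^sup>+t\<in>{0..}. h (Y t \<omega>) \<partial>lborel) \<partial>M)"
      if [measurable]: "h \<in> borel_measurable borel" for h
    proof -
      have "(\<integral>\<^sup>+x. h x \<partial>\<nu>) = (\<integral>\<^sup>+x. indicator ?I (fst x) * indicator {0..} (snd x) * h (Y (snd x) (fst x)) \<partial>(M \<Otimes>\<^sub>M lborel))"
        unfolding \<nu>_def by (subst nn_integral_distr) (simp_all add: nn_integral_density)
      also have "\<dots> = (\<integral>\<^sup>+\<omega>. (\<integral>\<^sup>+t. indicator ?I \<omega> * (h (Y t \<omega>) * indicator {0..} t) \<partial>lborel) \<partial>M)"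
        by (subst lborel.nn_integral_fst[symmetric]) (simp_all add: mult_ac)
      also have "\<dots> = (\<integral>\<^sup>+\<omega>. indicator ?I \<omega> * (\<integral>\<^sup>+t\<in>{0..}. h (Y t \<omega>) \<partial>lborel) \<partial>M)"
        by (intro nn_integral_cong nn_integral_cmult) measurable
      finally show ?thesis .
    qed
    \<comment> \<open>The comparison is available for sets of finite measure only; the half-line is
      therefore exhausted by bounded intervals.\<close>
    have "ennreal c * (\<integral>\<^sup>+x\<in>{R..R + real k}. g x \<partial>lborel) \<le> of_nat K" for k :: nat
    proof -
      let ?L = "density lborel (\<lambda>x. ennreal c * indicator {R..R + real k} x)"
      have "?L \<le> \<nu>"
      proof (subst le_measure, simp add: sets_\<nu>, intro ballI)
        fix A assume "A \<in> sets ?L"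
        then have [measurable]: "A \<in> sets borel" by simp
        let ?A = "A \<inter> {R..R + real k}"
        have "emeasure ?L A = (\<integral>\<^sup>+x. ennreal c * indicator ?A x \<partial>lborel)"
          by (subst emeasure_density) (auto intro!: nn_integral_cong simp: indicator_def)
        also have "\<dots> = ennreal c * emeasure lborel ?A" by (rule nn_integral_cmult_indicator) simp
        also have "\<dots> \<le> (\<integral>\<^sup>+\<omega>. indicator ?I \<omega> * occ {0..} ?A \<omega> \<partial>M)"
        proof (rule c)
          have "emeasure lborel ?A \<le> emeasure lborel {R..R + real k}" by (rule emeasure_mono) auto
          also have "\<dots> < \<infinity>" by simp
          finally show "emeasure lborel ?A < \<infinity>" .
        qed auto
        also have "\<dots> \<le> (\<integral>\<^sup>+\<omega>. indicator ?I \<omega> * (\<integral>\<^sup>+t\<in>{0..}. indicator A (Y t \<omega>) \<partial>lborel) \<partial>M)"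
          unfolding occ_def by (intro nn_integral_mono mult_left_mono mult_right_mono) (auto simp: indicator_def)
        also have "\<dots> = (\<integral>\<^sup>+x. indicator A x \<partial>\<nu>)" by (rule \<nu>[symmetric]) simp
        also have "\<dots> = emeasure \<nu> A" by (rule nn_integral_indicator) (simp add: sets_\<nu>)
        finally show "emeasure ?L A \<le> emeasure \<nu> A" .
      qed
      then have "(\<integral>\<^sup>+x. g x \<partial>?L) \<le> (\<integral>\<^sup>+x. g x \<partial>\<nu>)"
        by (intro nn_integral_mono_measure) (auto simp: sets_\<nu>)
      also have "\<dots> = (\<integral>\<^sup>+\<omega>. indicator ?I \<omega> * ?J \<omega> \<partial>M)" by (rule \<nu>) simp
      also have "\<dots> \<le> (\<integral>\<^sup>+\<omega>. of_nat K \<partial>M)"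
        by (intro nn_integral_mono) (auto simp: I indicator_def)
      also have "\<dots> = of_nat K" by (simp add: emeasure_space_1)
      finally show ?thesis
        by (subst (asm) nn_integral_density) (auto simp: nn_integral_cmult mult_ac)
    qed
    then have "(SUP k. ennreal c * (\<integral>\<^sup>+x\<in>{R..R + real k}. g x \<partial>lborel)) \<le> of_nat K"
      by (intro SUP_least)
    moreover have "(SUP k. ennreal c * (\<integral>\<^sup>+x\<in>{R..R + real k}. g x \<partial>lborel)) = ennreal c * (\<integral>\<^sup>+x\<in>{R..}. g x \<partial>lborel)"
    proof -
      have "(SUP k. \<integral>\<^sup>+x\<in>{R..R + real k}. g x \<partial>lborel) = (\<integral>\<^sup>+x. (SUP k. g x * indicator {R..R + real k} x) \<partial>lborel)"
        by (rule nn_integral_monotone_convergence_SUP[symmetric])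
           (auto simp: incseq_def le_fun_def indicator_def)
      also have "\<dots> = (\<integral>\<^sup>+x\<in>{R..}. g x \<partial>lborel)"
      proof (rule nn_integral_cong)
        fix x
        show "(SUP k. g x * indicator {R..R + real k} x) = g x * indicator {R..} x"
        proof (rule antisym)
          obtain m :: nat where "x - R \<le> real m" using real_arch_simple by blast
          then show "g x * indicator {R..} x \<le> (SUP k. g x * indicator {R..R + real k} x)"
            by (intro SUP_upper2[of m]) (auto simp: indicator_def)
        qed (auto intro!: SUP_least simp: indicator_def)
      qed
      finally show ?thesis by (subst SUP_mult_left_ennreal[symmetric]) simp
    qed
    ultimately have "ennreal c * \<infinity> \<le> of_nat K" unfolding inf by simp
    then show False using c(1) by (auto simp: ennreal_mult_top top_unique)
  qed
  then have "AE \<omega> in M. \<forall>K::nat. \<not> ?J \<omega> \<le> of_nat K" by (subst AE_all_countable) auto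
  then show ?thesis
  proof eventually_elim
    fix \<omega> assume *: "\<forall>K::nat. \<not> ?J \<omega> \<le> of_nat K"
    show "?J \<omega> = \<infinity>"
    proof (rule ccontr)
      assume "?J \<omega> \<noteq> \<infinity>"
      then obtain K :: nat where "?J \<omega> < of_nat K" using ennreal_Ex_less_of_nat[of "?J \<omega>"] by (auto simp: less_top)
      with * show False using less_imp_le by blast
    qed
  qed
qed

end

text \<open>The density \<open>l\<close> is not assumed measurable, so its integrals are lower integrals; they coincide
  with those of a measurable minorant, which is then a density of \<open>N\<close>.\<close>

lemma null_sets_of_lower_integral_density:
  fixes N :: "real measure" and l :: "real \<Rightarrow> ennreal"
  assumes N: "sets N = sets borel" and fin: "emeasure N UNIV < \<infinity>"
    and total: "emeasure N UNIV = (\<integral>\<^sup>+x. l x \<partial>lborel)"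
    and left: "\<And>q. q \<in> \<rat> \<Longrightarrow> emeasure N {..q} = (\<integral>\<^sup>+x. indicator {..q} x * l x \<partial>lborel)"
    and right: "\<And>q. q \<in> \<rat> \<Longrightarrow> emeasure N {q<..} = (\<integral>\<^sup>+x. indicator {q<..} x * l x \<partial>lborel)"
    and Z: "Z \<in> null_sets lborel"
  shows "emeasure N Z = 0"
proof -
  let ?S = "{g. simple_function lborel g \<and> g \<le> l}"
  have "(\<lambda>_. 0) \<in> ?S" by (auto simp: le_fun_def)
  then have "integral\<^sup>S lborel ` ?S \<noteq> {}" by blast
  \<comment> \<open>The integral is a supremum over simple functions below \<open>l\<close>. A
    sequence of them approaches it, and its pointwise supremum is the measurable minorant.\<close>
  from ennreal_Sup_countable_SUP[OF this] obtain r :: "nat \<Rightarrow> ennreal"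
    where r: "range r \<subseteq> integral\<^sup>S lborel ` ?S" "(SUP g\<in>?S. integral\<^sup>S lborel g) = (SUP i. r i)"
    by auto
  have "\<forall>i. \<exists>g. simple_function lborel g \<and> g \<le> l \<and> r i = integral\<^sup>S lborel g"
  proof
    fix i
    have "r i \<in> integral\<^sup>S lborel ` ?S" using r(1) by blast
    then show "\<exists>g. simple_function lborel g \<and> g \<le> l \<and> r i = integral\<^sup>S lborel g" by blast
  qed
  from choice[OF this] obtain g where g: "\<And>i. simple_function lborel (g i)" "\<And>i. g i \<le> l" "\<And>i. r i = integral\<^sup>S lborel (g i)"
    by blast
  define l' where "l' x = (SUP i. g i x)" for x
  have gm [measurable]: "g i \<in> borel_measurable borel" for i
    using borel_measurable_simple_function[OF g(1)[of i]] by simp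
  have l'm [measurable]: "l' \<in> borel_measurable borel"
    unfolding l'_def by measurable
  have l'_le: "l' x \<le> l x" for x
    unfolding l'_def using g(2) by (intro SUP_least) (auto simp: le_fun_def)
  have l'_total: "(\<integral>\<^sup>+x. l' x \<partial>lborel) = emeasure N UNIV"
  proof (rule antisym)
    show "(\<integral>\<^sup>+x. l' x \<partial>lborel) \<le> emeasure N UNIV"
      unfolding total by (intro nn_integral_mono l'_le)
    have "emeasure N UNIV = (SUP i. r i)"
      unfolding total nn_integral_def r(2) ..
    also have "\<dots> \<le> (\<integral>\<^sup>+x. l' x \<partial>lborel)"
    proof (rule SUP_least)
      fix i
      have "r i = (\<integral>\<^sup>+x. g i x \<partial>lborel)"
        unfolding g(3) by (rule nn_integral_eq_simple_integral[symmetric]) (rule g(1))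
      also have "\<dots> \<le> (\<integral>\<^sup>+x. l' x \<partial>lborel)"
        unfolding l'_def by (intro nn_integral_mono SUP_upper) simp
      finally show "r i \<le> (\<integral>\<^sup>+x. l' x \<partial>lborel)" .
    qed
    finally show "emeasure N UNIV \<le> (\<integral>\<^sup>+x. l' x \<partial>lborel)" .
  qed
  let ?D = "density lborel l'"
  have D: "emeasure ?D A = (\<integral>\<^sup>+x. indicator A x * l' x \<partial>lborel)" if "A \<in> sets borel" for A
    using that by (subst emeasure_density) (auto simp: mult.commute)
  \<comment> \<open>On each of the two complementary half-lines the minorant has at most the mass of
    \<open>N\<close>; the totals agree and are finite, so neither inequality can be strict. This is
    why both half-lines are assumed: lower integrals need not be additive.\<close>
  have rat: "emeasure N {q<..} = emeasure ?D {q<..}" if "q \<in> \<rat>" for q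
  proof -
    have le1: "emeasure ?D {..q} \<le> emeasure N {..q}" and le2: "emeasure ?D {q<..} \<le> emeasure N {q<..}"
      unfolding left[OF that] right[OF that] by (simp_all add: D nn_integral_mono mult_left_mono l'_le)
    have U: "{..q} \<union> {q<..} = (UNIV :: real set)" "{..q} \<inter> {q<..} = {}" by auto
    have sN: "emeasure N {..q} + emeasure N {q<..} = emeasure N UNIV"
      using plus_emeasure[of "{..q}" N "{q<..}"] U N by simp
    have sD: "emeasure ?D {..q} + emeasure ?D {q<..} = emeasure N UNIV"
    proof -
      have "emeasure ?D {..q} + emeasure ?D {q<..} = emeasure ?D UNIV"
        using plus_emeasure[of "{..q}" ?D "{q<..}"] U by simp
      also have "\<dots> = emeasure N UNIV" by (simp add: D l'_total)
      finally show ?thesis .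
    qed
    have "emeasure N {..q} \<le> emeasure N UNIV" by (intro emeasure_mono) (auto simp: N)
    then have "emeasure N {..q} \<noteq> \<top>" using fin by (auto simp: top_unique)
    moreover have "emeasure N {..q} + emeasure N {q<..} \<le> emeasure N {..q} + emeasure ?D {q<..}"
      unfolding sN sD[symmetric] using le1 by (rule add_right_mono)
    ultimately have "emeasure N {q<..} \<le> emeasure ?D {q<..}"
      by (simp add: ennreal_add_left_cancel_le)
    with le2 show ?thesis by simp
  qed
  have "N = ?D"
  proof (rule measure_eqI_lessThan)
    fix x :: real
    have "emeasure N {x<..} \<le> emeasure N UNIV" by (intro emeasure_mono) (auto simp: N)
    then show "emeasure N {x<..} < \<infinity>" using fin by (rule le_less_trans)
    \<comment> \<open>Squeezing the rationals between consecutive values makes them strictly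
      decreasing to \<open>x\<close> from above, so the open half-lines increase to
      \<open>{x<..}\<close>.\<close>
    have "\<exists>q\<in>\<rat>. x + 1 / real (n + 2) < q \<and> q < x + 1 / real (n + 1)" for n :: nat
      by (rule Rats_dense_in_real) (simp add: field_simps)
    then obtain q where q: "\<And>n. q n \<in> \<rat>" "\<And>n. x + 1 / real (n + 2) < q n" "\<And>n. q n < x + 1 / real (n + 1)"
      by metis
    have inc: "incseq (\<lambda>n. {q n<..})"
    proof (rule incseq_SucI)
      fix n
      have "q (Suc n) < q n" using q(2)[of n] q(3)[of "Suc n"] by (simp add: add.commute)
      then show "{q n<..} \<subseteq> {q (Suc n)<..}" by auto
    qed
    have un: "(\<Union>n. {q n<..}) = {x<..}"
    proof safe
      fix y n assume "q n < y"
      moreover have "0 < 1 / real (n + 2)" by simp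
      ultimately show "x < y" using q(2)[of n] by linarith
    next
      fix y assume "x < y"
      then obtain n where "inverse (real (Suc n)) < y - x" using reals_Archimedean[of "y - x"] by auto
      then have "q n < y" using q(3)[of n] by (simp add: inverse_eq_divide)
      then show "y \<in> (\<Union>n. {q n<..})" by auto
    qed
    have "emeasure N {x<..} = (SUP n. emeasure N {q n<..})"
      unfolding un[symmetric] using inc by (intro SUP_emeasure_incseq[symmetric]) (auto simp: N)
    also have "\<dots> = (SUP n. emeasure ?D {q n<..})" by (simp add: rat[OF q(1)])
    also have "\<dots> = emeasure ?D {x<..}"
      unfolding un[symmetric] using inc by (intro SUP_emeasure_incseq) auto
    finally show "emeasure N {x<..} = emeasure ?D {x<..}" .
  qed (auto simp: N)
  moreover have "emeasure ?D Z = 0"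
    using Z absolutely_continuousI_density[of l' lborel] by (auto simp: absolutely_continuous_def)
  ultimately show ?thesis by simp
qed

text \<open>The exceptional event in the occupation formula depends on the test function. Only
  countably many are used, the line and the rational half-lines, and they determine the finite
  occupation measure on each \<open>{0..real n}\<close>; so one almost sure event serves all null
  sets.\<close>

lemma (in levy_paths) occ_null_of_local_times:
  fixes L :: "real \<Rightarrow> real \<Rightarrow> 'a \<Rightarrow> real"
  assumes L: "\<And>g :: real \<Rightarrow> real. g \<in> borel_measurable borel \<Longrightarrow> (\<And>x. 0 \<le> g x) \<Longrightarrow> bounded (range g) \<Longrightarrow>
    AE \<omega> in M. \<forall>t\<ge>0. (\<integral>\<^sup>+s\<in>{0..t}. ennreal (g (Y s \<omega>)) \<partial>lborel) = (\<integral>\<^sup>+x. ennreal (g x) * ennreal (L t x \<omega>) \<partial>lborel)"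
  shows "AE \<omega> in M. \<forall>Z\<in>null_sets lborel. occ {0..} Z \<omega> = 0"
proof -
  have ind: "AE \<omega> in M. \<forall>t\<ge>0. occ {0..t} A \<omega> = (\<integral>\<^sup>+x. indicator A x * ennreal (L t x \<omega>) \<partial>lborel)"
    if [measurable]: "A \<in> sets borel" for A
  proof -
    have "bounded (range (indicat_real A))"
      by (intro boundedI[of _ 1]) (auto simp: indicator_def)
    from L[of "indicat_real A", OF _ _ this] show ?thesis by (simp add: occ_def ennreal_indicator)
  qed
  have "AE \<omega> in M. \<forall>q\<in>\<rat>. (\<forall>t\<ge>0. occ {0..t} {..q} \<omega> = (\<integral>\<^sup>+x. indicator {..q} x * ennreal (L t x \<omega>) \<partial>lborel)) \<and>
      (\<forall>t\<ge>0. occ {0..t} {q<..} \<omega> = (\<integral>\<^sup>+x. indicator {q<..} x * ennreal (L t x \<omega>) \<partial>lborel))"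
    using ind by (subst AE_ball_countable[OF countable_rat]) auto
  moreover have "AE \<omega> in M. \<forall>t\<ge>0. occ {0..t} UNIV \<omega> = (\<integral>\<^sup>+x. indicator UNIV x * ennreal (L t x \<omega>) \<partial>lborel)"
    by (rule ind) simp
  ultimately show ?thesis using AE_space
  proof eventually_elim
    fix \<omega>
    assume half: "\<forall>q\<in>\<rat>. (\<forall>t\<ge>0. occ {0..t} {..q} \<omega> = (\<integral>\<^sup>+x. indicator {..q} x * ennreal (L t x \<omega>) \<partial>lborel)) \<and>
      (\<forall>t\<ge>0. occ {0..t} {q<..} \<omega> = (\<integral>\<^sup>+x. indicator {q<..} x * ennreal (L t x \<omega>) \<partial>lborel))"
      and total: "\<forall>t\<ge>0. occ {0..t} UNIV \<omega> = (\<integral>\<^sup>+x. indicator UNIV x * ennreal (L t x \<omega>) \<partial>lborel)"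
      and \<omega>: "\<omega> \<in> space M"
    have [measurable]: "(\<lambda>t. Y t \<omega>) \<in> borel_measurable borel" using \<omega> by measurable
    show "\<forall>Z\<in>null_sets lborel. occ {0..} Z \<omega> = 0"
    proof
      fix Z :: "real set" assume Z: "Z \<in> null_sets lborel"
      then have [measurable]: "Z \<in> sets borel" by auto
      have "occ {0..real n} Z \<omega> = 0" for n
      proof -
        define N where "N = distr (density lborel (indicator {0..real n})) borel (\<lambda>t. Y t \<omega>)"
        have NA: "emeasure N A = occ {0..real n} A \<omega>" if [measurable]: "A \<in> sets borel" for A
        proof -
          have "emeasure N A = (\<integral>\<^sup>+x. indicator A x \<partial>N)" by (simp add: N_def)
          also have "\<dots> = (\<integral>\<^sup>+t. indicator {0..real n} t * indicator A (Y t \<omega>) \<partial>lborel)"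
            unfolding N_def by (subst nn_integral_distr) (simp_all add: nn_integral_density)
          finally show ?thesis by (simp add: occ_def mult.commute)
        qed
        have "emeasure N Z = 0"
        proof (rule null_sets_of_lower_integral_density)
          show "sets N = sets borel" by (simp add: N_def)
          show "emeasure N UNIV < \<infinity>" by (subst NA) (auto simp: occ_def)
          show "emeasure N UNIV = (\<integral>\<^sup>+x. ennreal (L (real n) x \<omega>) \<partial>lborel)"
            using total by (subst NA) auto
          show "emeasure N {..q} = (\<integral>\<^sup>+x. indicator {..q} x * ennreal (L (real n) x \<omega>) \<partial>lborel)" if "q \<in> \<rat>" for q
            using half that by (subst NA) auto
          show "emeasure N {q<..} = (\<integral>\<^sup>+x. indicator {q<..} x * ennreal (L (real n) x \<omega>) \<partial>lborel)" if "q \<in> \<rat>" for q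
            using half that by (subst NA) auto
        qed (rule Z)
        then show ?thesis by (simp add: NA)
      qed
      moreover have "occ {0..<real n} Z \<omega> \<le> occ {0..real n} Z \<omega>" for n
        unfolding occ_def by (intro nn_integral_mono) (auto simp: indicator_def)
      ultimately have "occ {0..<real n} Z \<omega> = 0" for n by (metis le_zero_eq)
      then show "occ {0..} Z \<omega> = 0"
        unfolding occ_def by (subst nn_integral_horizon) auto
    qed
  qed
qed

section \<open>Transfer to the given process\<close>

text \<open>Subtracting \<open>X 0\<close> makes every path start at 0, not just almost every one.
  Increments do not change, and the law at a fixed time agrees because the two versions differ on a
  null event only.\<close>

lemma levy_process_imp_levy_paths:
  assumes levy: "levy_process M X"
  shows "levy_paths M (\<lambda>t \<omega>. X (max 0 t) \<omega> - X 0 \<omega>)" (is "levy_paths M ?Y")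
proof -
  interpret prob_space M using levy by (simp add: levy_process_def)
  have X [measurable]: "X t \<in> borel_measurable M" if "0 \<le> t" for t
    using levy that by (simp add: levy_process_def)
  have X0: "AE \<omega> in M. X 0 \<omega> = 0"
    using levy by (simp add: levy_process_def)
  show ?thesis
  proof unfold_locales
    show "?Y t \<in> borel_measurable M" for t
      using X[of "max 0 t"] X[of 0] by (intro borel_measurable_diff) auto
    show "?Y t \<omega> = 0" if "t \<le> 0" for t \<omega> using that by (simp add: max_def)
    show "((\<lambda>s. ?Y s \<omega>) \<longlongrightarrow> ?Y t \<omega>) (at_right t)" if "\<omega> \<in> space M" for \<omega> t
    proof (cases "0 \<le> t")
      case True
      have "((\<lambda>s. X s \<omega>) \<longlongrightarrow> X t \<omega>) (at_right t)"
        using levy that True by (auto simp: levy_process_def)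
      moreover have "\<forall>\<^sub>F s in at_right t. X s \<omega> = X (max 0 s) \<omega>"
        unfolding eventually_at_right_field using True by (intro exI[of _ "t + 1"]) (auto simp: max_def)
      ultimately have "((\<lambda>s. X (max 0 s) \<omega>) \<longlongrightarrow> X t \<omega>) (at_right t)"
        by (rule Lim_transform_eventually)
      then show ?thesis using True by (intro tendsto_diff tendsto_const) (simp add: max_def)
    next
      case False
      then have "\<forall>\<^sub>F s in at_right t. ?Y t \<omega> = ?Y s \<omega>"
        unfolding eventually_at_right_field by (intro exI[of _ 0]) (auto simp: max_def)
      then show ?thesis by (rule Lim_transform_eventually[OF tendsto_const])
    qed
    show "indep_vars (\<lambda>_. borel) (\<lambda>i \<omega>. ?Y (tt (Suc i)) \<omega> - ?Y (tt i) \<omega>) (UNIV :: nat set)"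
      if tt: "incseq tt" "0 \<le> tt 0" for tt :: "nat \<Rightarrow> real"
    proof -
      have "max 0 (tt i) = tt i" for i
        using tt incseqD[OF tt(1), of 0 i] by simp
      moreover have "indep_vars (\<lambda>_. borel) (\<lambda>i \<omega>. X (tt (Suc i)) \<omega> - X (tt i) \<omega>) UNIV"
        using levy tt by (simp add: levy_process_def)
      ultimately show ?thesis by simp
    qed
    show "distr M borel (\<lambda>\<omega>. ?Y (s + t) \<omega> - ?Y s \<omega>) = distr M borel (?Y t)" if "0 \<le> s" "0 \<le> t" for s t
    proof -
      have "distr M borel (\<lambda>\<omega>. ?Y (s + t) \<omega> - ?Y s \<omega>) = distr M borel (X t)"
        using levy that by (simp add: levy_process_def)
      also have "\<dots> = distr M borel (?Y t)"
      proof (rule distr_cong_AE)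
        show "AE \<omega> in M. X t \<omega> = ?Y t \<omega>"
          using X0 by eventually_elim (use that in simp)
        show "?Y t \<in> borel_measurable M"
          using X[of "max 0 t"] X[of 0] by (intro borel_measurable_diff) auto
      qed (use that in auto)
      finally show ?thesis .
    qed
  qed
qed

text \<open>The two analytic alternatives exclude each other, and each forces its probability; hence
  two one-sided implications give all the equivalences.\<close>

theorem theorem1:
  fixes M :: "'a measure" and X :: "real \<Rightarrow> 'a \<Rightarrow> real" and f :: "real \<Rightarrow> real"
  assumes levy: "levy_process M X"
    and mean: "integrable M (X 1)" "(\<integral>\<omega>. X 1 \<omega> \<partial>M) > 0"
    and lt: "has_local_times M X"
    and not_cp: "\<not> compound_poisson_process M X"
    and f_meas: "f \<in> borel_measurable borel"
    and f_nonneg: "\<And>x. f x \<ge> 0"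
    and f_locint: "\<And>a b. (\<integral>\<^sup>+ x\<in>{a..b}. ennreal (f x) \<partial>lborel) < \<infinity>"
  defines "E \<equiv> {\<omega> \<in> space M. (\<integral>\<^sup>+ s\<in>{0..}. ennreal (f (X s \<omega>)) \<partial>lborel) < \<infinity>}"
  shows "E \<in> sets M
    \<and> (measure M E = 0 \<or> measure M E = 1)
    \<and> (measure M E = 1 \<longleftrightarrow> (\<exists>a. (\<integral>\<^sup>+ x\<in>{a..}. ennreal (f x) \<partial>lborel) < \<infinity>))
    \<and> (measure M E = 0 \<longleftrightarrow> (\<exists>a. (\<integral>\<^sup>+ x\<in>{a..}. ennreal (f x) \<partial>lborel) = \<infinity>))
    \<and> (measure M E = 0 \<longleftrightarrow> (\<forall>a. (\<integral>\<^sup>+ x\<in>{a..}. ennreal (f x) \<partial>lborel) = \<infinity>))"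
proof -
  define Y where "Y t \<omega> = X (max 0 t) \<omega> - X 0 \<omega>" for t \<omega>
  interpret levy_paths M Y
    using levy_process_imp_levy_paths[OF levy] unfolding Y_def[abs_def] .
  have X0m [measurable]: "X 0 \<in> borel_measurable M" and X1m: "X 1 \<in> borel_measurable M"
    using levy by (auto simp: levy_process_def)
  have X0: "AE \<omega> in M. X 0 \<omega> = 0"
    using levy by (simp add: levy_process_def)
  have XY: "X s \<omega> = Y s \<omega> + X 0 \<omega>" if "0 \<le> s" for s \<omega>
    using that by (simp add: Y_def)
  have Y1: "AE \<omega> in M. X 1 \<omega> = Y 1 \<omega>"
    using X0 by eventually_elim (simp add: Y_def)
  obtain L :: "real \<Rightarrow> real \<Rightarrow> 'a \<Rightarrow> real" where L: "\<And>g :: real \<Rightarrow> real. g \<in> borel_measurable borel \<Longrightarrow> (\<And>x. 0 \<le> g x) \<Longrightarrow> bounded (range g) \<Longrightarrow>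
    AE \<omega> in M. \<forall>t\<ge>0. (\<integral>\<^sup>+s\<in>{0..t}. ennreal (g (X s \<omega>)) \<partial>lborel) = (\<integral>\<^sup>+x. ennreal (g x) * ennreal (L t x \<omega>) \<partial>lborel)"
    using lt unfolding has_local_times_def by blast
  interpret local_time_levy M Y
  proof unfold_locales
    show "integrable M (Y 1)"
      using mean(1) X1m Y1 by (subst integrable_cong_AE[of _ _ "X 1"]) auto
    have "expectation (Y 1) = expectation (X 1)"
      using X1m Y1 by (intro integral_cong_AE) auto
    with mean(2) show "0 < expectation (Y 1)" by simp
    show "AE \<omega> in M. \<forall>N\<in>null_sets lborel. occ {0..} N \<omega> = 0"
    proof (rule occ_null_of_local_times)
      fix g :: "real \<Rightarrow> real" assume g: "g \<in> borel_measurable borel" "\<And>x. 0 \<le> g x" "bounded (range g)"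
      from L[OF g] X0 show "AE \<omega> in M. \<forall>t\<ge>0. (\<integral>\<^sup>+s\<in>{0..t}. ennreal (g (Y s \<omega>)) \<partial>lborel) = (\<integral>\<^sup>+x. ennreal (g x) * ennreal (L t x \<omega>) \<partial>lborel)"
      proof eventually_elim
        fix \<omega>
        assume *: "\<forall>t\<ge>0. (\<integral>\<^sup>+s\<in>{0..t}. ennreal (g (X s \<omega>)) \<partial>lborel) = (\<integral>\<^sup>+x. ennreal (g x) * ennreal (L t x \<omega>) \<partial>lborel)"
          and "X 0 \<omega> = 0"
        then have eq: "Y s \<omega> = X s \<omega>" if "0 \<le> s" for s
          using XY[OF that, of \<omega>] by simp
        have "(\<integral>\<^sup>+s\<in>{0..t}. ennreal (g (Y s \<omega>)) \<partial>lborel) = (\<integral>\<^sup>+s\<in>{0..t}. ennreal (g (X s \<omega>)) \<partial>lborel)" for t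
          by (intro nn_integral_cong) (simp add: eq indicator_def)
        with * show "\<forall>t\<ge>0. (\<integral>\<^sup>+s\<in>{0..t}. ennreal (g (Y s \<omega>)) \<partial>lborel) = (\<integral>\<^sup>+x. ennreal (g x) * ennreal (L t x \<omega>) \<partial>lborel)"
          by simp
      qed
    qed
  qed
  note f_meas [measurable]
  let ?J = "\<lambda>\<omega>. \<integral>\<^sup>+s\<in>{0..}. ennreal (f (X s \<omega>)) \<partial>lborel"
  \<comment> \<open>An identity for every outcome, with \<open>X 0\<close> kept: measurability of
    \<open>E\<close> is required in \<open>M\<close> itself, which may fail to be complete, so
    almost sure equality with the integral along \<open>Y\<close> would not suffice.\<close>
  have J: "?J \<omega> = (\<integral>\<^sup>+s\<in>{0..}. ennreal (f (Y s \<omega> + X 0 \<omega>)) \<partial>lborel)" for \<omega>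
    by (intro nn_integral_cong) (simp add: indicator_def flip: XY)
  have [measurable]: "?J \<in> borel_measurable M" unfolding J by measurable
  have E [measurable]: "E \<in> sets M" unfolding E_def by measurable
  have JY: "AE \<omega> in M. ?J \<omega> = (\<integral>\<^sup>+s\<in>{0..}. ennreal (f (Y s \<omega>)) \<partial>lborel)"
    using X0 unfolding J by eventually_elim simp
  \<comment> \<open>Local integrability makes finiteness independent of the left endpoint, so
    existence of one divergent endpoint and divergence at all endpoints coincide.\<close>
  have tail: "(\<integral>\<^sup>+x\<in>{b..}. ennreal (f x) \<partial>lborel) < \<infinity>" if "(\<integral>\<^sup>+x\<in>{a..}. ennreal (f x) \<partial>lborel) < \<infinity>" for a b
  proof -
    have "(\<integral>\<^sup>+x\<in>{b..}. ennreal (f x) \<partial>lborel) \<le> (\<integral>\<^sup>+x. ennreal (f x) * indicator {b..a} x + ennreal (f x) * indicator {a..} x \<partial>lborel)"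
      by (intro nn_integral_mono) (auto simp: indicator_def)
    also have "\<dots> = (\<integral>\<^sup>+x\<in>{b..a}. ennreal (f x) \<partial>lborel) + (\<integral>\<^sup>+x\<in>{a..}. ennreal (f x) \<partial>lborel)"
      by (rule nn_integral_add) measurable
    also have "\<dots> < \<infinity>" using f_locint[where a = b and b = a] that by simp
    finally show ?thesis .
  qed
  show ?thesis
  proof (cases "\<exists>a. (\<integral>\<^sup>+x\<in>{a..}. ennreal (f x) \<partial>lborel) < \<infinity>")
    case True
    then have fin: "(\<integral>\<^sup>+x\<in>{b..}. ennreal (f x) \<partial>lborel) < \<infinity>" for b using tail by blast
    have "AE \<omega> in M. (\<integral>\<^sup>+s\<in>{0..}. ennreal (f (Y s \<omega>)) \<partial>lborel) < \<infinity>"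
    proof (rule integral_finite)
      show "(\<lambda>x. ennreal (f x)) \<in> borel_measurable borel" by measurable
    qed (rule fin)
    with JY AE_space have "AE \<omega> in M. \<omega> \<in> E"
      by eventually_elim (simp add: E_def)
    then have "measure M E = 1" using E prob_eq_1 by blast
    moreover have "(\<integral>\<^sup>+x\<in>{b..}. ennreal (f x) \<partial>lborel) \<noteq> \<infinity>" for b using fin[of b] by simp
    ultimately show ?thesis using E fin by simp
  next
    case False
    then have inf: "(\<integral>\<^sup>+x\<in>{b..}. ennreal (f x) \<partial>lborel) = \<infinity>" for b by (simp add: not_less top_unique)
    have "AE \<omega> in M. (\<integral>\<^sup>+s\<in>{0..}. ennreal (f (Y s \<omega>)) \<partial>lborel) = \<infinity>"
    proof (rule integral_infinite)
      show "(\<lambda>x. ennreal (f x)) \<in> borel_measurable borel" by measurable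
    qed (rule inf)
    with JY have "AE \<omega> in M. \<omega> \<notin> E"
      by eventually_elim (simp add: E_def)
    then have "measure M E = 0" using E prob_eq_0 by blast
    then show ?thesis using E inf by simp
  qed
qed

end
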